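(* Let $M^3$ be an indefinite proper affine hypersphere of $\mathbb{R}^4$ (with $S=H\,\mathrm{Id}$, $H\neq0$ constant) which admits a pointwise $\mathrm{SO}(1,1)$-symmetry, and suppose $H=b_4^2-\alpha_{12}^2$ on $M^3$ (functions as in the context). Then $M^3$ is affine equivalent with $$\varphi:I\times N^2\to\mathbb{R}^4,\quad (v,x,y)\mapsto(\gamma_1(v)x,\ \gamma_1(v)y,\ \gamma_1(v)f(x,y)+\gamma_2(v),\ \gamma_1(v)),$$ where $\psi:N^2\to\mathbb{R}^3$, $(x,y)\mapsto(x,y,f(x,y))$, is a hyperbolic paraboloid with affine normal $(0,0,1)$ and $\gamma=(\gamma_1,\gamma_2):I\to\mathbb{R}^2$ is a curve.
   Context: Setting: $\varphi:M^3\to\mathbb{R}^4$ nondegenerate hypersurface with Blaschke normal $\xi$, $D_X\varphi_*Y=\varphi_*(\nabla_XY)+h(X,Y)\xi$, $D_X\xi=-\varphi_*(SX)$; $h$ affine metric (Lorentzian), $K=\nabla-\hat\nabla$ the difference tensor, $\hat\nabla$ the Levi-Civita connection of $h$. Affine hypersphere: $S=H\,\mathrm{Id}$, $H$ constant; proper if $H\ne 0$. Pointwise $G$-symmetry: for every $p$ the group of $h_p$-isometries $L$ of $T_pM$ with $\det L=1$ and $K_p(LX,LY)=LK_p(X,Y)$ is isomorphic to $G$. Under $\mathrm{SO}(1,1)$-symmetry, locally there is a frame $\{E,V,F\}$ with $h(E,E)=h(F,F)=0$, $h(E,F)=1$, $h(E,V)=h(F,V)=0$, $h(V,V)=1$,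 and a function $b_4>0$ with $K(V,V)=-2b_4V$, $K(V,E)=b_4E$, $K(V,F)=b_4F$, $K(E,E)=K(F,F)=0$, $K(E,F)=b_4V$; define $\alpha_{12}:=h(\hat\nabla_EV,F)$. *)

theory Defs
  imports "HOL-Analysis.Analysis" "HOL-Algebra.Group"
begin

fun Ck :: "nat \<Rightarrow> 'a::euclidean_space set \<Rightarrow> ('a \<Rightarrow> 'b::real_normed_vector) \<Rightarrow> bool" where
  "Ck 0 U f = continuous_on U f"
| "Ck (Suc k) U f = (f differentiable_on U \<and>
      (\<forall>i\<in>Basis. Ck k U (\<lambda>u. frechet_derivative f (at u) i)))"

definition smooth_on :: "'a::euclidean_space set \<Rightarrow> ('a \<Rightarrow> 'b::real_normed_vector) \<Rightarrow> bool" where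
  "smooth_on U f \<longleftrightarrow> (\<forall>k. Ck k U f)"

definition pd :: "(real^'n \<Rightarrow> 'b::real_normed_vector) \<Rightarrow> 'n \<Rightarrow> real^'n \<Rightarrow> 'b" where
  "pd f i u = frechet_derivative f (at u) (axis i 1)"

definition frame4 :: "real^4 \<Rightarrow> real^4 \<Rightarrow> real^4 \<Rightarrow> real^4 \<Rightarrow> real^4^4" where
  "frame4 a b c d = vector [a, b, c, d]"

text \<open>h u i j = h(d_i, d_j) at the point u; Gam u i j k = k-th component of
  nabla_{d_i} d_j; S u i k = k-th component of S d_i.\<close>

definition hmat :: "(real^3 \<Rightarrow> 3 \<Rightarrow> 3 \<Rightarrow> real) \<Rightarrow> real^3 \<Rightarrow> real^3^3" where
  "hmat h u = (\<chi> i j. h u i j)"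

definition hform :: "(real^3 \<Rightarrow> 3 \<Rightarrow> 3 \<Rightarrow> real) \<Rightarrow> real^3 \<Rightarrow> real^3 \<Rightarrow> real^3 \<Rightarrow> real" where
  "hform h u X Y = (\<Sum>i\<in>UNIV. \<Sum>j\<in>UNIV. X$i * Y$j * h u i j)"

definition lc_christoffel :: "(real^3 \<Rightarrow> 3 \<Rightarrow> 3 \<Rightarrow> real) \<Rightarrow> real^3 \<Rightarrow> 3 \<Rightarrow> 3 \<Rightarrow> 3 \<Rightarrow> real" where
  "lc_christoffel h u i j k = (1/2) * (\<Sum>l\<in>UNIV. matrix_inv (hmat h u) $ k $ l *
      (pd (\<lambda>w. h w j l) i u + pd (\<lambda>w. h w i l) j u - pd (\<lambda>w. h w i j) l u))"

definition lc_cov :: "(real^3 \<Rightarrow> 3 \<Rightarrow> 3 \<Rightarrow> real) \<Rightarrow> real^3 \<Rightarrow> real^3 \<Rightarrow> (real^3 \<Rightarrow> real^3) \<Rightarrow> real^3" where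
  "lc_cov h u X Y = (\<chi> k. (\<Sum>i\<in>UNIV. X$i * (pd Y i u)$k)
      + (\<Sum>i\<in>UNIV. \<Sum>j\<in>UNIV. X$i * (Y u)$j * lc_christoffel h u i j k))"

definition diff_tensor :: "(real^3 \<Rightarrow> 3 \<Rightarrow> 3 \<Rightarrow> 3 \<Rightarrow> real) \<Rightarrow> (real^3 \<Rightarrow> 3 \<Rightarrow> 3 \<Rightarrow> real)
     \<Rightarrow> real^3 \<Rightarrow> real^3 \<Rightarrow> real^3 \<Rightarrow> real^3" where
  "diff_tensor Gam h u X Y = (\<chi> k. \<Sum>i\<in>UNIV. \<Sum>j\<in>UNIV.
      X$i * Y$j * (Gam u i j k - lc_christoffel h u i j k))"

definition blaschke_hypersurface ::
  "(real^3) set \<Rightarrow> (real^3 \<Rightarrow> real^4) \<Rightarrow> (real^3 \<Rightarrow> real^4) \<Rightarrow> (real^3 \<Rightarrow> 3 \<Rightarrow> 3 \<Rightarrow> 3 \<Rightarrow> real)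
     \<Rightarrow> (real^3 \<Rightarrow> 3 \<Rightarrow> 3 \<Rightarrow> real) \<Rightarrow> (real^3 \<Rightarrow> 3 \<Rightarrow> 3 \<Rightarrow> real) \<Rightarrow> bool" where
  "blaschke_hypersurface U \<phi> \<xi> Gam h S \<longleftrightarrow>
     open U \<and> U \<noteq> {} \<and> smooth_on U \<phi> \<and> smooth_on U \<xi> \<and>
     (\<forall>u\<in>U. det (frame4 (pd \<phi> 1 u) (pd \<phi> 2 u) (pd \<phi> 3 u) (\<xi> u)) \<noteq> 0) \<and>
     (\<forall>u\<in>U. \<forall>i j. pd (pd \<phi> j) i u = (\<Sum>k\<in>UNIV. Gam u i j k *\<^sub>R pd \<phi> k u) + h u i j *\<^sub>R \<xi> u) \<and>
     (\<forall>u\<in>U. \<forall>i. pd \<xi> i u = - (\<Sum>k\<in>UNIV. S u i k *\<^sub>R pd \<phi> k u)) \<and>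
     (\<forall>u\<in>U. det (hmat h u) \<noteq> 0) \<and>
     (\<forall>u\<in>U. \<bar>det (frame4 (pd \<phi> 1 u) (pd \<phi> 2 u) (pd \<phi> 3 u) (\<xi> u))\<bar> = sqrt \<bar>det (hmat h u)\<bar>)"

definition indefinite_on :: "(real^3) set \<Rightarrow> (real^3 \<Rightarrow> 3 \<Rightarrow> 3 \<Rightarrow> real) \<Rightarrow> bool" where
  "indefinite_on U h \<longleftrightarrow> (\<forall>u\<in>U. (\<exists>X. hform h u X X > 0) \<and> (\<exists>X. hform h u X X < 0))"

definition sym_group :: "(real^3 \<Rightarrow> 3 \<Rightarrow> 3 \<Rightarrow> 3 \<Rightarrow> real) \<Rightarrow> (real^3 \<Rightarrow> 3 \<Rightarrow> 3 \<Rightarrow> real)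
     \<Rightarrow> real^3 \<Rightarrow> (real^3^3) monoid" where
  "sym_group Gam h u = \<lparr> carrier = {L. (\<forall>X Y. hform h u (L *v X) (L *v Y) = hform h u X Y) \<and> det L = 1 \<and>
        (\<forall>X Y. diff_tensor Gam h u (L *v X) (L *v Y) = L *v diff_tensor Gam h u X Y)},
     mult = (\<lambda>A B. A ** B), one = mat 1 \<rparr>"

definition eta11 :: "real^2^2" where
  "eta11 = (\<chi> i j. if i = j then (if i = 1 then 1 else -1) else 0)"

definition SO11 :: "(real^2^2) monoid" where
  "SO11 = \<lparr> carrier = {A. transpose A ** eta11 ** A = eta11 \<and> det A = 1},
     mult = (\<lambda>A B. A ** B), one = mat 1 \<rparr>"

definition pointwise_SO11_symmetric :: "(real^3) set \<Rightarrow> (real^3 \<Rightarrow> 3 \<Rightarrow> 3 \<Rightarrow> 3 \<Rightarrow> real)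
     \<Rightarrow> (real^3 \<Rightarrow> 3 \<Rightarrow> 3 \<Rightarrow> real) \<Rightarrow> bool" where
  "pointwise_SO11_symmetric U Gam h \<longleftrightarrow> (\<forall>u\<in>U. sym_group Gam h u \<cong> SO11)"

definition so11_frame :: "(real^3) set \<Rightarrow> (real^3 \<Rightarrow> 3 \<Rightarrow> 3 \<Rightarrow> 3 \<Rightarrow> real) \<Rightarrow> (real^3 \<Rightarrow> 3 \<Rightarrow> 3 \<Rightarrow> real)
     \<Rightarrow> (real^3 \<Rightarrow> real^3) \<Rightarrow> (real^3 \<Rightarrow> real^3) \<Rightarrow> (real^3 \<Rightarrow> real^3) \<Rightarrow> (real^3 \<Rightarrow> real) \<Rightarrow> bool" where
  "so11_frame U Gam h E V F b4 \<longleftrightarrow>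
     smooth_on U E \<and> smooth_on U V \<and> smooth_on U F \<and>
     (\<forall>u\<in>U. b4 u > 0 \<and>
        hform h u (E u) (E u) = 0 \<and> hform h u (F u) (F u) = 0 \<and> hform h u (E u) (F u) = 1 \<and>
        hform h u (E u) (V u) = 0 \<and> hform h u (F u) (V u) = 0 \<and> hform h u (V u) (V u) = 1 \<and>
        diff_tensor Gam h u (V u) (V u) = (-2 * b4 u) *\<^sub>R V u \<and>
        diff_tensor Gam h u (V u) (E u) = b4 u *\<^sub>R E u \<and>
        diff_tensor Gam h u (V u) (F u) = b4 u *\<^sub>R F u \<and>
        diff_tensor Gam h u (E u) (E u) = 0 \<and>
        diff_tensor Gam h u (F u) (F u) = 0 \<and>
        diff_tensor Gam h u (E u) (F u) = b4 u *\<^sub>R V u)"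

definition alpha12 :: "(real^3 \<Rightarrow> 3 \<Rightarrow> 3 \<Rightarrow> real) \<Rightarrow> (real^3 \<Rightarrow> real^3) \<Rightarrow> (real^3 \<Rightarrow> real^3)
     \<Rightarrow> (real^3 \<Rightarrow> real^3) \<Rightarrow> real^3 \<Rightarrow> real" where
  "alpha12 h E V F u = hform h u (lc_cov h u (E u) V) (F u)"

text \<open>psi(x,y) = (x,y,f(x,y)) is a hyperbolic paraboloid with affine normal (0,0,1):
  f is a quadratic polynomial with constant Hessian [[a,b],[b,c]], a c - b^2 = -1.\<close>
definition hyp_paraboloid_normal001 :: "(real^2 \<Rightarrow> real) \<Rightarrow> (real^2) set \<Rightarrow> bool" where
  "hyp_paraboloid_normal001 f N \<longleftrightarrow> (\<exists>a b c d e g. a * c - b^2 = -1 \<and>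
     (\<forall>z\<in>N. f z = (a * (z$1)^2 + 2 * b * z$1 * z$2 + c * (z$2)^2) / 2 + d * z$1 + e * z$2 + g))"

definition prod_dom :: "real set \<Rightarrow> (real^2) set \<Rightarrow> (real^3) set" where
  "prod_dom I N = {w. w$1 \<in> I \<and> (vector [w$2, w$3] :: real^2) \<in> N}"

definition model_map :: "(real \<Rightarrow> real) \<Rightarrow> (real \<Rightarrow> real) \<Rightarrow> (real^2 \<Rightarrow> real) \<Rightarrow> real^3 \<Rightarrow> real^4" where
  "model_map g1 g2 f w = vector [g1 (w$1) * w$2, g1 (w$1) * w$3,
      g1 (w$1) * f (vector [w$2, w$3]) + g2 (w$1), g1 (w$1)]"

end

theory Submission
  imports Defs
begin

text \<open>
  Write \<open>\<theta> = h(V, \<cdot>)\<close>, \<open>r = b\<^sub>4\<close>, \<open>\<alpha> = \<alpha>\<^sub>1\<^sub>2\<close> and \<open>q = \<alpha> + r\<close>. The frame relations say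
  \<open>K(X,Y) = r (\<theta>(X) Y + \<theta>(Y) X + h(X,Y) V - 5 \<theta>(X) \<theta>(Y) V)\<close>. The Codazzi equation for \<open>K\<close> then gives
  \<open>\<nabla>\<^sub>X V = q X - (q + 2r) \<theta>(X) V\<close> and \<open>dr = 0\<close> on the kernel of \<open>\<theta>\<close>, and differentiating \<open>\<phi>\<^sub>* V\<close> twice gives
  \<open>dq = -4rq \<theta>\<close>; here \<open>H = r\<^sup>2 - \<alpha>\<^sup>2 = q (2r - q)\<close> enters, and forces \<open>q \<noteq> 0\<close>. Translate so that \<open>\<xi> = -H \<phi>\<close>.
  Then \<open>w = \<phi>\<^sub>* V - q \<phi>\<close> and the covector \<open>\<ell>\<close> with \<open>\<ell> \<circ> \<phi>\<^sub>* = q \<theta>\<close>, \<open>\<ell>(\<phi>) = 1\<close> have derivatives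
  proportional to themselves, so both have constant direction. In linear coordinates with \<open>w \<parallel> e\<^sub>3\<close> and
  \<open>\<ell> \<parallel> e\<^sup>4\<close> the functions \<open>v = \<phi>\<^sup>4\<close>, \<open>x = \<phi>\<^sup>1/\<phi>\<^sup>4\<close>, \<open>y = \<phi>\<^sup>2/\<phi>\<^sup>4\<close> form a chart, so that one may take
  \<open>\<gamma>\<^sub>1(v) = v\<close>. The structure equation makes the \<open>(x,y)\<close>-Hessian of \<open>\<phi>\<^sup>3\<close> a multiple of the leaf metric, hence
  indefinite, and \<open>v\<close> times a constant matrix.
\<close>

text \<open>The leaves of \<theta> = 0 are umbilic for \<open>h\<close>, and each of them turns out
  to be an improper affine sphere in a hyperplane. The covector \<ell> kills the tangent planes of
  the leaves, and it kills w as well because \<ell>(w) = q - q; so the leaves lie in parallel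
  hyperplanes, and w, which is constant along each leaf, is transversal to the leaf inside its
  hyperplane. The term -q \<phi> in w is there to cancel the q X of the derivative of V, and the
  value q \<theta> of \<ell> is then forced by \<ell>(w) = 0. On leaf vectors K has only a
  V-component, so the leaf inherits the Levi-Civita connection of its own metric. This is why its
  graph function has vanishing third derivatives. A formal obstacle is regularity: \<open>h\<close>,
  \<open>Gam\<close> and \<open>b4\<close> come without smoothness assumptions, and it has to be
  recovered from the structure equations before anything can be differentiated.\<close>

section \<open>Maps of class C-k on open sets\<close>

abbreviation dd :: "('a::real_normed_vector \<Rightarrow> 'b::real_normed_vector) \<Rightarrow> 'a \<Rightarrow> 'a \<Rightarrow> 'b" where
  "dd f u \<equiv> frechet_derivative f (at u)"

lemma dd_eq: "(f has_derivative f') (at u) \<Longrightarrow> dd f u = f'"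
  using frechet_derivative_at by metis

lemma linear_eq_sum_Basis:
  fixes L :: "'a::euclidean_space \<Rightarrow> 'b::real_vector"
  assumes "linear L"
  shows "L x = (\<Sum>j\<in>Basis. (x \<bullet> j) *\<^sub>R L j)"
proof -
  have "L x = L (\<Sum>j\<in>Basis. (x \<bullet> j) *\<^sub>R j)"
    by (simp add: euclidean_representation)
  then show ?thesis
    by (simp add: linear_sum[OF assms] linear_scale[OF assms])
qed

lemma Ck_Suc_has_derivative:
  "Ck (Suc k) U f \<Longrightarrow> open U \<Longrightarrow> u \<in> U \<Longrightarrow> (f has_derivative dd f u) (at u)"
  by (simp add: differentiable_on_eq_differentiable_at frechet_derivative_works)

lemma Ck_Suc_dd: "Ck (Suc k) U f \<Longrightarrow> i \<in> Basis \<Longrightarrow> Ck k U (\<lambda>u. dd f u i)"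
  by simp

lemma Ck_SucI:
  assumes "open U" "\<And>u. u \<in> U \<Longrightarrow> (f has_derivative f' u) (at u)"
    and "\<And>i. i \<in> Basis \<Longrightarrow> Ck k U (\<lambda>u. dd f u i)"
  shows "Ck (Suc k) U f"
  using assms by (auto simp: differentiable_on_eq_differentiable_at differentiable_def)

text \<open>Differentiability and the derivative at an interior point depend only on the germ, so on
  an open set agreement passes through every level of the recursion.\<close>

lemma Ck_cong:
  assumes "open U" "\<And>u. u \<in> U \<Longrightarrow> f u = g u"
  shows "Ck k U f \<longleftrightarrow> Ck k U g"
  using assms(2)
proof (induction k arbitrary: f g)
  case 0
  then show ?case by (simp cong: continuous_on_cong)
next
  case (Suc k)
  have der: "dd f u = dd g u \<and> (f differentiable at u \<longleftrightarrow> g differentiable at u)" if "u \<in> U" for u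
  proof -
    have "(f has_derivative D) (at u) \<longleftrightarrow> (g has_derivative D) (at u)" for D
      using Suc.prems that assms(1) has_derivative_transform_within_open by metis
    then show ?thesis by (simp add: frechet_derivative_def differentiable_def)
  qed
  have "Ck k U (\<lambda>u. dd f u i) \<longleftrightarrow> Ck k U (\<lambda>u. dd g u i)" for i
    using der by (intro Suc.IH) simp
  then show ?case
    using der assms(1) by (simp add: differentiable_on_eq_differentiable_at)
qed

text \<open>Lets an explicit formula for the derivative replace \<open>dd\<close>; the closure rules
  that follow climb one order through it.\<close>

lemma Ck_SucI':
  assumes "open U" "\<And>u. u \<in> U \<Longrightarrow> (f has_derivative f' u) (at u)"
    and "\<And>i. i \<in> Basis \<Longrightarrow> Ck k U (\<lambda>u. f' u i)"
  shows "Ck (Suc k) U f"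
proof (rule Ck_SucI[OF assms(1,2)])
  fix i :: 'a assume "i \<in> Basis"
  then show "Ck k U (\<lambda>u. dd f u i)"
    using assms(3) Ck_cong[OF assms(1), of "\<lambda>u. f' u i" "\<lambda>u. dd f u i" k] dd_eq[OF assms(2)] by simp
qed

lemma Ck_continuous_on: "Ck k U f \<Longrightarrow> continuous_on U f"
  by (cases k) (auto intro: differentiable_imp_continuous_on)

lemma Ck_mono_Suc: "Ck (Suc k) U f \<Longrightarrow> Ck k U f"
proof (induction k arbitrary: f)
  case (Suc k)
  then show ?case by (metis Ck.simps(2))
qed (simp add: differentiable_imp_continuous_on)

lemma Ck_subset:
  assumes "open U" "open V" "V \<subseteq> U"
  shows "Ck k U f \<Longrightarrow> Ck k V f"
proof (induction k arbitrary: f)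
  case 0
  then show ?case using assms(3) continuous_on_subset by simp blast
next
  case (Suc k)
  then show ?case using assms(3) differentiable_on_subset[of f U V] by simp
qed

lemma Ck_const: "Ck k U (\<lambda>u. c)"
  by (induction k arbitrary: c) auto

lemma Ck_bounded_linear:
  assumes "open U" "bounded_linear L"
  shows "Ck k U f \<Longrightarrow> Ck k U (\<lambda>u. L (f u))"
proof (induction k arbitrary: f)
  case 0
  then show ?case using assms(2) by (simp add: bounded_linear.continuous_on)
next
  case (Suc k)
  have der: "((\<lambda>u. L (f u)) has_derivative (\<lambda>x. L (dd f u x))) (at u)" if "u \<in> U" for u
    using bounded_linear.has_derivative[OF assms(2)] Ck_Suc_has_derivative[OF Suc.prems assms(1) that] by blast
  show ?case
    by (rule Ck_SucI'[OF assms(1) der]) (assumption, intro Suc.IH Ck_Suc_dd[OF Suc.prems])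
qed

lemma Ck_add:
  assumes "open U"
  shows "Ck k U f \<Longrightarrow> Ck k U g \<Longrightarrow> Ck k U (\<lambda>u. f u + g u)"
proof (induction k arbitrary: f g)
  case 0
  then show ?case by (simp add: continuous_on_add)
next
  case (Suc k)
  have der: "((\<lambda>u. f u + g u) has_derivative (\<lambda>x. dd f u x + dd g u x)) (at u)" if "u \<in> U" for u
    by (intro has_derivative_add Suc.prems[THEN Ck_Suc_has_derivative] assms that)
  show ?case
    by (rule Ck_SucI'[OF assms der]) (assumption, intro Suc.IH Suc.prems[THEN Ck_Suc_dd])
qed

lemma Ck_sum:
  assumes "open U" "\<And>i. i \<in> I \<Longrightarrow> Ck k U (f i)"
  shows "Ck k U (\<lambda>u. \<Sum>i\<in>I. f i u)"
proof (cases "finite I")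
  case True
  then show ?thesis using assms(2)
    by (induction I rule: finite_induct) (simp_all add: Ck_const Ck_add[OF assms(1)])
qed (simp add: Ck_const)

lemma Ck_bilinear:
  assumes "open U" "bounded_bilinear B"
  shows "Ck k U f \<Longrightarrow> Ck k U g \<Longrightarrow> Ck k U (\<lambda>u. B (f u) (g u))"
proof (induction k arbitrary: f g)
  case 0
  then show ?case using bounded_bilinear.continuous_on[OF assms(2)] by simp
next
  case (Suc k)
  have der: "((\<lambda>u. B (f u) (g u)) has_derivative (\<lambda>x. B (f u) (dd g u x) + B (dd f u x) (g u))) (at u)"
    if "u \<in> U" for u
    using bounded_bilinear.FDERIV[OF assms(2)] Ck_Suc_has_derivative[OF Suc.prems(1) assms(1) that]
      Ck_Suc_has_derivative[OF Suc.prems(2) assms(1) that] by blast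
  show ?case
    by (rule Ck_SucI'[OF assms(1) der])
      (assumption, intro Ck_add[OF assms(1)] Suc.IH Suc.prems[THEN Ck_Suc_dd] Suc.prems[THEN Ck_mono_Suc])
qed

text \<open>The derivative of 1/f is a product of 1/f, f' and 1/f, so the induction hypothesis for
  1/f one order lower suffices.\<close>

lemma Ck_inverse:
  fixes f :: "'a::euclidean_space \<Rightarrow> real"
  assumes "open U" "\<And>u. u \<in> U \<Longrightarrow> f u \<noteq> 0"
  shows "Ck k U f \<Longrightarrow> Ck k U (\<lambda>u. inverse (f u))"
proof (induction k)
  case 0
  then show ?case using assms(2) continuous_on_inverse[of U f] by simp
next
  case (Suc k)
  have "((\<lambda>u. inverse (f u)) has_derivative (\<lambda>x. -1 * (inverse (f u) * dd f u x * inverse (f u)))) (at u)"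
    if "u \<in> U" for u
    using Deriv.has_derivative_inverse[OF assms(2)[OF that] Ck_Suc_has_derivative[OF Suc.prems assms(1) that]]
    by simp
  moreover have "Ck k U (\<lambda>u. -1 * (inverse (f u) * dd f u i * inverse (f u)))" if "i \<in> Basis" for i
    using Suc.IH[OF Ck_mono_Suc[OF Suc.prems]] Ck_Suc_dd[OF Suc.prems that]
    by (intro Ck_bilinear[OF assms(1) bounded_bilinear_mult] Ck_const)
  ultimately show ?case
    by (intro Ck_SucI'[OF assms(1)])
qed

lemma Ck_compose:
  fixes f :: "'b::euclidean_space \<Rightarrow> 'c::real_normed_vector" and g :: "'a::euclidean_space \<Rightarrow> 'b"
  assumes "open U" "open V" "g ` U \<subseteq> V"
  shows "Ck k V f \<Longrightarrow> Ck k U g \<Longrightarrow> Ck k U (\<lambda>u. f (g u))"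
proof (induction k arbitrary: f)
  case 0
  then show ?case using assms(3) continuous_on_compose2[of V f U g] by simp
next
  case (Suc k)
  have der: "((\<lambda>u. f (g u)) has_derivative (\<lambda>x. dd f (g u) (dd g u x))) (at u)" if "u \<in> U" for u
    using Ck_Suc_has_derivative[OF Suc.prems(1) assms(2), of "g u"]
      Ck_Suc_has_derivative[OF Suc.prems(2) assms(1) that] assms(3) that
      diff_chain_at[of g "dd g u" u f "dd f (g u)"] by (auto simp: o_def image_subset_iff)
  have "Ck k U (\<lambda>u. dd f (g u) (dd g u i))" if i: "i \<in> Basis" for i
  proof -
    \<comment> \<open>The direction \<open>dd g u i\<close> moves with \<open>u\<close>. Expanding
      it in the basis leaves partial derivatives of \<open>f\<close> in fixed directions, which the
      recursion controls.\<close>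
    have lin: "dd f (g u) (dd g u i) = (\<Sum>j\<in>Basis. (dd g u i \<bullet> j) *\<^sub>R dd f (g u) j)" if "u \<in> U" for u
    proof -
      have "linear (dd f (g u))"
        using Ck_Suc_has_derivative[OF Suc.prems(1) assms(2), of "g u"] assms(3) that
          has_derivative_linear by blast
      then show ?thesis by (rule linear_eq_sum_Basis)
    qed
    have "Ck k U (\<lambda>u. \<Sum>j\<in>Basis. (dd g u i \<bullet> j) *\<^sub>R dd f (g u) j)"
    proof (intro Ck_sum[OF assms(1)] Ck_bilinear[OF assms(1) bounded_bilinear_scaleR])
      fix j :: 'b assume j: "j \<in> Basis"
      show "Ck k U (\<lambda>u. dd g u i \<bullet> j)"
        by (rule Ck_bounded_linear[OF assms(1) bounded_linear_inner_left Ck_Suc_dd[OF Suc.prems(2) i]])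
      show "Ck k U (\<lambda>u. dd f (g u) j)"
        by (rule Suc.IH[OF Ck_Suc_dd[OF Suc.prems(1) j] Ck_mono_Suc[OF Suc.prems(2)]])
    qed
    then show ?thesis
      using Ck_cong[OF assms(1), of "\<lambda>u. dd f (g u) (dd g u i)", OF lin] by simp
  qed
  then show ?case using der by (intro Ck_SucI'[OF assms(1)])
qed

lemma Ck_linear: "open U \<Longrightarrow> bounded_linear L \<Longrightarrow> Ck k U L"
proof (cases k)
  case (Suc n)
  assume "open U" "bounded_linear L"
  then show ?thesis
    unfolding Suc by (intro Ck_SucI'[where f' = "\<lambda>_. L"] Ck_const) (auto intro: bounded_linear_imp_has_derivative)
qed (simp add: linear_continuous_on)

section \<open>Closure properties of smooth maps\<close>

lemma smooth_onI: "(\<And>k. Ck k U f) \<Longrightarrow> smooth_on U f"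
  by (simp add: smooth_on_def)

lemma smooth_onD: "smooth_on U f \<Longrightarrow> Ck k U f"
  by (simp add: smooth_on_def)

lemma smooth_on_has_derivative:
  "smooth_on U f \<Longrightarrow> open U \<Longrightarrow> u \<in> U \<Longrightarrow> (f has_derivative dd f u) (at u)"
  using Ck_Suc_has_derivative[of 0] smooth_onD by blast

lemma smooth_on_cong: "open U \<Longrightarrow> (\<And>u. u \<in> U \<Longrightarrow> f u = g u) \<Longrightarrow> smooth_on U f \<longleftrightarrow> smooth_on U g"
  unfolding smooth_on_def using Ck_cong by blast

lemma smooth_on_subset: "smooth_on U f \<Longrightarrow> open U \<Longrightarrow> open V \<Longrightarrow> V \<subseteq> U \<Longrightarrow> smooth_on V f"
  unfolding smooth_on_def using Ck_subset by blast

lemma smooth_on_const: "smooth_on U (\<lambda>u. c)"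
  by (simp add: smooth_on_def Ck_const)

lemma smooth_on_linear: "open U \<Longrightarrow> bounded_linear L \<Longrightarrow> smooth_on U L"
  by (simp add: smooth_on_def Ck_linear)

lemma smooth_on_bounded_linear:
  "bounded_linear L \<Longrightarrow> open U \<Longrightarrow> smooth_on U f \<Longrightarrow> smooth_on U (\<lambda>u. L (f u))"
  by (simp add: smooth_on_def Ck_bounded_linear)

lemma smooth_on_add:
  "open U \<Longrightarrow> smooth_on U f \<Longrightarrow> smooth_on U g \<Longrightarrow> smooth_on U (\<lambda>u. f u + g u)"
  by (simp add: smooth_on_def Ck_add)

lemma smooth_on_sum:
  "open U \<Longrightarrow> (\<And>i. i \<in> I \<Longrightarrow> smooth_on U (f i)) \<Longrightarrow> smooth_on U (\<lambda>u. \<Sum>i\<in>I. f i u)"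
  by (simp add: smooth_on_def Ck_sum)

lemma smooth_on_bilinear:
  "bounded_bilinear B \<Longrightarrow> open U \<Longrightarrow> smooth_on U f \<Longrightarrow> smooth_on U g \<Longrightarrow> smooth_on U (\<lambda>u. B (f u) (g u))"
  by (simp add: smooth_on_def Ck_bilinear)

lemmas smooth_on_scaleR = smooth_on_bilinear[OF bounded_bilinear_scaleR]
  and smooth_on_mult = smooth_on_bilinear[OF bounded_bilinear_mult]
  and smooth_on_vec_nth = smooth_on_bounded_linear[OF bounded_linear_vec_nth]

lemma smooth_on_diff:
  assumes "open U" "smooth_on U f" "smooth_on U g"
  shows "smooth_on U (\<lambda>u. f u - g u)"
  using smooth_on_add[OF assms(1,2) smooth_on_bounded_linear[OF bounded_linear_minus[OF bounded_linear_ident] assms(1,3)]]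
  by simp

lemma smooth_on_divide:
  fixes f g :: "'a::euclidean_space \<Rightarrow> real"
  assumes "open U" "smooth_on U f" "smooth_on U g" "\<And>u. u \<in> U \<Longrightarrow> g u \<noteq> 0"
  shows "smooth_on U (\<lambda>u. f u / g u)"
proof -
  have "smooth_on U (\<lambda>u. inverse (g u))"
    using assms by (simp add: smooth_on_def Ck_inverse)
  then show ?thesis
    unfolding divide_inverse by (intro smooth_on_mult assms)
qed

lemma smooth_on_prod:
  fixes f :: "'i \<Rightarrow> 'a::euclidean_space \<Rightarrow> real"
  assumes "open U" "\<And>i. i \<in> I \<Longrightarrow> smooth_on U (f i)"
  shows "smooth_on U (\<lambda>u. \<Prod>i\<in>I. f i u)"
proof (cases "finite I")
  case True
  then show ?thesis using assms(2)
    by (induction I rule: finite_induct) (simp_all add: smooth_on_const smooth_on_mult[OF assms(1)])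
qed (simp add: smooth_on_const)

lemma smooth_on_compose:
  fixes f :: "'b::euclidean_space \<Rightarrow> 'c::real_normed_vector" and g :: "'a::euclidean_space \<Rightarrow> 'b"
  shows "open U \<Longrightarrow> open V \<Longrightarrow> g ` U \<subseteq> V \<Longrightarrow> smooth_on V f \<Longrightarrow> smooth_on U g \<Longrightarrow> smooth_on U (\<lambda>u. f (g u))"
  unfolding smooth_on_def using Ck_compose by blast

lemma smooth_on_vecI:
  fixes f :: "'a::euclidean_space \<Rightarrow> real^'n"
  assumes "open U" "\<And>i. smooth_on U (\<lambda>u. f u $ i)"
  shows "smooth_on U f"
proof -
  have "smooth_on U (\<lambda>u. \<Sum>i\<in>UNIV. f u $ i *\<^sub>R axis i 1)"
    using assms by (intro smooth_on_sum smooth_on_scaleR smooth_on_const)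
  moreover have "f u = (\<Sum>i\<in>UNIV. f u $ i *\<^sub>R axis i 1)" for u
    using basis_expansion[of "f u"] by (simp add: scalar_mult_eq_scaleR)
  ultimately show ?thesis
    using smooth_on_cong[OF assms(1), of f "\<lambda>u. \<Sum>i\<in>UNIV. f u $ i *\<^sub>R axis i 1"] by blast
qed

lemma smooth_on_dd:
  fixes f :: "'a::euclidean_space \<Rightarrow> 'b::real_normed_vector"
  assumes "open U" "smooth_on U f" "smooth_on U X"
  shows "smooth_on U (\<lambda>u. dd f u (X u))"
proof -
  have "dd f u (X u) = (\<Sum>j\<in>Basis. (X u \<bullet> j) *\<^sub>R dd f u j)" if "u \<in> U" for u
  proof -
    have "linear (dd f u)"
      using smooth_on_has_derivative[OF assms(2,1) that] has_derivative_linear by blast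
    then show ?thesis by (rule linear_eq_sum_Basis)
  qed
  moreover have "smooth_on U (\<lambda>u. \<Sum>j\<in>Basis. (X u \<bullet> j) *\<^sub>R dd f u j)"
  proof (intro smooth_on_sum smooth_on_scaleR assms(1))
    fix j :: 'a assume j: "j \<in> Basis"
    show "smooth_on U (\<lambda>u. X u \<bullet> j)"
      by (rule smooth_on_bounded_linear[OF bounded_linear_inner_left assms(1,3)])
    show "smooth_on U (\<lambda>u. dd f u j)"
      using smooth_onD[OF assms(2)] j by (intro smooth_onI) (metis Ck.simps(2))
  qed
  ultimately show ?thesis
    using smooth_on_cong[OF assms(1), of "\<lambda>u. dd f u (X u)" "\<lambda>u. \<Sum>j\<in>Basis. (X u \<bullet> j) *\<^sub>R dd f u j"]
    by blast
qed

lemma smooth_on_det: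
  fixes M :: "'a::euclidean_space \<Rightarrow> real^'n^'n"
  assumes "open U" "\<And>i j. smooth_on U (\<lambda>u. M u $ i $ j)"
  shows "smooth_on U (\<lambda>u. det (M u))"
  unfolding det_def
  by (intro smooth_on_sum smooth_on_mult smooth_on_const smooth_on_prod assms)

text \<open>By Cramer's rule each component of the solution is a quotient of determinants in the
  smooth data.\<close>

lemma smooth_on_linear_system:
  fixes M :: "'a::euclidean_space \<Rightarrow> real^'n^'n"
  assumes "open U" "\<And>i j. smooth_on U (\<lambda>u. M u $ i $ j)" "\<And>i. smooth_on U (\<lambda>u. b u $ i)"
    and "\<And>u. u \<in> U \<Longrightarrow> det (M u) \<noteq> 0" "\<And>u. u \<in> U \<Longrightarrow> M u *v x u = b u"
  shows "smooth_on U x"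
proof (rule smooth_on_vecI[OF assms(1)])
  fix k :: 'n
  have rhs: "smooth_on U (\<lambda>u. det (\<chi> i j. if j = k then b u $ i else M u $ i $ j) / det (M u))"
  proof (intro smooth_on_divide smooth_on_det assms)
    show "smooth_on U (\<lambda>u. (\<chi> i j. if j = k then b u $ i else M u $ i $ j) $ i $ j)" for i j
      using assms(2,3) by (cases "j = k") auto
  qed
  have "x u $ k = det (\<chi> i j. if j = k then b u $ i else M u $ i $ j) / det (M u)" if "u \<in> U" for u
    using cramer[OF assms(4)[OF that], of "x u" "b u"] assms(5)[OF that] by simp
  then show "smooth_on U (\<lambda>u. x u $ k)"
    by (rule smooth_on_cong[OF assms(1), THEN iffD2, OF _ rhs])
qed

section \<open>Symmetry of second derivatives and the inverse function theorem\<close>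

lemma has_real_derivative_along_line:
  fixes f :: "'a::real_normed_vector \<Rightarrow> real"
  assumes "(f has_derivative D) (at (c + t *\<^sub>R X))"
  shows "((\<lambda>t. f (c + t *\<^sub>R X)) has_real_derivative D X) (at t)"
proof -
  have "((\<lambda>t. c + t *\<^sub>R X) has_derivative (\<lambda>s. s *\<^sub>R X)) (at t)"
    using has_derivative_add[OF has_derivative_const has_derivative_scaleR_left[OF has_derivative_ident]] by simp
  from diff_chain_at[OF this assms] have "((\<lambda>t. f (c + t *\<^sub>R X)) has_derivative (\<lambda>s. D (s *\<^sub>R X))) (at t)"
    by (simp add: o_def)
  moreover have "linear D" using assms has_derivative_linear by blast
  ultimately show ?thesis
    by (simp add: has_field_derivative_def linear_scale mult.commute[of _ "D X"])
qed

text \<open>Two mean value theorems: in direction \<open>X\<close> for the difference of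
  \<open>f\<close> along two parallel segments, then in direction \<open>Y\<close> for the
  derivative of \<open>f\<close>.\<close>

lemma second_difference_mvt:
  fixes f :: "'a::euclidean_space \<Rightarrow> real"
  assumes "open U" "smooth_on U f" "s > 0"
    and "\<And>a b. 0 \<le> a \<Longrightarrow> a \<le> s \<Longrightarrow> 0 \<le> b \<Longrightarrow> b \<le> s \<Longrightarrow> u + a *\<^sub>R X + b *\<^sub>R Y \<in> U"
  shows "\<exists>a b. 0 < a \<and> a < s \<and> 0 < b \<and> b < s \<and>
    f (u + s *\<^sub>R X + s *\<^sub>R Y) - f (u + s *\<^sub>R X) - f (u + s *\<^sub>R Y) + f u
      = s * s * dd (\<lambda>w. dd f w X) (u + a *\<^sub>R X + b *\<^sub>R Y) Y"
proof -
  have sub: "u + a *\<^sub>R X \<in> U" if "0 \<le> a" "a \<le> s" for a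
    using assms(4)[of a 0] that assms(3) by simp
  have 1: "((\<lambda>t. f ((u + s *\<^sub>R Y) + t *\<^sub>R X) - f (u + t *\<^sub>R X)) has_real_derivative
      (dd f ((u + s *\<^sub>R Y) + t *\<^sub>R X) X - dd f (u + t *\<^sub>R X) X)) (at t)" if "0 \<le> t" "t \<le> s" for t
    using smooth_on_has_derivative[OF assms(2,1)] assms(4)[of t s] sub[OF that] assms(3) that
    by (intro DERIV_diff has_real_derivative_along_line) (auto simp: algebra_simps)
  obtain a where a: "0 < a" "a < s"
    and e1: "f ((u + s *\<^sub>R Y) + s *\<^sub>R X) - f (u + s *\<^sub>R X) - (f ((u + s *\<^sub>R Y) + 0 *\<^sub>R X) - f (u + 0 *\<^sub>R X))
      = (s - 0) * (dd f ((u + s *\<^sub>R Y) + a *\<^sub>R X) X - dd f (u + a *\<^sub>R X) X)"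
    using MVT2[OF assms(3) 1] by blast
  have 2: "((\<lambda>t. dd f ((u + a *\<^sub>R X) + t *\<^sub>R Y) X) has_real_derivative
      dd (\<lambda>w. dd f w X) ((u + a *\<^sub>R X) + t *\<^sub>R Y) Y) (at t)" if "0 \<le> t" "t \<le> s" for t
    using smooth_on_has_derivative[OF smooth_on_dd[OF assms(1,2) smooth_on_const] assms(1)] assms(4)[of a t] a that
    by (intro has_real_derivative_along_line) auto
  obtain b where b: "0 < b" "b < s"
    and e2: "dd f ((u + a *\<^sub>R X) + s *\<^sub>R Y) X - dd f ((u + a *\<^sub>R X) + 0 *\<^sub>R Y) X
      = (s - 0) * dd (\<lambda>w. dd f w X) ((u + a *\<^sub>R X) + b *\<^sub>R Y) Y"
    using MVT2[OF assms(3) 2] by blast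
  have "f (u + s *\<^sub>R X + s *\<^sub>R Y) - f (u + s *\<^sub>R X) - f (u + s *\<^sub>R Y) + f u
      = s * (dd f (u + a *\<^sub>R X + s *\<^sub>R Y) X - dd f (u + a *\<^sub>R X) X)"
    using e1 by (simp add: add.commute add.left_commute)
  also have "\<dots> = s * s * dd (\<lambda>w. dd f w X) (u + a *\<^sub>R X + b *\<^sub>R Y) Y"
    using e2 by simp
  finally show ?thesis using a b by blast
qed

lemma dd_commute_real:
  fixes f :: "'a::euclidean_space \<Rightarrow> real"
  assumes "open U" "smooth_on U f" "u \<in> U"
  shows "dd (\<lambda>w. dd f w X) u Y = dd (\<lambda>w. dd f w Y) u X"
proof (rule ccontr)
  define P where "P w = dd (\<lambda>w. dd f w X) w Y" for w
  define Q where "Q w = dd (\<lambda>w. dd f w Y) w X" for w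
  assume "\<not> ?thesis"
  then have "P u \<noteq> Q u" by (simp add: P_def Q_def)
  \<comment> \<open>Half the gap: if both mixed derivatives moved by less than \<open>e\<close> and
    still met in a common value, the gap would be smaller than itself.\<close>
  define e where "e = \<bar>P u - Q u\<bar> / 2"
  have e: "e > 0" using \<open>P u \<noteq> Q u\<close> by (simp add: e_def)
  have "smooth_on U P" "smooth_on U Q"
    unfolding P_def Q_def by (intro smooth_on_dd assms smooth_on_const)+
  then have "isCont P u" "isCont Q u"
    using smooth_on_has_derivative[OF _ assms(1,3)] has_derivative_continuous by blast+
  then obtain d1 d2 where d1: "d1 > 0" "\<And>w. dist w u < d1 \<Longrightarrow> dist (P w) (P u) < e"
    and d2: "d2 > 0" "\<And>w. dist w u < d2 \<Longrightarrow> dist (Q w) (Q u) < e"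
    using e unfolding continuous_at_eps_delta by metis
  obtain d3 where d3: "d3 > 0" "ball u d3 \<subseteq> U"
    using assms(1,3) open_contains_ball by blast
  define d where "d = min d1 (min d2 d3)"
  have d: "d > 0" using d1 d2 d3 by (simp add: d_def)
  \<comment> \<open>Short enough to keep the whole parallelogram within \<open>d\<close> of
    \<open>u\<close>; the summand 1 keeps the denominator positive when \<open>X\<close> and
    \<open>Y\<close> both vanish.\<close>
  define s where "s = d / (norm X + norm Y + 1)"
  have s: "s > 0" using d by (simp add: s_def add_nonneg_pos)
  have near: "dist (u + a *\<^sub>R X + b *\<^sub>R Y) u < d" if "0 \<le> a" "a \<le> s" "0 \<le> b" "b \<le> s" for a b
  proof -
    have "dist (u + a *\<^sub>R X + b *\<^sub>R Y) u \<le> a * norm X + b * norm Y"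
      using norm_triangle_ineq[of "a *\<^sub>R X" "b *\<^sub>R Y"] that by (simp add: dist_norm add.assoc)
    also have "\<dots> \<le> s * norm X + s * norm Y"
      using that by (intro add_mono mult_right_mono) auto
    also have "\<dots> < s * (norm X + norm Y + 1)" using s by (simp add: algebra_simps)
    also have "\<dots> = d" unfolding s_def by (simp add: add_nonneg_pos less_imp_neq[symmetric])
    finally show ?thesis .
  qed
  have inU: "u + a *\<^sub>R X + b *\<^sub>R Y \<in> U" if "0 \<le> a" "a \<le> s" "0 \<le> b" "b \<le> s" for a b
    using near[OF that] d3 by (auto simp: d_def dist_commute)
  obtain a b where ab: "0 < a" "a < s" "0 < b" "b < s"
    and e1: "f (u + s *\<^sub>R X + s *\<^sub>R Y) - f (u + s *\<^sub>R X) - f (u + s *\<^sub>R Y) + f u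
      = s * s * P (u + a *\<^sub>R X + b *\<^sub>R Y)"
    using second_difference_mvt[OF assms(1,2) s inU] unfolding P_def by blast
  have inU': "u + a *\<^sub>R Y + b *\<^sub>R X \<in> U" if "0 \<le> a" "a \<le> s" "0 \<le> b" "b \<le> s" for a b
    using inU[of b a] that by (simp add: add.commute add.left_commute)
  obtain a' b' where ab': "0 < a'" "a' < s" "0 < b'" "b' < s"
    and e2: "f (u + s *\<^sub>R Y + s *\<^sub>R X) - f (u + s *\<^sub>R Y) - f (u + s *\<^sub>R X) + f u
      = s * s * Q (u + a' *\<^sub>R Y + b' *\<^sub>R X)"
    using second_difference_mvt[OF assms(1,2) s inU'] unfolding Q_def by blast
  have swap: "u + x *\<^sub>R Y + y *\<^sub>R X = u + y *\<^sub>R X + x *\<^sub>R Y" for x y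
    by (simp add: add.commute add.left_commute)
  \<comment> \<open>The second difference is symmetric in \<open>X\<close> and \<open>Y\<close>, so
    both evaluations give the same number.\<close>
  have "s * s * P (u + a *\<^sub>R X + b *\<^sub>R Y) = s * s * Q (u + b' *\<^sub>R X + a' *\<^sub>R Y)"
    using e1 e2 unfolding swap by linarith
  then have "P (u + a *\<^sub>R X + b *\<^sub>R Y) = Q (u + b' *\<^sub>R X + a' *\<^sub>R Y)" using s by simp
  moreover have "dist (P (u + a *\<^sub>R X + b *\<^sub>R Y)) (P u) < e"
    using d1 near[of a b] ab by (auto simp: d_def)
  moreover have "dist (Q (u + b' *\<^sub>R X + a' *\<^sub>R Y)) (Q u) < e"
    using d2 near[of b' a'] ab' by (auto simp: d_def)
  ultimately show False unfolding e_def dist_real_def by (simp add: abs_if split: if_splits)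
qed

lemma dd_linear_image:
  assumes "bounded_linear L" "(f has_derivative f') (at u)"
  shows "dd (\<lambda>w. L (f w)) u X = L (dd f u X)"
  using dd_eq[OF bounded_linear.has_derivative[OF assms]] dd_eq[OF assms(2)] by simp

lemma dd_cong:
  assumes "open U" "u \<in> U" "\<And>w. w \<in> U \<Longrightarrow> f w = g w"
  shows "dd f u = dd g u"
proof -
  have "(f has_derivative D) (at u) \<longleftrightarrow> (g has_derivative D) (at u)" for D
    using assms has_derivative_transform_within_open by metis
  then show ?thesis by (simp add: frechet_derivative_def)
qed

lemma dd_commute:
  fixes f :: "'a::euclidean_space \<Rightarrow> 'b::euclidean_space"
  assumes "open U" "smooth_on U f" "u \<in> U"
  shows "dd (\<lambda>w. dd f w X) u Y = dd (\<lambda>w. dd f w Y) u X"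
proof (rule euclidean_eqI)
  fix b :: 'b
  have fb: "smooth_on U (\<lambda>w. f w \<bullet> b)"
    by (rule smooth_on_bounded_linear[OF bounded_linear_inner_left assms(1,2)])
  have 1: "dd (\<lambda>w. f w \<bullet> b) w X = dd f w X \<bullet> b" if "w \<in> U" for w X
    by (rule dd_linear_image[OF bounded_linear_inner_left smooth_on_has_derivative[OF assms(2,1) that]])
  have 2: "dd (\<lambda>w. dd f w X) u Y \<bullet> b = dd (\<lambda>w. dd (\<lambda>w. f w \<bullet> b) w X) u Y" for X Y
    using dd_linear_image[OF bounded_linear_inner_left[of b] smooth_on_has_derivative
        [OF smooth_on_dd[OF assms(1,2) smooth_on_const[of U X]] assms(1,3)], of Y]
      dd_cong[OF assms(1,3), of "\<lambda>w. dd f w X \<bullet> b" "\<lambda>w. dd (\<lambda>w. f w \<bullet> b) w X"] 1 by simp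
  show "dd (\<lambda>w. dd f w X) u Y \<bullet> b = dd (\<lambda>w. dd f w Y) u X \<bullet> b"
    unfolding 2 by (rule dd_commute_real[OF assms(1) fb assms(3)])
qed

section \<open>Smoothness of a local inverse\<close>

lemma matrix_inv:
  fixes A :: "real^'n^'n"
  assumes "invertible A"
  shows "A ** matrix_inv A = mat 1" "matrix_inv A ** A = mat 1"
  using someI_ex[OF assms[unfolded invertible_def]] by (simp_all add: matrix_inv_def)

text \<open>The derivative of \<open>t\<close> is the inverse of \<open>dd s\<close> taken at
  \<open>t y\<close>. Its columns \<open>S j\<close> are smooth, so each order of regularity of
  \<open>t\<close> passes to its derivative and yields the next one.\<close>

lemma smooth_on_local_inverse:
  fixes s :: "real^'n \<Rightarrow> real^'n"
  assumes "open W" "open V" "smooth_on W s" "t ` V \<subseteq> W"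
    and st: "\<And>y. y \<in> V \<Longrightarrow> s (t y) = y"
    and t: "\<And>y. y \<in> V \<Longrightarrow> (t has_derivative t' y) (at y)"
    and inj: "\<And>u X. u \<in> W \<Longrightarrow> dd s u X = 0 \<Longrightarrow> X = 0"
  shows "smooth_on V t"
proof -
  define M where "M u = matrix (dd s u)" for u
  define S where "S j u = matrix_inv (M u) *v axis j (1::real)" for j u
  have der_s: "(s has_derivative dd s u) (at u)" if "u \<in> W" for u
    using smooth_on_has_derivative[OF assms(3,1) that] .
  have M: "M u *v X = dd s u X" if "u \<in> W" for u X
    unfolding M_def using matrix_works has_derivative_linear[OF der_s[OF that]] linear_matrix_vector_mul_eq by blast
  have inv: "invertible (M u)" if "u \<in> W" for u
  proof -
    have "inj ((*v) (M u))"
      using inj[OF that] M[OF that] by (auto simp: linear_injective_0)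
    then show ?thesis using invertible_left_inverse matrix_left_invertible_injective by blast
  qed
  have S: "smooth_on W (S j)" for j
  proof (rule smooth_on_linear_system[OF assms(1), where M = M and b = "\<lambda>_. axis j 1"])
    show "smooth_on W (\<lambda>u. M u $ i $ k)" for i k
    proof -
      have "smooth_on W (\<lambda>u. dd s u (axis k 1) $ i)"
        by (intro smooth_on_vec_nth smooth_on_dd assms smooth_on_const)
      then show ?thesis by (simp add: M_def matrix_def)
    qed
    show "smooth_on W (\<lambda>u. axis j (1::real) $ i)" for i by (rule smooth_on_const)
    show "det (M u) \<noteq> 0" if "u \<in> W" for u using inv[OF that] invertible_det_nz by blast
    show "M u *v S j u = axis j 1" if "u \<in> W" for u
      unfolding S_def using inv[OF that] by (simp add: matrix_vector_mul_assoc matrix_inv)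
  qed
  have dt: "dd t y (axis j 1) = S j (t y)" if y: "y \<in> V" for y j
  proof -
    have ty: "t y \<in> W" using y assms(4) by blast
    have "((\<lambda>y. s (t y)) has_derivative (\<lambda>x. dd s (t y) (t' y x))) (at y)"
      using diff_chain_at[OF t[OF y] der_s[OF ty]] by (simp add: o_def)
    moreover have "((\<lambda>y. s (t y)) has_derivative (\<lambda>x. x)) (at y)"
      by (rule has_derivative_transform_within_open[OF has_derivative_ident assms(2) y]) (simp add: st)
    ultimately have "dd s (t y) (t' y x) = x" for x by (metis has_derivative_unique)
    then have "M (t y) *v t' y (axis j 1) = axis j 1" using M[OF ty] by simp
    then have "matrix_inv (M (t y)) *v (M (t y) *v t' y (axis j 1)) = S j (t y)"
      unfolding S_def by simp
    then have "t' y (axis j 1) = S j (t y)"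
      using inv[OF ty] by (simp add: matrix_vector_mul_assoc matrix_inv)
    then show ?thesis using dd_eq[OF t[OF y]] by simp
  qed
  have "Ck k V t" for k
  proof (induction k)
    case 0
    show ?case using t by (auto intro!: continuous_at_imp_continuous_on has_derivative_continuous)
  next
    case (Suc k)
    show ?case
    proof (rule Ck_SucI[OF assms(2) t])
      fix i :: "real^'n" assume "i \<in> Basis"
      then obtain j where j: "i = axis j 1" by (auto simp: Basis_vec_def)
      have "Ck k V (\<lambda>y. S j (t y))"
        using Ck_compose[OF assms(2,1,4)] smooth_onD[OF S] Suc by blast
      then show "Ck k V (\<lambda>y. dd t y i)"
        using Ck_cong[OF assms(2), of "\<lambda>y. dd t y i" "\<lambda>y. S j (t y)"] dt j by blast
    qed
  qed
  then show ?thesis by (rule smooth_onI)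
qed

text \<open>The inverse function theorem yields a differentiable inverse; injectivity of
  \<open>dd s\<close> is asked on all of \<open>U\<close>, not just at \<open>p\<close>, so that the
  bootstrap of \<open>smooth_on_local_inverse\<close> applies on the whole of
  \<open>V\<close>.\<close>

lemma smooth_inverse_function:
  fixes s :: "real^'n \<Rightarrow> real^'n"
  assumes "open U" "smooth_on U s" "p \<in> U" and inj: "\<And>u X. u \<in> U \<Longrightarrow> dd s u X = 0 \<Longrightarrow> X = 0"
  obtains W V t where "open W" "p \<in> W" "W \<subseteq> U" "open V" "s p \<in> V" "homeomorphism W V s t" "smooth_on V t"
proof -
  have der: "(s has_derivative dd s u) (at u)" if "u \<in> U" for u
    using smooth_on_has_derivative[OF assms(2,1) that] .
  \<comment> \<open>The derivative as a bounded operator; its continuity in operator norm can be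
    tested on one basis vector at a time.\<close>
  define s' where "s' u = Blinfun (dd s u)" for u
  have s': "blinfun_apply (s' u) = dd s u" if "u \<in> U" for u
    unfolding s'_def using der[OF that] by (simp add: bounded_linear_Blinfun_apply has_derivative_bounded_linear)
  have 1: "(s has_derivative blinfun_apply (s' u)) (at u)" if "u \<in> U" for u
    using der[OF that] s'[OF that] by simp
  have 2: "continuous_on U s'"
  proof (rule continuous_on_blinfun_componentwise)
    fix i :: "real^'n"
    have "continuous_on U (\<lambda>u. dd s u i)"
      using smooth_on_dd[OF assms(1,2) smooth_on_const] smooth_onD Ck_continuous_on by blast
    then show "continuous_on U (\<lambda>u. blinfun_apply (s' u) i)"
      using s' by (simp cong: continuous_on_cong)
  qed
  have lin: "linear (dd s p)" using der[OF assms(3)] has_derivative_linear by blast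
  then have "inj (dd s p)" using inj[OF assms(3)] linear_injective_0 by blast
  then obtain g where g: "linear g" "g \<circ> dd s p = id"
    using linear_injective_left_inverse[OF lin] by blast
  have 3: "Blinfun g o\<^sub>L s' p = id_blinfun"
    using g s'[OF assms(3)]
    by (intro blinfun_eqI) (simp add: bounded_linear_Blinfun_apply linear_conv_bounded_linear[symmetric] pointfree_idE)
  obtain W V t t' where *: "open W" "W \<subseteq> U" "p \<in> W" "open V" "s p \<in> V" "homeomorphism W V s t"
      "\<And>y. y \<in> V \<Longrightarrow> (t has_derivative (t' y)) (at y)"
    using inverse_function_theorem[OF assms(1) 1 2 assms(3) 3] by metis
  have "smooth_on V t"
  proof (rule smooth_on_local_inverse[OF *(1,4) smooth_on_subset[OF assms(2,1) *(1,2)] _ _ *(7)])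
    show "t ` V \<subseteq> W" "\<And>y. y \<in> V \<Longrightarrow> s (t y) = y"
      using *(6) by (auto simp: homeomorphism_def)
  qed (use inj *(2) in blast)+
  then show ?thesis using that * by blast
qed

section \<open>Bilinear maps that depend on a point\<close>

lemma bilinear_eq_sum_Basis:
  fixes B :: "'a::euclidean_space \<Rightarrow> 'b::euclidean_space \<Rightarrow> 'c::real_vector"
  assumes "bilinear B"
  shows "B x y = (\<Sum>i\<in>Basis. \<Sum>j\<in>Basis. (x \<bullet> i) *\<^sub>R (y \<bullet> j) *\<^sub>R B i j)"
proof -
  have "linear (\<lambda>x. B x y)" "\<And>x. linear (B x)"
    using assms by (auto simp: bilinear_def)
  then show ?thesis
    by (subst linear_eq_sum_Basis[of "\<lambda>x. B x y"], simp)
      (subst linear_eq_sum_Basis[of "B _"], simp_all add: scaleR_sum_right)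
qed

text \<open>Serves for metrics and connections, whose derivatives are given for constant arguments
  only; expansion in bases reduces moving arguments to that case.\<close>

lemma has_derivative_bilinear_field:
  fixes B :: "'a::real_normed_vector \<Rightarrow> 'b::euclidean_space \<Rightarrow> 'c::euclidean_space \<Rightarrow> 'd::real_normed_vector"
  assumes bil: "\<And>w. bilinear (B w)"
    and B: "\<And>x y. ((\<lambda>w. B w x y) has_derivative (\<lambda>z. B' z x y)) (at u)"
    and X: "(X has_derivative X') (at u)" and Y: "(Y has_derivative Y') (at u)"
  shows "((\<lambda>w. B w (X w) (Y w)) has_derivative
    (\<lambda>z. B' z (X u) (Y u) + B u (X' z) (Y u) + B u (X u) (Y' z))) (at u)"
proof -
  \<comment> \<open>Uniqueness of derivatives carries the basis expansion of \<open>B\<close> over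
    to \<open>B'\<close>, whose bilinearity is not among the assumptions.\<close>
  have B': "B' z x y = (\<Sum>i\<in>Basis. \<Sum>j\<in>Basis. (x \<bullet> i) *\<^sub>R (y \<bullet> j) *\<^sub>R B' z i j)" for x y z
  proof -
    have "((\<lambda>w. \<Sum>i\<in>Basis. \<Sum>j\<in>Basis. (x \<bullet> i) *\<^sub>R (y \<bullet> j) *\<^sub>R B w i j) has_derivative
        (\<lambda>z. \<Sum>i\<in>Basis. \<Sum>j\<in>Basis. (x \<bullet> i) *\<^sub>R (y \<bullet> j) *\<^sub>R B' z i j)) (at u)"
      by (intro has_derivative_sum has_derivative_scaleR_right B)
    then have "(\<lambda>z. B' z x y) = (\<lambda>z. \<Sum>i\<in>Basis. \<Sum>j\<in>Basis. (x \<bullet> i) *\<^sub>R (y \<bullet> j) *\<^sub>R B' z i j)"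
      unfolding bilinear_eq_sum_Basis[OF bil, of _ x y, symmetric] by (rule has_derivative_unique[OF B])
    then show ?thesis by (rule fun_cong)
  qed
  have *: "((\<lambda>w. \<Sum>i\<in>Basis. \<Sum>j\<in>Basis. (X w \<bullet> i) *\<^sub>R (Y w \<bullet> j) *\<^sub>R B w i j) has_derivative
      (\<lambda>z. \<Sum>i\<in>Basis. \<Sum>j\<in>Basis. (X u \<bullet> i) *\<^sub>R ((Y u \<bullet> j) *\<^sub>R B' z i j + (Y' z \<bullet> j) *\<^sub>R B u i j)
        + (X' z \<bullet> i) *\<^sub>R (Y u \<bullet> j) *\<^sub>R B u i j)) (at u)"
    by (intro has_derivative_sum has_derivative_scaleR has_derivative_inner_left X Y B)
  show ?thesis
    using * unfolding bilinear_eq_sum_Basis[OF bil, of _ "X _"] bilinear_eq_sum_Basis[OF bil, of _ "X' _"] B'[of _ "X u"]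
    by (simp add: scaleR_right_distrib sum.distrib add.assoc add.commute add.left_commute)
qed

lemma smooth_on_bilinear_field:
  fixes B :: "'a::euclidean_space \<Rightarrow> 'b::euclidean_space \<Rightarrow> 'c::euclidean_space \<Rightarrow> 'd::real_normed_vector"
  assumes "open U" "\<And>w. bilinear (B w)" "\<And>x y. smooth_on U (\<lambda>w. B w x y)" "smooth_on U X" "smooth_on U Y"
  shows "smooth_on U (\<lambda>w. B w (X w) (Y w))"
  unfolding bilinear_eq_sum_Basis[OF assms(2), of _ "X _"]
  by (intro smooth_on_sum smooth_on_scaleR smooth_on_bounded_linear[OF bounded_linear_inner_left] assms)

section \<open>The Codazzi and Gauss equations in a null frame\<close>

text \<open>Pairing with \<open>F\<close>, \<open>V\<close>, \<open>E\<close> reads off the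
  coefficients of \<open>E\<close>, \<open>V\<close>, \<open>F\<close>. Hence the three vectors are
  independent, and in dimension three they span.\<close>

lemma null_frame_expansion:
  fixes b :: "real^3 \<Rightarrow> real^3 \<Rightarrow> real"
  assumes bil: "bilinear b" and sym: "\<And>X Y. b X Y = b Y X"
    and b: "b E E = 0" "b F F = 0" "b E F = 1" "b V E = 0" "b V F = 0" "b V V = 1"
  shows "X = b X F *\<^sub>R E + b X V *\<^sub>R V + b X E *\<^sub>R F"
proof -
  note lin = bilinear_ladd[OF bil] bilinear_lmul[OF bil] bilinear_lzero[OF bil]
  have b': "b F E = 1" "b E V = 0" "b F V = 0" using b sym by metis+
  define A :: "real^3^3" where "A = (\<chi> i j. if j = 1 then E $ i else if j = 2 then V $ i else F $ i)"
  have A: "A *v x = x$1 *\<^sub>R E + x$2 *\<^sub>R V + x$3 *\<^sub>R F" for x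
    by (simp add: vec_eq_iff matrix_vector_mult_def sum_3 A_def mult.commute)
  have "x = 0" if "A *v x = 0" for x
  proof -
    have "b (A *v x) Y = 0" for Y using that by (simp add: lin)
    from this[of F] this[of V] this[of E] have "x$1 = 0" "x$2 = 0" "x$3 = 0"
      by (simp_all add: A lin b b')
    then show ?thesis by (simp add: vec_eq_iff forall_3)
  qed
  then have "inj ((*v) A)"
    by (simp add: linear_injective_0)
  then have "surj ((*v) A)"
    by (simp add: linear_injective_imp_surjective)
  then obtain x where "X = A *v x" by (metis surjD)
  then have X: "X = x$1 *\<^sub>R E + x$2 *\<^sub>R V + x$3 *\<^sub>R F" by (simp add: A)
  have "b X F = x$1" "b X V = x$2" "b X E = x$3"
    by (simp_all add: X lin b b')
  then show ?thesis using X by simp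
qed

text \<open>
  \<open>G\<close> is the induced connection in the given coordinates, \<open>\<phi>\<close> is centred so that the affine normal is \<open>-H \<phi>\<close>, \<open>C\<close> is the
  cubic form \<open>h(K(X,Y),Z)\<close>, and \<open>compat\<close> says that \<open>G - K\<close> is the Levi-Civita connection of \<open>h\<close>.
\<close>

locale so11_sphere =
  fixes U :: "(real^3) set" and \<phi> :: "real^3 \<Rightarrow> real^4"
    and h :: "real^3 \<Rightarrow> real^3 \<Rightarrow> real^3 \<Rightarrow> real" and G :: "real^3 \<Rightarrow> real^3 \<Rightarrow> real^3 \<Rightarrow> real^3"
    and E V F :: "real^3 \<Rightarrow> real^3" and r q :: "real^3 \<Rightarrow> real" and H :: real
    and \<theta> :: "real^3 \<Rightarrow> real^3 \<Rightarrow> real"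
    and C :: "real^3 \<Rightarrow> real^3 \<Rightarrow> real^3 \<Rightarrow> real^3 \<Rightarrow> real"
  defines "\<theta> \<equiv> \<lambda>u. h u (V u)"
    and "C \<equiv> \<lambda>u X Y Z. r u * (\<theta> u X * h u Y Z + \<theta> u Y * h u X Z + \<theta> u Z * h u X Y - 5 * \<theta> u X * \<theta> u Y * \<theta> u Z)"
  assumes U: "open U"
    and smooth: "smooth_on U \<phi>" "smooth_on U E" "smooth_on U V" "smooth_on U F" "smooth_on U r"
      "\<And>X Y. smooth_on U (\<lambda>u. h u X Y)" "\<And>X Y. smooth_on U (\<lambda>u. G u X Y)"
    and h_bil: "\<And>u. bilinear (h u)" and G_bil: "\<And>u. bilinear (G u)"
    and h_sym: "\<And>u X Y. u \<in> U \<Longrightarrow> h u X Y = h u Y X"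
    and G_sym: "\<And>u X Y. u \<in> U \<Longrightarrow> G u X Y = G u Y X"
    and frame: "\<And>u. u \<in> U \<Longrightarrow> h u (E u) (E u) = 0" "\<And>u. u \<in> U \<Longrightarrow> h u (F u) (F u) = 0"
      "\<And>u. u \<in> U \<Longrightarrow> h u (E u) (F u) = 1" "\<And>u. u \<in> U \<Longrightarrow> h u (V u) (E u) = 0"
      "\<And>u. u \<in> U \<Longrightarrow> h u (V u) (F u) = 0" "\<And>u. u \<in> U \<Longrightarrow> h u (V u) (V u) = 1"
    and r_pos: "\<And>u. u \<in> U \<Longrightarrow> r u > 0"
    and struct: "\<And>u X Y. u \<in> U \<Longrightarrow> dd (\<lambda>w. dd \<phi> w Y) u X = dd \<phi> u (G u X Y) - (H * h u X Y) *\<^sub>R \<phi> u"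
    and indep: "\<And>u X c. u \<in> U \<Longrightarrow> dd \<phi> u X = c *\<^sub>R \<phi> u \<Longrightarrow> X = 0"
    and phi_nz: "\<And>u. u \<in> U \<Longrightarrow> \<phi> u \<noteq> 0"
    and compat: "\<And>u X Y Z. u \<in> U \<Longrightarrow>
      dd (\<lambda>w. h w X Y) u Z = h u (G u Z X) Y + h u X (G u Z Y) - 2 * C u X Y Z"
    and q_def: "\<And>u. u \<in> U \<Longrightarrow> q u = h u (dd V u (E u) + G u (E u) (V u)) (F u)"
    and H_eq: "\<And>u. u \<in> U \<Longrightarrow> H = q u * (2 * r u - q u)" and H_nz: "H \<noteq> 0"
begin

lemmas h_linear = bilinear_ladd[OF h_bil] bilinear_radd[OF h_bil] bilinear_lmul[OF h_bil] bilinear_rmul[OF h_bil]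
  bilinear_lsub[OF h_bil] bilinear_rsub[OF h_bil] bilinear_lneg[OF h_bil] bilinear_rneg[OF h_bil]
  bilinear_lzero[OF h_bil] bilinear_rzero[OF h_bil]

lemmas G_linear = bilinear_ladd[OF G_bil] bilinear_radd[OF G_bil] bilinear_lmul[OF G_bil] bilinear_rmul[OF G_bil]
  bilinear_lsub[OF G_bil] bilinear_rsub[OF G_bil] bilinear_lneg[OF G_bil] bilinear_rneg[OF G_bil]
  bilinear_lzero[OF G_bil] bilinear_rzero[OF G_bil]

lemma \<theta>_simps:
  "\<theta> u (X + Y) = \<theta> u X + \<theta> u Y" "\<theta> u (X - Y) = \<theta> u X - \<theta> u Y" "\<theta> u (c *\<^sub>R X) = c * \<theta> u X" "\<theta> u 0 = 0"
  by (simp_all add: \<theta>_def h_linear)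

lemma \<theta>_frame: "u \<in> U \<Longrightarrow> \<theta> u (E u) = 0" "u \<in> U \<Longrightarrow> \<theta> u (F u) = 0" "u \<in> U \<Longrightarrow> \<theta> u (V u) = 1"
  using frame by (simp_all add: \<theta>_def)

lemma frame_expansion:
  assumes u: "u \<in> U"
  shows "X = h u X (F u) *\<^sub>R E u + \<theta> u X *\<^sub>R V u + h u X (E u) *\<^sub>R F u"
  using null_frame_expansion[OF h_bil h_sym[OF u] frame[OF u]]
  by (simp add: \<theta>_def h_sym[OF u, of "V u"])

lemma h_eqI:
  assumes u: "u \<in> U" and "\<And>Z. h u X Z = h u Y Z"
  shows "X = Y"
proof -
  have "\<theta> u X = \<theta> u Y" using assms(2)[of "V u"] h_sym[OF u] by (simp add: \<theta>_def)
  then show ?thesis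
    using frame_expansion[OF u, of X] frame_expansion[OF u, of Y] assms(2) by simp
qed

text \<open>At X = Y = V the three symmetric terms give 3V; subtracting 5V produces the prescribed
  -2V, while every other pair of frame vectors is untouched by that term.\<close>

definition K where
  "K u X Y = r u *\<^sub>R (\<theta> u X *\<^sub>R Y + \<theta> u Y *\<^sub>R X + h u X Y *\<^sub>R V u - (5 * \<theta> u X * \<theta> u Y) *\<^sub>R V u)"

definition L where "L u X Y = G u X Y - K u X Y"

lemma h_K: "u \<in> U \<Longrightarrow> h u (K u X Y) Z = C u X Y Z"
  by (simp add: K_def C_def \<theta>_def h_linear algebra_simps)

lemma h_K': "u \<in> U \<Longrightarrow> h u Z (K u X Y) = C u X Y Z"
  using h_K h_sym by metis

lemma K_sym: "u \<in> U \<Longrightarrow> K u X Y = K u Y X"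
  by (simp add: K_def h_sym[of u X Y] add.commute mult.commute)

lemma L_sym: "u \<in> U \<Longrightarrow> L u X Y = L u Y X"
  by (simp add: L_def K_sym[of u X Y] G_sym[of u X Y])

lemma C_perm: "u \<in> U \<Longrightarrow> C u X Y Z = C u Y X Z" "u \<in> U \<Longrightarrow> C u X Y Z = C u X Z Y"
  by (simp_all add: C_def h_sym[of u X Y] h_sym[of u Y Z] algebra_simps)

lemma C_linear:
  "C u (X + X') Y Z = C u X Y Z + C u X' Y Z" "C u (X - X') Y Z = C u X Y Z - C u X' Y Z"
  by (simp_all add: C_def h_linear \<theta>_simps algebra_simps)

text \<open>Replacing \<open>G\<close> by \<open>L + K\<close> adds one \<open>C\<close> for each
  slot of \<open>h\<close>, by the total symmetry of \<open>C\<close>; these two cancel the -2C of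
  \<open>compat\<close>.\<close>

lemma compat_L: "u \<in> U \<Longrightarrow> dd (\<lambda>w. h w X Y) u Z = h u (L u Z X) Y + h u X (L u Z Y)"
  using C_perm(1)[of u Z X Y] C_perm(2)[of u X Z Y] C_perm(2)[of u Z Y X]
  by (simp add: compat L_def h_linear h_K h_K')

lemma has_derivative_h_const: "u \<in> U \<Longrightarrow> ((\<lambda>w. h w X Y) has_derivative dd (\<lambda>w. h w X Y) u) (at u)"
  by (rule smooth_on_has_derivative[OF smooth(6) U])

lemma has_derivative_h:
  assumes "u \<in> U" "(X has_derivative X') (at u)" "(Y has_derivative Y') (at u)"
  shows "((\<lambda>w. h w (X w) (Y w)) has_derivative
    (\<lambda>z. h u (L u z (X u)) (Y u) + h u (X u) (L u z (Y u)) + h u (X' z) (Y u) + h u (X u) (Y' z))) (at u)"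
proof -
  have "((\<lambda>w. h w x y) has_derivative (\<lambda>z. h u (L u z x) y + h u x (L u z y))) (at u)" for x y
    using has_derivative_h_const[OF assms(1), of x y] by (simp add: compat_L[OF assms(1), abs_def])
  then show ?thesis by (rule has_derivative_bilinear_field[OF h_bil _ assms(2,3)])
qed

lemma has_derivative_frame:
  assumes "u \<in> U"
  shows "(E has_derivative dd E u) (at u)" "(V has_derivative dd V u) (at u)" "(F has_derivative dd F u) (at u)"
    "(r has_derivative dd r u) (at u)" "(\<phi> has_derivative dd \<phi> u) (at u)"
  using smooth_on_has_derivative[OF _ U assms] smooth by blast+

text \<open>\<open>N u X\<close> is \<open>\<nabla>\<^sub>X V\<close>, and \<open>t u X Y\<close> is \<open>h\<close> of the Levi-Civita derivative of \<open>V\<close> along \<open>X\<close> with \<open>Y\<close>.\<close>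

definition N where "N u X = dd V u X + G u X (V u)"

definition t where "t u X Y = h u (N u X - K u X (V u)) Y"

lemma t_eq: "t u X Y = h u (dd V u X + L u X (V u)) Y"
  by (simp add: t_def N_def L_def algebra_simps)

lemma has_derivative_\<theta>:
  assumes "u \<in> U"
  shows "((\<lambda>w. \<theta> w X) has_derivative (\<lambda>z. t u z X + \<theta> u (L u z X))) (at u)"
  using has_derivative_h[OF assms has_derivative_frame(2)[OF assms] has_derivative_const, of X]
  by (simp add: \<theta>_def t_eq h_linear algebra_simps)

text \<open>Obtained by differentiating h(V,V) = 1 with a metric connection.\<close>

lemma t_V:
  assumes u: "u \<in> U"
  shows "t u X (V u) = 0"
proof -
  have "((\<lambda>w. h w (V w) (V w)) has_derivative (\<lambda>z. 0)) (at u)"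
    by (rule has_derivative_transform_within_open[OF has_derivative_const[of 1] U u]) (simp add: frame)
  from has_derivative_unique[OF this has_derivative_h[OF u has_derivative_frame(2)[OF u] has_derivative_frame(2)[OF u]]]
  have "0 = h u (L u X (V u)) (V u) + h u (V u) (L u X (V u)) + h u (dd V u X) (V u) + h u (V u) (dd V u X)"
    by metis
  then show ?thesis
    using h_sym[OF u] by (simp add: t_eq h_linear)
qed

text \<open>The split matters: the three terms with \<open>L\<close> will cancel in the Codazzi
  equation, and what is left is the covariant derivative of \<open>C\<close>.\<close>

lemma has_derivative_C:
  assumes u: "u \<in> U"
  shows "((\<lambda>w. C w X Y Z) has_derivative (\<lambda>z.
     dd r u z * (\<theta> u X * h u Y Z + \<theta> u Y * h u X Z + \<theta> u Z * h u X Y - 5 * \<theta> u X * \<theta> u Y * \<theta> u Z)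
     + r u * (t u z X * (h u Y Z - 5 * \<theta> u Y * \<theta> u Z) + t u z Y * (h u X Z - 5 * \<theta> u X * \<theta> u Z)
        + t u z Z * (h u X Y - 5 * \<theta> u X * \<theta> u Y))
     + C u (L u z X) Y Z + C u X (L u z Y) Z + C u X Y (L u z Z))) (at u)"
proof -
  have hh: "((\<lambda>w. h w x y) has_derivative (\<lambda>z. h u (L u z x) y + h u x (L u z y))) (at u)" for x y
    using has_derivative_h_const[OF u, of x y] by (simp add: compat_L[OF u, abs_def])
  show ?thesis unfolding C_def
    by (rule has_derivative_eq_rhs, (rule has_derivative_mult has_derivative_add has_derivative_diff
        has_derivative_\<theta>[OF u] hh has_derivative_frame(4)[OF u] has_derivative_const)+)
       (simp add: algebra_simps fun_eq_iff)
qed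

end

text \<open>A product rule in which base point and direction both move. With the identity as
  \<open>\<tau>\<close> it handles fields on \<open>U\<close>, and with a parametrisation it handles
  the adapted chart.\<close>

lemma has_derivative_dd_field:
  fixes f :: "'a::euclidean_space \<Rightarrow> 'b::real_normed_vector" and \<tau> :: "'c::real_normed_vector \<Rightarrow> 'a"
  assumes "open U" "smooth_on U f" "open D" "y \<in> D" and \<tau>U: "\<And>w. w \<in> D \<Longrightarrow> \<tau> w \<in> U"
    and \<tau>: "(\<tau> has_derivative \<tau>') (at y)" and Y: "(Y has_derivative Y') (at y)"
  shows "((\<lambda>w. dd f (\<tau> w) (Y w)) has_derivative
    (\<lambda>z. dd (\<lambda>w. dd f w (Y y)) (\<tau> y) (\<tau>' z) + dd f (\<tau> y) (Y' z))) (at y)"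
proof -
  have u: "\<tau> y \<in> U" using assms(4) \<tau>U by blast
  have lin: "linear (dd f w)" if "w \<in> U" for w
    using smooth_on_has_derivative[OF assms(2,1) that] has_derivative_linear by blast
  have der: "((\<lambda>w. dd f w x) has_derivative dd (\<lambda>w. dd f w x) (\<tau> y)) (at (\<tau> y))" for x
    by (rule smooth_on_has_derivative[OF smooth_on_dd[OF assms(1,2) smooth_on_const] assms(1) u])
  have der\<tau>: "((\<lambda>w. dd f (\<tau> w) x) has_derivative (\<lambda>z. dd (\<lambda>w. dd f w x) (\<tau> y) (\<tau>' z))) (at y)" for x
    using diff_chain_at[OF \<tau> der] by (simp add: o_def)
  have const: "dd (\<lambda>w. dd f w x) (\<tau> y) z = (\<Sum>j\<in>Basis. (x \<bullet> j) *\<^sub>R dd (\<lambda>w. dd f w j) (\<tau> y) z)" for x z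
  proof -
    have "((\<lambda>w. \<Sum>j\<in>Basis. (x \<bullet> j) *\<^sub>R dd f w j) has_derivative
        (\<lambda>z. \<Sum>j\<in>Basis. (x \<bullet> j) *\<^sub>R dd (\<lambda>w. dd f w j) (\<tau> y) z)) (at (\<tau> y))"
      by (intro has_derivative_sum has_derivative_scaleR_right der)
    then have "((\<lambda>w. dd f w x) has_derivative
        (\<lambda>z. \<Sum>j\<in>Basis. (x \<bullet> j) *\<^sub>R dd (\<lambda>w. dd f w j) (\<tau> y) z)) (at (\<tau> y))"
      by (rule has_derivative_transform_within_open[OF _ assms(1) u])
        (rule linear_eq_sum_Basis[OF lin, symmetric])
    from fun_cong[OF dd_eq[OF this]] show ?thesis .
  qed
  have "((\<lambda>w. \<Sum>j\<in>Basis. (Y w \<bullet> j) *\<^sub>R dd f (\<tau> w) j) has_derivative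
      (\<lambda>z. \<Sum>j\<in>Basis. (Y y \<bullet> j) *\<^sub>R dd (\<lambda>w. dd f w j) (\<tau> y) (\<tau>' z) + (Y' z \<bullet> j) *\<^sub>R dd f (\<tau> y) j)) (at y)"
    by (intro has_derivative_sum has_derivative_scaleR has_derivative_inner_left Y der\<tau>)
  moreover have "(\<Sum>j\<in>Basis. (Y y \<bullet> j) *\<^sub>R dd (\<lambda>w. dd f w j) (\<tau> y) (\<tau>' z) + (Y' z \<bullet> j) *\<^sub>R dd f (\<tau> y) j)
      = dd (\<lambda>w. dd f w (Y y)) (\<tau> y) (\<tau>' z) + dd f (\<tau> y) (Y' z)" for z
    unfolding const[of "Y y"] linear_eq_sum_Basis[OF lin[OF u], of "Y' z"] by (rule sum.distrib)
  ultimately have "((\<lambda>w. \<Sum>j\<in>Basis. (Y w \<bullet> j) *\<^sub>R dd f (\<tau> w) j) has_derivative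
      (\<lambda>z. dd (\<lambda>w. dd f w (Y y)) (\<tau> y) (\<tau>' z) + dd f (\<tau> y) (Y' z))) (at y)"
    by simp
  then show ?thesis
    by (rule has_derivative_transform_within_open[OF _ assms(3,4)])
      (rule linear_eq_sum_Basis[OF lin[OF \<tau>U], symmetric])
qed

context so11_sphere
begin

lemma C_rot: "u \<in> U \<Longrightarrow> C u X Y Z = C u Y Z X"
  using C_perm(1)[of u X Y Z] C_perm(2)[of u Y X Z] by simp

lemma dd_\<phi>_linear:
  assumes "u \<in> U"
  shows "dd \<phi> u (X + Y) = dd \<phi> u X + dd \<phi> u Y" "dd \<phi> u (X - Y) = dd \<phi> u X - dd \<phi> u Y"
    "dd \<phi> u (c *\<^sub>R X) = c *\<^sub>R dd \<phi> u X" "dd \<phi> u 0 = 0"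
  using has_derivative_linear[OF has_derivative_frame(5)[OF assms]]
  by (simp_all add: linear_add linear_diff linear_scale linear_0)

lemma has_derivative_\<phi>_field_along:
  fixes \<tau> :: "'a::real_normed_vector \<Rightarrow> real^3"
  assumes "open D" "y \<in> D" and \<tau>U: "\<And>w. w \<in> D \<Longrightarrow> \<tau> w \<in> U"
    and \<tau>: "(\<tau> has_derivative \<tau>') (at y)" and Y: "(Y has_derivative Y') (at y)"
  shows "((\<lambda>w. dd \<phi> (\<tau> w) (Y w)) has_derivative
    (\<lambda>z. dd \<phi> (\<tau> y) (G (\<tau> y) (\<tau>' z) (Y y) + Y' z) - (H * h (\<tau> y) (\<tau>' z) (Y y)) *\<^sub>R \<phi> (\<tau> y))) (at y)"
  using has_derivative_dd_field[OF U smooth(1) assms]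
  by (simp add: struct[OF \<tau>U[OF assms(2)]] dd_\<phi>_linear[OF \<tau>U[OF assms(2)]] algebra_simps)

lemma has_derivative_\<phi>_field:
  assumes "u \<in> U" "(Y has_derivative Y') (at u)"
  shows "((\<lambda>w. dd \<phi> w (Y w)) has_derivative
    (\<lambda>z. dd \<phi> u (G u z (Y u) + Y' z) - (H * h u z (Y u)) *\<^sub>R \<phi> u)) (at u)"
  by (rule has_derivative_\<phi>_field_along[OF U assms(1) _ has_derivative_ident assms(2)])

lemma has_derivative_G_const: "u \<in> U \<Longrightarrow> ((\<lambda>w. G w X Y) has_derivative dd (\<lambda>w. G w X Y) u) (at u)"
  by (rule smooth_on_has_derivative[OF smooth(7) U])

text \<open>The mixed second derivatives of the map \<open>dd \<phi> w X\<close> agree, and since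
  \<open>\<phi>\<close> is transversal their tangential parts agree too. For constant
  \<open>W\<close> and \<open>Z\<close> no bracket enters.\<close>

lemma gauss:
  assumes u: "u \<in> U"
  shows "G u W (G u Z X) + dd (\<lambda>w. G w Z X) u W - (H * h u Z X) *\<^sub>R W
    = G u Z (G u W X) + dd (\<lambda>w. G w W X) u Z - (H * h u W X) *\<^sub>R Z"
proof -
  define a where "a W Z = H * (h u W (G u Z X) + h u (L u W Z) X + h u Z (L u W X))" for W Z
  define R where "R W Z = G u W (G u Z X) + dd (\<lambda>w. G w Z X) u W - (H * h u Z X) *\<^sub>R W" for W Z
  have *: "dd (\<lambda>w. dd (\<lambda>v. dd \<phi> v X) w Z) u W = dd \<phi> u (R W Z) - a W Z *\<^sub>R \<phi> u" for W Z
  proof -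
    have "((\<lambda>w. dd \<phi> w (G w Z X) - (H * h w Z X) *\<^sub>R \<phi> w) has_derivative
        (\<lambda>z. (dd \<phi> u (G u z (G u Z X) + dd (\<lambda>w. G w Z X) u z) - (H * h u z (G u Z X)) *\<^sub>R \<phi> u)
          - ((H * h u Z X) *\<^sub>R dd \<phi> u z + (H * (h u (L u z Z) X + h u Z (L u z X))) *\<^sub>R \<phi> u))) (at u)"
      by (intro has_derivative_diff has_derivative_\<phi>_field[OF u] has_derivative_G_const[OF u]
          has_derivative_scaleR has_derivative_mult_right has_derivative_frame(5)[OF u])
        (use has_derivative_h_const[OF u, of Z X] in \<open>simp add: compat_L[OF u, abs_def]\<close>)
    then have "((\<lambda>w. dd (\<lambda>v. dd \<phi> v X) w Z) has_derivative
        (\<lambda>z. (dd \<phi> u (G u z (G u Z X) + dd (\<lambda>w. G w Z X) u z) - (H * h u z (G u Z X)) *\<^sub>R \<phi> u)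
          - ((H * h u Z X) *\<^sub>R dd \<phi> u z + (H * (h u (L u z Z) X + h u Z (L u z X))) *\<^sub>R \<phi> u))) (at u)"
      by (rule has_derivative_transform_within_open[OF _ U u]) (simp add: struct)
    from fun_cong[OF dd_eq[OF this]] show ?thesis
      by (simp add: a_def R_def dd_\<phi>_linear[OF u] algebra_simps)
  qed
  have "dd \<phi> u (R W Z) - a W Z *\<^sub>R \<phi> u = dd \<phi> u (R Z W) - a Z W *\<^sub>R \<phi> u"
    using dd_commute[OF U smooth_on_dd[OF U smooth(1) smooth_on_const] u, of X Z W]
    unfolding * .
  then have "dd \<phi> u (R W Z - R Z W) = (a W Z - a Z W) *\<^sub>R \<phi> u"
    by (simp add: dd_\<phi>_linear[OF u] algebra_simps)
  then have "R W Z - R Z W = 0" by (rule indep[OF u])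
  then show ?thesis by (simp add: R_def)
qed

text \<open>Compares the symmetric second derivative of \<open>h\<close> with the \<open>h\<close>-symmetrised Gauss equation.\<close>

lemma codazzi_raw:
  assumes u: "u \<in> U"
  shows "C u (G u Z X) Y W + C u (G u Z Y) X W + dd (\<lambda>w. C w X Y Z) u W
    = C u (G u W X) Y Z + C u (G u W Y) X Z + dd (\<lambda>w. C w X Y W) u Z"
proof -
  have *: "dd (\<lambda>w. dd (\<lambda>v. h v X Y) w Z) u W
      = h u (L u W (G u Z X)) Y + h u (G u Z X) (L u W Y) + h u (dd (\<lambda>w. G w Z X) u W) Y
       + h u (L u W X) (G u Z Y) + h u X (L u W (G u Z Y)) + h u X (dd (\<lambda>w. G w Z Y) u W)
       - 2 * dd (\<lambda>w. C w X Y Z) u W" for W Z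
  proof -
    have dC: "((\<lambda>w. C w X Y Z) has_derivative dd (\<lambda>w. C w X Y Z) u) (at u)"
      unfolding dd_eq[OF has_derivative_C[OF u]] by (rule has_derivative_C[OF u])
    have "((\<lambda>w. h w (G w Z X) Y + h w X (G w Z Y) - 2 * C w X Y Z) has_derivative
        (\<lambda>z. (h u (L u z (G u Z X)) Y + h u (G u Z X) (L u z Y) + h u (dd (\<lambda>w. G w Z X) u z) Y + h u (G u Z X) 0)
         + (h u (L u z X) (G u Z Y) + h u X (L u z (G u Z Y)) + h u 0 (G u Z Y) + h u X (dd (\<lambda>w. G w Z Y) u z))
         - 2 * dd (\<lambda>w. C w X Y Z) u z)) (at u)"
      by (intro has_derivative_diff has_derivative_add has_derivative_h[OF u] has_derivative_G_const[OF u]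
          has_derivative_const has_derivative_mult_right dC)
    then have "((\<lambda>w. dd (\<lambda>v. h v X Y) w Z) has_derivative
        (\<lambda>z. (h u (L u z (G u Z X)) Y + h u (G u Z X) (L u z Y) + h u (dd (\<lambda>w. G w Z X) u z) Y + h u (G u Z X) 0)
         + (h u (L u z X) (G u Z Y) + h u X (L u z (G u Z Y)) + h u 0 (G u Z Y) + h u X (dd (\<lambda>w. G w Z Y) u z))
         - 2 * dd (\<lambda>w. C w X Y Z) u z)) (at u)"
      by (rule has_derivative_transform_within_open[OF _ U u]) (simp add: compat)
    from fun_cong[OF dd_eq[OF this]] show ?thesis
      by (simp add: h_linear)
  qed
  have sym2: "dd (\<lambda>w. dd (\<lambda>v. h v X Y) w Z) u W = dd (\<lambda>w. dd (\<lambda>v. h v X Y) w W) u Z"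
    by (rule dd_commute[OF U smooth(6) u])
  have g: "h u (G u W (G u Z X)) Y + h u (dd (\<lambda>w. G w Z X) u W) Y - H * h u Z X * h u W Y
    = h u (G u Z (G u W X)) Y + h u (dd (\<lambda>w. G w W X) u Z) Y - H * h u W X * h u Z Y" for X Y
    using arg_cong[OF gauss[OF u, of W Z X], of "\<lambda>v. h u v Y"] by (simp add: h_linear)
  have p: "h u (L u W (G u Z X)) Y = h u (G u W (G u Z X)) Y - C u (G u Z X) Y W" for W Z X Y
    using C_rot[OF u, of W "G u Z X" Y] C_rot[OF u, of "G u Z X" Y W] C_perm(1)[OF u, of "G u Z X" W Y] C_perm(2)[OF u, of "G u Z X" W Y]
    by (simp add: L_def h_linear h_K[OF u])
  have p': "h u X (L u W (G u Z Y)) = h u (G u W (G u Z Y)) X - C u (G u Z Y) X W" for W Z X Y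
    using p[of W Z Y X] h_sym[OF u, of X] by simp
  have s: "h u (G u Z X) (L u W Y) = h u (G u Z X) (G u W Y) - C u (G u Z X) Y W" for W Z X Y
    using C_perm(2)[OF u, of "G u Z X" W Y] C_rot[OF u, of "G u Z X" W Y]
    by (simp add: L_def h_linear h_K'[OF u])
  have s': "h u (L u W X) (G u Z Y) = h u (G u W X) (G u Z Y) - C u (G u Z Y) X W" for W Z X Y
    using s[of Z Y W X] h_sym[OF u, of "L u W X"] h_sym[OF u, of "G u W X"] by simp
  have f: "h u X (dd (\<lambda>w. G w Z Y) u W) = h u (dd (\<lambda>w. G w Z Y) u W) X" for W Z
    by (rule h_sym[OF u])
  have q: "h u (G u W X) (G u Z Y) = h u (G u Z Y) (G u W X)" 
     "h u (G u W Y) (G u Z X) = h u (G u Z X) (G u W Y)"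
    by (rule h_sym[OF u])+
  \<comment> \<open>The curvature contribution H (h(Z,X) h(W,Y) - h(W,X) h(Z,Y)) is skew in
    \<open>X\<close> and \<open>Y\<close>, so the sum of the two Gauss equations loses it.\<close>
  have "H * h u Z X * h u W Y + H * h u Z Y * h u W X = H * h u W X * h u Z Y + H * h u W Y * h u Z X"
    by simp
  then show ?thesis
    using sym2 g[of X Y] g[of Y X] unfolding * p p' s s' f q by linarith
qed

text \<open>The covariant derivative of \<open>C\<close> along \<open>W\<close> with respect to the Levi-Civita connection of \<open>h\<close>.\<close>

definition S where "S u W X Y Z =
   dd r u W * (\<theta> u X * h u Y Z + \<theta> u Y * h u X Z + \<theta> u Z * h u X Y - 5 * \<theta> u X * \<theta> u Y * \<theta> u Z)
     + r u * (t u W X * (h u Y Z - 5 * \<theta> u Y * \<theta> u Z) + t u W Y * (h u X Z - 5 * \<theta> u X * \<theta> u Z)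
        + t u W Z * (h u X Y - 5 * \<theta> u X * \<theta> u Y))"

text \<open>After \<open>G = L + K\<close> the quadratic terms pair off because C(K(Z,X),Y,W) =
  h(K(Z,X),K(Y,W)) is symmetric in the two pairs; the terms with \<open>L\<close> cancel since
  \<open>L\<close> is torsion-free.\<close>

lemma codazzi:
  assumes u: "u \<in> U"
  shows "S u W X Y Z = S u Z X Y W"
proof -
  have dC: "dd (\<lambda>w. C w X Y Z) u W
      = S u W X Y Z + C u (L u W X) Y Z + C u X (L u W Y) Z + C u X Y (L u W Z)" for W Z
    using fun_cong[OF dd_eq[OF has_derivative_C[OF u]]] by (simp add: S_def)
  have G: "G u X Y = L u X Y + K u X Y" for X Y by (simp add: L_def)
  have CK: "C u (K u Z X) Y W = C u (K u W Y) X Z" for W X Y Z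
  proof -
    have "C u (K u Z X) Y W = h u (K u Y W) (K u Z X)"
      unfolding C_rot[OF u, of "K u Z X"] by (rule h_K[OF u, symmetric])
    also have "\<dots> = h u (K u X Z) (K u W Y)"
      unfolding K_sym[OF u, of Y W] K_sym[OF u, of Z X] by (rule h_sym[OF u])
    also have "\<dots> = C u (K u W Y) X Z"
      unfolding C_rot[OF u, of "K u W Y"] by (rule h_K[OF u])
    finally show ?thesis .
  qed
  have "C u X Y (L u W Z) = C u X Y (L u Z W)" unfolding L_sym[OF u, of W Z] ..
  moreover have "C u (L u W Y) X Z = C u X (L u W Y) Z" "C u (L u Z Y) X W = C u X (L u Z Y) W"
    by (rule C_perm(1)[OF u])+
  ultimately show ?thesis
    using codazzi_raw[OF u, of Z X Y W] CK[of Z X Y W] CK[of Z Y X W]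
    unfolding dC G C_linear by linarith
qed

text \<open>In a null frame almost every term vanishes, so each choice of arguments isolates one
  quantity. In geometric terms: V is geodesic for \<open>h\<close>, and the leaves of \<theta> = 0
  are umbilic.\<close>

lemma codazzi_frame:
  assumes u: "u \<in> U"
  shows "dd r u (E u) = 0" "dd r u (F u) = 0"
    "t u (V u) (E u) = 0" "t u (V u) (F u) = 0" "t u (E u) (E u) = 0" "t u (F u) (F u) = 0"
    "t u (E u) (F u) = t u (F u) (E u)" 
proof -
  have s: "h u (F u) (E u) = 1" "h u (E u) (V u) = 0" "h u (F u) (V u) = 0"
    using frame[OF u] h_sym[OF u] by metis+
  note [simp] = frame[OF u] s \<theta>_frame[OF u] t_V[OF u] 
  have r: "r u \<noteq> 0" using r_pos[OF u] by simp
  \<comment> \<open>Exchanging the direction E with the last slot F leaves dr(F) multiplied by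
    h(E,E) = 0 on the other side.\<close>
  show 1: "dd r u (E u) = 0" 
    using codazzi[OF u, of "E u" "V u" "E u" "F u"] by (simp add: S_def)
  show 2: "dd r u (F u) = 0" 
    using codazzi[OF u, of "F u" "V u" "F u" "E u"] by (simp add: S_def)
  show "t u (V u) (E u) = 0"
    using codazzi[OF u, of "V u" "V u" "V u" "E u"] 1 r by (simp add: S_def)
  show "t u (V u) (F u) = 0"
    using codazzi[OF u, of "V u" "V u" "V u" "F u"] 2 r by (simp add: S_def)
  show "t u (E u) (E u) = 0"
    using codazzi[OF u, of "E u" "V u" "E u" "V u"] r by (simp add: S_def)
  show "t u (F u) (F u) = 0"
    using codazzi[OF u, of "F u" "V u" "F u" "V u"] r by (simp add: S_def)
  \<comment> \<open>The factor -4 is h(V,V) - 5; the common right side dr(V) is what makes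
    \<open>t\<close> symmetric on the leaf.\<close>
  have "- (r u * (t u (E u) (F u) * 4)) = dd r u (V u)" "- (r u * (t u (F u) (E u) * 4)) = dd r u (V u)"
    using codazzi[OF u, of "E u" "V u" "F u" "V u"] codazzi[OF u, of "F u" "V u" "E u" "V u"]
    by (simp_all add: S_def)
  then have "r u * t u (E u) (F u) = r u * t u (F u) (E u)" by linarith
  then show "t u (E u) (F u) = t u (F u) (E u)" using r by simp
qed

text \<open>On the frame \<open>t\<close> equals (q - r)(h - \<theta>\<theta>). Adding K(X,V) = r (X
  - 3 \<theta>(X) V) passes from the Levi-Civita derivative of V to the induced one.\<close>

lemma N_eq:
  assumes u: "u \<in> U"
  shows "N u X = q u *\<^sub>R X - ((q u + 2 * r u) * \<theta> u X) *\<^sub>R V u"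
proof -
  have s: "h u (F u) (E u) = 1" "h u (E u) (V u) = 0" "h u (F u) (V u) = 0"
    using frame[OF u] h_sym[OF u] by metis+
  have lin: "linear (dd V u)" using has_derivative_linear[OF has_derivative_frame(2)[OF u]] .
  have t_lin: "t u (a *\<^sub>R X1 + b *\<^sub>R X2 + c *\<^sub>R X3) Y = a * t u X1 Y + b * t u X2 Y + c * t u X3 Y" for a b c X1 X2 X3 Y
    by (simp add: t_eq L_def K_def \<theta>_simps linear_add[OF lin] linear_scale[OF lin] h_linear G_linear algebra_simps)
  \<comment> \<open>\<open>q\<close> measures the induced derivative of V and \<open>t\<close> the
    Levi-Civita one; K(E,V) = r E is the difference.\<close>
  have tEF: "t u (E u) (F u) = q u - r u"
    by (simp add: t_def N_def q_def[OF u] h_linear h_K[OF u] C_def \<theta>_frame[OF u] frame[OF u] s)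
  have tX: "t u X Y = (q u - r u) * (h u X Y - \<theta> u X * \<theta> u Y)" if "Y = E u \<or> Y = F u \<or> Y = V u" for Y
    using that
    by (subst frame_expansion[OF u, of X], subst t_lin)
      (auto simp: codazzi_frame(3-6)[OF u] tEF codazzi_frame(7)[OF u, symmetric] t_V[OF u] \<theta>_frame[OF u] frame[OF u] \<theta>_def h_sym[OF u, of X "V u"])
  have tX': "t u X Y = (q u - r u) * (h u X Y - \<theta> u X * \<theta> u Y)" for Y
  proof -
    have tr: "t u X (a *\<^sub>R Y1 + b *\<^sub>R Y2 + c *\<^sub>R Y3) = a * t u X Y1 + b * t u X Y2 + c * t u X Y3" for a b c Y1 Y2 Y3
      by (simp add: t_def h_linear algebra_simps)
    obtain a b c where Y: "Y = a *\<^sub>R E u + b *\<^sub>R V u + c *\<^sub>R F u"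
      using frame_expansion[OF u, of Y] by blast
    show ?thesis
      unfolding Y tr h_linear \<theta>_simps by (simp add: tX) (simp add: algebra_simps)
  qed
  have "h u (N u X) Y = h u (q u *\<^sub>R X - ((q u + 2 * r u) * \<theta> u X) *\<^sub>R V u) Y" for Y
  proof -
    have "h u (N u X) Y = t u X Y + C u X (V u) Y" by (simp add: t_def h_linear h_K[OF u])
    also have "\<dots> = h u (q u *\<^sub>R X - ((q u + 2 * r u) * \<theta> u X) *\<^sub>R V u) Y"
      unfolding tX' C_def \<theta>_def h_linear by (simp add: h_sym[OF u, of X "V u"] frame[OF u] algebra_simps)
    finally show ?thesis .
  qed
  then show ?thesis by (rule h_eqI[OF u])
qed

lemma t_val:
  assumes u: "u \<in> U"
  shows "t u X Y = (q u - r u) * (h u X Y - \<theta> u X * \<theta> u Y)"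
  unfolding t_def N_eq[OF u] h_linear h_K[OF u] C_def \<theta>_def
  by (simp add: h_sym[OF u, of X "V u"] frame[OF u] algebra_simps)

end

section \<open>The constant direction and the constant hyperplane\<close>

text \<open>Dividing \<open>y\<close> by its value under a fixed functional cancels the growth rate
  \<open>c\<close>, so the quotient has derivative zero and is constant on a convex set.\<close>

lemma constant_direction:
  fixes y :: "'a::real_normed_vector \<Rightarrow> 'b::euclidean_space"
  assumes "convex B" "p \<in> B" "u \<in> B"
    and y: "\<And>u. u \<in> B \<Longrightarrow> (y has_derivative (\<lambda>z. c u z *\<^sub>R y u)) (at u)"
    and nz: "\<And>u. u \<in> B \<Longrightarrow> n \<bullet> y u \<noteq> 0"
  shows "y u = ((n \<bullet> y u) / (n \<bullet> y p)) *\<^sub>R y p"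
proof -
  define g where "g u = inverse (n \<bullet> y u) *\<^sub>R y u" for u
  have "(g has_derivative (\<lambda>z. 0)) (at u within B)" if u: "u \<in> B" for u
  proof -
    have i: "((\<lambda>u. n \<bullet> y u) has_derivative (\<lambda>z. c u z * (n \<bullet> y u))) (at u)"
      using has_derivative_inner_right[OF y[OF u], of n] by simp
    have "(g has_derivative (\<lambda>z. inverse (n \<bullet> y u) *\<^sub>R (c u z *\<^sub>R y u)
        + (- (inverse (n \<bullet> y u) * (c u z * (n \<bullet> y u)) * inverse (n \<bullet> y u))) *\<^sub>R y u)) (at u)"
      unfolding g_def
      by (rule has_derivative_scaleR[OF Deriv.has_derivative_inverse[OF nz[OF u] i] y[OF u]])
    moreover have "inverse (n \<bullet> y u) * (c u z * (n \<bullet> y u)) * inverse (n \<bullet> y u) = inverse (n \<bullet> y u) * c u z" for z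
      using nz[OF u] by simp
    ultimately have "(g has_derivative (\<lambda>z. 0)) (at u)" by simp
    then show ?thesis by (rule has_derivative_at_withinI)
  qed
  then obtain k where "g v = k" if "v \<in> B" for v
    using has_derivative_zero_constant[OF assms(1)] by metis
  then have "g u = g p" using assms(2,3) by simp
  then have "(n \<bullet> y u) *\<^sub>R g u = (n \<bullet> y u) *\<^sub>R g p" by simp
  then show ?thesis using nz[OF assms(3)] by (simp add: g_def divide_inverse)
qed

section \<open>Frames of four vectors in the ambient space\<close>

lemma vector_4:
  "(vector [a, b, c, d] :: 'a::zero^4) $ 1 = a" "(vector [a, b, c, d] :: 'a^4) $ 2 = b"
  "(vector [a, b, c, d] :: 'a^4) $ 3 = c" "(vector [a, b, c, d] :: 'a^4) $ 4 = d"
  unfolding vector_def by simp_all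

lemma frame4_mult: "frame4 a b c d *v y = vector [a \<bullet> y, b \<bullet> y, c \<bullet> y, d \<bullet> y]"
  by (simp add: frame4_def vec_eq_iff forall_4 vector_4 matrix_vector_mult_def inner_vec_def)

lemma transpose_frame4_mult: "transpose (frame4 a b c d) *v x = x$1 *\<^sub>R a + x$2 *\<^sub>R b + x$3 *\<^sub>R c + x$4 *\<^sub>R d"
  by (simp add: frame4_def vec_eq_iff vector_4 matrix_vector_mult_def transpose_def sum_4 mult.commute)

lemma det_frame4_nonzero:
  assumes "\<And>x1 x2 x3 x4. x1 *\<^sub>R a + x2 *\<^sub>R b + x3 *\<^sub>R c + x4 *\<^sub>R d = 0 \<Longrightarrow> x1 = 0 \<and> x2 = 0 \<and> x3 = 0 \<and> x4 = 0"
  shows "det (frame4 a b c d) \<noteq> 0"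
proof -
  have "x = 0" if "transpose (frame4 a b c d) *v x = 0" for x
    using assms[OF that[unfolded transpose_frame4_mult]] by (simp add: vec_eq_iff forall_4)
  then have "inj ((*v) (transpose (frame4 a b c d)))"
    by (simp add: linear_injective_0)
  then have "invertible (transpose (frame4 a b c d))"
    using invertible_left_inverse matrix_left_invertible_injective by blast
  then show ?thesis using invertible_det_nz det_transpose by metis
qed

lemma invertible_mult_eq_0:
  fixes A :: "real^'n^'n"
  assumes "det A \<noteq> 0" "A *v x = 0"
  shows "x = 0"
proof -
  have "inj ((*v) A)"
    using assms(1) invertible_det_nz invertible_left_inverse matrix_left_invertible_injective by blast
  then show ?thesis using assms(2) by (simp add: linear_injective_0)
qed

context so11_sphere
begin

lemma q_smooth: "smooth_on U q"
proof -
  have "smooth_on U (\<lambda>u. h u (dd V u (E u) + G u (E u) (V u)) (F u))"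
    by (rule smooth_on_bilinear_field[OF U h_bil smooth(6) smooth_on_add[OF U smooth_on_dd[OF U smooth(3,2)]
        smooth_on_bilinear_field[OF U G_bil smooth(7,2,3)]] smooth(4)])
  from smooth_on_cong[OF U, THEN iffD2, OF _ this] show ?thesis using q_def by metis
qed

lemma q_nz: "u \<in> U \<Longrightarrow> q u \<noteq> 0"
  using H_eq H_nz by force

lemma has_derivative_q: "u \<in> U \<Longrightarrow> (q has_derivative dd q u) (at u)"
  by (rule smooth_on_has_derivative[OF q_smooth U])

definition m where "m u = dd \<phi> u (V u)"

lemma has_derivative_m:
  assumes u: "u \<in> U"
  shows "(m has_derivative
    (\<lambda>z. q u *\<^sub>R dd \<phi> u z - ((q u + 2 * r u) * \<theta> u z) *\<^sub>R m u - (H * \<theta> u z) *\<^sub>R \<phi> u)) (at u)"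
proof -
  have "(m has_derivative (\<lambda>z. dd \<phi> u (N u z) - (H * \<theta> u z) *\<^sub>R \<phi> u)) (at u)"
    using has_derivative_\<phi>_field[OF u has_derivative_frame(2)[OF u]]
    by (simp add: N_def add.commute m_def[abs_def] \<theta>_def h_sym[OF u, of _ "V u"])
  then show ?thesis by (simp add: N_eq[OF u] dd_\<phi>_linear[OF u] m_def)
qed

lemma m_smooth: "smooth_on U m"
  unfolding m_def[abs_def] by (rule smooth_on_dd[OF U smooth(1,3)])

text \<open>The symmetry of the second derivative of \<open>m\<close>; its components along \<open>\<phi>\<close> cancel.\<close>

lemma dq_vec:
  assumes u: "u \<in> U"
  shows "dd q u Y *\<^sub>R X - ((dd q u Y + 2 * dd r u Y) * \<theta> u X) *\<^sub>R V u - (((q u + 2 * r u) * q u + H) * \<theta> u X) *\<^sub>R Y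
    = dd q u X *\<^sub>R Y - ((dd q u X + 2 * dd r u X) * \<theta> u Y) *\<^sub>R V u - (((q u + 2 * r u) * q u + H) * \<theta> u Y) *\<^sub>R X"
proof -
  define b where "b = q u + 2 * r u"
  have *: "dd (\<lambda>w. dd m w X) u z = q u *\<^sub>R (dd \<phi> u (G u z X) - (H * h u z X) *\<^sub>R \<phi> u) + dd q u z *\<^sub>R dd \<phi> u X
     - ((b * \<theta> u X) *\<^sub>R (q u *\<^sub>R dd \<phi> u z - (b * \<theta> u z) *\<^sub>R m u - (H * \<theta> u z) *\<^sub>R \<phi> u)
        + (b * (t u z X + \<theta> u (L u z X)) + (dd q u z + 2 * dd r u z) * \<theta> u X) *\<^sub>R m u)
     - ((H * \<theta> u X) *\<^sub>R dd \<phi> u z + (H * (t u z X + \<theta> u (L u z X))) *\<^sub>R \<phi> u)" for X z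
  proof -
    have "((\<lambda>w. dd \<phi> w X) has_derivative (\<lambda>z. dd \<phi> u (G u z X) - (H * h u z X) *\<^sub>R \<phi> u)) (at u)"
      using has_derivative_\<phi>_field[OF u has_derivative_const[of X]] by simp
    then have "((\<lambda>w. q w *\<^sub>R dd \<phi> w X - ((q w + 2 * r w) * \<theta> w X) *\<^sub>R m w - (H * \<theta> w X) *\<^sub>R \<phi> w) has_derivative
     (\<lambda>z. q u *\<^sub>R (dd \<phi> u (G u z X) - (H * h u z X) *\<^sub>R \<phi> u) + dd q u z *\<^sub>R dd \<phi> u X
     - (((q u + 2 * r u) * \<theta> u X) *\<^sub>R (q u *\<^sub>R dd \<phi> u z - ((q u + 2 * r u) * \<theta> u z) *\<^sub>R m u - (H * \<theta> u z) *\<^sub>R \<phi> u)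
        + ((q u + 2 * r u) * (t u z X + \<theta> u (L u z X)) + (dd q u z + 2 * dd r u z) * \<theta> u X) *\<^sub>R m u)
     - ((H * \<theta> u X) *\<^sub>R dd \<phi> u z + (H * (t u z X + \<theta> u (L u z X))) *\<^sub>R \<phi> u))) (at u)"
      by (intro has_derivative_diff has_derivative_scaleR has_derivative_mult has_derivative_add
          has_derivative_mult_right has_derivative_q[OF u] has_derivative_m[OF u]
          has_derivative_\<theta>[OF u] has_derivative_frame[OF u])
    then have "((\<lambda>w. dd m w X) has_derivative
     (\<lambda>z. q u *\<^sub>R (dd \<phi> u (G u z X) - (H * h u z X) *\<^sub>R \<phi> u) + dd q u z *\<^sub>R dd \<phi> u X
     - (((q u + 2 * r u) * \<theta> u X) *\<^sub>R (q u *\<^sub>R dd \<phi> u z - ((q u + 2 * r u) * \<theta> u z) *\<^sub>R m u - (H * \<theta> u z) *\<^sub>R \<phi> u)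
        + ((q u + 2 * r u) * (t u z X + \<theta> u (L u z X)) + (dd q u z + 2 * dd r u z) * \<theta> u X) *\<^sub>R m u)
     - ((H * \<theta> u X) *\<^sub>R dd \<phi> u z + (H * (t u z X + \<theta> u (L u z X))) *\<^sub>R \<phi> u))) (at u)"
      by (rule has_derivative_transform_within_open[OF _ U u]) (simp add: dd_eq[OF has_derivative_m])
    from fun_cong[OF dd_eq[OF this]] show ?thesis unfolding b_def .
  qed
  have tL: "t u X Y = t u Y X" "L u X Y = L u Y X"
    by (simp_all add: t_val[OF u] h_sym[OF u, of X Y] L_sym[OF u, of X Y])
  \<comment> \<open>Everything symmetric in \<open>X\<close> and \<open>Y\<close> drops out, in
    particular all terms with \<open>G\<close>, \<open>L\<close> and \<open>t\<close>. The right
    side is written as a multiple of \<open>\<phi> u\<close> to fit \<open>indep\<close>.\<close>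
  have "dd \<phi> u (dd q u Y *\<^sub>R X - ((dd q u Y + 2 * dd r u Y) * \<theta> u X) *\<^sub>R V u - ((b * q u + H) * \<theta> u X) *\<^sub>R Y
    - (dd q u X *\<^sub>R Y - ((dd q u X + 2 * dd r u X) * \<theta> u Y) *\<^sub>R V u - ((b * q u + H) * \<theta> u Y) *\<^sub>R X)) = 0 *\<^sub>R \<phi> u"
    using dd_commute[OF U m_smooth u, of X Y]
    unfolding * dd_\<phi>_linear[OF u] m_def[symmetric] tL h_sym[OF u, of X Y] G_sym[OF u, of X Y]
    by (simp add: algebra_simps)
  from indep[OF u this] show ?thesis by (simp add: b_def)
qed

text \<open>In \<open>dq_vec\<close> the pair E, F forces dq to vanish on the leaf, and the pair E,
  V gives dq(V) = -((q + 2r) q + H), which H = q (2r - q) turns into -4rq.\<close>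

lemma dq:
  assumes u: "u \<in> U"
  shows "dd q u X = - 4 * r u * q u * \<theta> u X"
proof -
  have s: "h u (F u) (E u) = 1" "h u (E u) (V u) = 0" "h u (F u) (V u) = 0"
    using frame[OF u] h_sym[OF u] by metis+
  note [simp] = frame[OF u] s \<theta>_frame[OF u]
  have 1: "dd q u (E u) = 0"
    using arg_cong[OF dq_vec[OF u, of "E u" "F u"], of "\<lambda>v. h u v (E u)"] by (simp add: h_linear)
  have 2: "dd q u (F u) = 0"
    using arg_cong[OF dq_vec[OF u, of "E u" "F u"], of "\<lambda>v. h u v (F u)"] by (simp add: h_linear)
  have 3: "dd q u (V u) = - ((q u + 2 * r u) * q u + H)"
    using arg_cong[OF dq_vec[OF u, of "E u" "V u"], of "\<lambda>v. h u v (F u)"] by (simp add: h_linear)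
  have lin: "linear (dd q u)" using has_derivative_q[OF u] has_derivative_linear by blast
  obtain a b c where X: "X = a *\<^sub>R E u + b *\<^sub>R V u + c *\<^sub>R F u"
    using frame_expansion[OF u, of X] by blast
  have "dd q u X = b * - ((q u + 2 * r u) * q u + H)"
    unfolding X linear_add[OF lin] linear_scale[OF lin] by (simp add: 1 2 3)
  moreover have "\<theta> u X = b" unfolding X \<theta>_simps by simp
  ultimately show ?thesis by (simp add: H_eq[OF u] algebra_simps)
qed

definition ww where "ww u = m u - q u *\<^sub>R \<phi> u"

text \<open>Subtracting q \<phi> removes the tangential term q dd \<phi> u z from the derivative of
  \<open>m\<close>; the value of \<open>dq\<close> then makes the coefficient of \<phi> equal to -q
  times that of \<open>m\<close>, up to the sign already in \<open>ww\<close>.\<close>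

lemma has_derivative_ww:
  assumes u: "u \<in> U"
  shows "(ww has_derivative (\<lambda>z. (- (q u + 2 * r u) * \<theta> u z) *\<^sub>R ww u)) (at u)"
proof -
  have "(ww has_derivative (\<lambda>z. (q u *\<^sub>R dd \<phi> u z - ((q u + 2 * r u) * \<theta> u z) *\<^sub>R m u - (H * \<theta> u z) *\<^sub>R \<phi> u)
      - (q u *\<^sub>R dd \<phi> u z + dd q u z *\<^sub>R \<phi> u))) (at u)"
    unfolding ww_def[abs_def]
    by (intro has_derivative_diff has_derivative_scaleR has_derivative_m[OF u] has_derivative_q[OF u] has_derivative_frame[OF u])
  moreover have "(q u *\<^sub>R dd \<phi> u z - ((q u + 2 * r u) * \<theta> u z) *\<^sub>R m u - (H * \<theta> u z) *\<^sub>R \<phi> u)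
      - (q u *\<^sub>R dd \<phi> u z + dd q u z *\<^sub>R \<phi> u) = (- (q u + 2 * r u) * \<theta> u z) *\<^sub>R ww u" for z
  proof -
    have "- (H * \<theta> u z) - dd q u z = (q u + 2 * r u) * \<theta> u z * q u"
      unfolding dq[OF u] H_eq[OF u] by (simp add: algebra_simps)
    then have "(- (H * \<theta> u z) - dd q u z) *\<^sub>R \<phi> u = ((q u + 2 * r u) * \<theta> u z * q u) *\<^sub>R \<phi> u" by simp
    then show ?thesis by (simp add: ww_def algebra_simps)
  qed
  ultimately show ?thesis by simp
qed

lemma frame_indep:
  assumes u: "u \<in> U" and "x1 *\<^sub>R dd \<phi> u (E u) + x2 *\<^sub>R dd \<phi> u (F u) + x3 *\<^sub>R ww u + x4 *\<^sub>R \<phi> u = 0"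
  shows "x1 = 0 \<and> x2 = 0 \<and> x3 = 0 \<and> x4 = 0"
proof -
  define X where "X = x1 *\<^sub>R E u + x2 *\<^sub>R F u + x3 *\<^sub>R V u"
  have "dd \<phi> u X = (x3 * q u - x4) *\<^sub>R \<phi> u"
    using assms(2) by (simp add: X_def dd_\<phi>_linear[OF u] ww_def m_def algebra_simps add_eq_0_iff)
  then have "X = 0" by (rule indep[OF u])
  then have "h u X Y = 0" for Y by (simp add: h_linear)
  from this[of "E u"] this[of "F u"] this[of "V u"] have "x1 = 0 \<and> x2 = 0 \<and> x3 = 0"
    using frame[OF u] h_sym[OF u, of "F u" "E u"] h_sym[OF u, of "E u" "V u"] h_sym[OF u, of "F u" "V u"]
    by (simp add: X_def h_linear)
  then show ?thesis using assms(2) phi_nz[OF u] by simp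
qed

text \<open>The basis vectors are the rows, so \<open>M u *v y\<close> lists the values of the
  covector \<open>y\<close> on a basis of the ambient space.\<close>

definition M where "M u = frame4 (dd \<phi> u (axis 1 1)) (dd \<phi> u (axis 2 1)) (dd \<phi> u (axis 3 1)) (\<phi> u)"

lemma dd_\<phi>_axis:
  assumes u: "u \<in> U"
  shows "dd \<phi> u X = X$1 *\<^sub>R dd \<phi> u (axis 1 1) + X$2 *\<^sub>R dd \<phi> u (axis 2 1) + X$3 *\<^sub>R dd \<phi> u (axis 3 1)"
proof -
  have "X = X$1 *\<^sub>R axis 1 1 + X$2 *\<^sub>R axis 2 1 + X$3 *\<^sub>R axis 3 1"
    by (simp add: vec_eq_iff forall_3 axis_def)
  then show ?thesis using dd_\<phi>_linear[OF u] by metis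
qed

lemma det_M:
  assumes u: "u \<in> U"
  shows "det (M u) \<noteq> 0"
  unfolding M_def
proof (rule det_frame4_nonzero)
  fix x1 x2 x3 x4
  assume *: "x1 *\<^sub>R dd \<phi> u (axis 1 1) + x2 *\<^sub>R dd \<phi> u (axis 2 1) + x3 *\<^sub>R dd \<phi> u (axis 3 1) + x4 *\<^sub>R \<phi> u = 0"
  define X :: "real^3" where "X = vector [x1, x2, x3]"
  have "dd \<phi> u X = (- x4) *\<^sub>R \<phi> u"
    using * unfolding dd_\<phi>_axis[OF u, of X] by (simp add: X_def vector_3 add_eq_0_iff2)
  then have "X = 0" by (rule indep[OF u])
  then have "X$1 = 0" "X$2 = 0" "X$3 = 0" by simp_all
  then have "x1 = 0" "x2 = 0" "x3 = 0" by (simp_all add: X_def vector_3)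
  then show "x1 = 0 \<and> x2 = 0 \<and> x3 = 0 \<and> x4 = 0" using * phi_nz[OF u] by simp
qed

lemma covector_eq_0:
  assumes u: "u \<in> U" and "\<And>X. y \<bullet> dd \<phi> u X = 0" "y \<bullet> \<phi> u = 0"
  shows "y = 0"
proof -
  have "M u *v y = 0"
    unfolding M_def frame4_mult using assms by (simp add: vec_eq_iff forall_4 vector_4 inner_commute)
  then show ?thesis using invertible_mult_eq_0[OF det_M[OF u]] by blast
qed

text \<open>The inverse solves for the covector with prescribed values on that basis; these values
  make it vanish on \<open>ww u\<close>.\<close>

definition ell :: "real^3 \<Rightarrow> real^4" where
  "ell u = matrix_inv (M u) *v vector [q u * \<theta> u (axis 1 1), q u * \<theta> u (axis 2 1), q u * \<theta> u (axis 3 1), 1]"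

lemma M_ell: "u \<in> U \<Longrightarrow> M u *v ell u = vector [q u * \<theta> u (axis 1 1), q u * \<theta> u (axis 2 1), q u * \<theta> u (axis 3 1), 1]"
  using det_M[of u] invertible_det_nz[of "M u"] by (simp add: ell_def matrix_vector_mul_assoc matrix_inv)

lemma ell:
  assumes u: "u \<in> U"
  shows "ell u \<bullet> dd \<phi> u X = q u * \<theta> u X" "ell u \<bullet> \<phi> u = 1"
proof -
  have *: "(M u *v ell u) $ i = vector [q u * \<theta> u (axis 1 1), q u * \<theta> u (axis 2 1), q u * \<theta> u (axis 3 1), 1] $ i" for i
    by (simp add: M_ell[OF u])
  note ** = *[of 1] *[of 2] *[of 3] *[of 4]
  show "ell u \<bullet> \<phi> u = 1" using ** by (simp add: M_def frame4_mult vector_4 inner_commute)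
  have "X = X$1 *\<^sub>R axis 1 1 + X$2 *\<^sub>R axis 2 1 + X$3 *\<^sub>R axis 3 1"
    by (simp add: vec_eq_iff forall_3 axis_def)
  then have "\<theta> u X = X$1 * \<theta> u (axis 1 1) + X$2 * \<theta> u (axis 2 1) + X$3 * \<theta> u (axis 3 1)"
    by (metis \<theta>_simps(1,3))
  then show "ell u \<bullet> dd \<phi> u X = q u * \<theta> u X"
    using ** unfolding dd_\<phi>_axis[OF u, of X]
    by (simp add: M_def frame4_mult vector_4 inner_commute[of "ell u"] inner_add_left algebra_simps)
qed

lemma \<theta>_smooth: "smooth_on U (\<lambda>u. \<theta> u X)"
  unfolding \<theta>_def by (rule smooth_on_bilinear_field[OF U h_bil smooth(6,3) smooth_on_const])

lemma ell_smooth: "smooth_on U ell"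
proof (rule smooth_on_linear_system[OF U _ _ det_M M_ell])
  have "smooth_on U (\<lambda>u. dd \<phi> u X $ j)" for X j
    by (intro smooth_on_vec_nth smooth_on_dd U smooth smooth_on_const)
  then show "smooth_on U (\<lambda>u. M u $ i $ j)" for i j
    using smooth_on_vec_nth[OF U smooth(1)] exhaust_4[of i] by (auto simp: M_def frame4_def vector_4)
  show "smooth_on U (\<lambda>u. (vector [q u * \<theta> u (axis 1 1), q u * \<theta> u (axis 2 1), q u * \<theta> u (axis 3 1), 1] :: real^4) $ i)" for i
    using smooth_on_mult[OF U q_smooth \<theta>_smooth] smooth_on_const exhaust_4[of i] by (auto simp: vector_4)
qed

text \<open>Tested on \<phi> and on tangent vectors. In the tangential test, inserting
  \<open>dq\<close>, \<open>H\<close> and \<theta>(K(z,X)) cancels the terms with h(z,X) and leaves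
  -q squared times \<theta>(z) \<theta>(X).\<close>

lemma has_derivative_ell:
  assumes u: "u \<in> U"
  shows "(ell has_derivative (\<lambda>z. (- q u * \<theta> u z) *\<^sub>R ell u)) (at u)"
proof -
  have der: "(ell has_derivative dd ell u) (at u)"
    by (rule smooth_on_has_derivative[OF ell_smooth U u])
  have "dd ell u z + (q u * \<theta> u z) *\<^sub>R ell u = 0" for z
  proof (rule covector_eq_0[OF u])
    have 1: "((\<lambda>w. ell w \<bullet> \<phi> w) has_derivative (\<lambda>z. ell u \<bullet> dd \<phi> u z + dd ell u z \<bullet> \<phi> u)) (at u)"
      by (rule has_derivative_inner[OF der has_derivative_frame(5)[OF u]])
    have 2: "((\<lambda>w. ell w \<bullet> \<phi> w) has_derivative (\<lambda>z. 0)) (at u)"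
      by (rule has_derivative_transform_within_open[OF has_derivative_const[of 1] U u]) (simp add: ell)
    from fun_cong[OF has_derivative_unique[OF 1 2]] have "ell u \<bullet> dd \<phi> u z + dd ell u z \<bullet> \<phi> u = 0" .
    then show "(dd ell u z + (q u * \<theta> u z) *\<^sub>R ell u) \<bullet> \<phi> u = 0"
      by (simp add: inner_add_left ell[OF u])
  next
    fix X
    have 1: "((\<lambda>w. ell w \<bullet> dd \<phi> w X) has_derivative (\<lambda>z. ell u \<bullet> (dd \<phi> u (G u z X) - (H * h u z X) *\<^sub>R \<phi> u) + dd ell u z \<bullet> dd \<phi> u X)) (at u)"
      using has_derivative_inner[OF der has_derivative_\<phi>_field[OF u has_derivative_const[of X]]] by simp
    have 2: "((\<lambda>w. ell w \<bullet> dd \<phi> w X) has_derivative (\<lambda>z. q u * (t u z X + \<theta> u (L u z X)) + dd q u z * \<theta> u X)) (at u)"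
      by (rule has_derivative_transform_within_open[OF has_derivative_mult[OF has_derivative_q[OF u] has_derivative_\<theta>[OF u]] U u])
        (simp add: ell)
    from fun_cong[OF has_derivative_unique[OF 1 2]] have *: "ell u \<bullet> (dd \<phi> u (G u z X) - (H * h u z X) *\<^sub>R \<phi> u) + dd ell u z \<bullet> dd \<phi> u X
        = q u * (t u z X + \<theta> u (L u z X)) + dd q u z * \<theta> u X" .
    have GL: "G u z X = L u z X + K u z X" by (simp add: L_def)
    have \<theta>K: "\<theta> u (K u z X) = r u * (h u z X - 3 * \<theta> u z * \<theta> u X)"
      by (simp add: K_def \<theta>_simps \<theta>_frame[OF u] algebra_simps)
    show "(dd ell u z + (q u * \<theta> u z) *\<^sub>R ell u) \<bullet> dd \<phi> u X = 0"
      using * unfolding GL inner_diff_right inner_add_left inner_scaleR_left inner_scaleR_right ell[OF u] \<theta>_simps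
        t_val[OF u] dq[OF u] H_eq[OF u] \<theta>K by (simp add: algebra_simps)
  qed
  then have "dd ell u = (\<lambda>z. (- q u * \<theta> u z) *\<^sub>R ell u)" by (simp add: fun_eq_iff add_eq_0_iff2)
  then show ?thesis using der by simp
qed

lemma normal_form:
  assumes p: "p \<in> U"
  obtains e A \<rho> where "e > 0" "ball p e \<subseteq> U" "det (A :: real^4^4) \<noteq> 0"
    "\<And>u. u \<in> ball p e \<Longrightarrow> A *v (m u - q u *\<^sub>R \<phi> u) = axis 3 (\<rho> u)"
    "\<And>u. u \<in> ball p e \<Longrightarrow> \<rho> u \<noteq> 0"
    "\<And>u. u \<in> ball p e \<Longrightarrow> (A *v \<phi> u) $ 4 \<noteq> 0"
    "\<And>u X. u \<in> ball p e \<Longrightarrow> (A *v dd \<phi> u X) $ 4 = q u * \<theta> u X * (A *v \<phi> u) $ 4"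
proof -
  \<comment> \<open>Columns are two leaf directions, the distinguished direction \<open>ww p\<close>
    and the position vector; the inverse of \<open>Q\<close> sends them to the coordinate
    axes.\<close>
  define Q where "Q = transpose (frame4 (dd \<phi> p (E p)) (dd \<phi> p (F p)) (ww p) (\<phi> p))"
  have Q: "Q *v x = x$1 *\<^sub>R dd \<phi> p (E p) + x$2 *\<^sub>R dd \<phi> p (F p) + x$3 *\<^sub>R ww p + x$4 *\<^sub>R \<phi> p" for x
    unfolding Q_def by (rule transpose_frame4_mult)
  have "det Q \<noteq> 0"
    unfolding Q_def det_transpose by (rule det_frame4_nonzero) (rule frame_indep[OF p])
  then have inv: "invertible Q" by (simp add: invertible_det_nz)
  define A where "A = matrix_inv Q"
  have AQ: "A *v (Q *v x) = x" for x
    unfolding A_def by (simp add: matrix_vector_mul_assoc matrix_inv[OF inv])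
  have "A ** Q = mat 1" unfolding A_def by (rule matrix_inv[OF inv])
  then have detA: "det A \<noteq> 0" by (metis det_I det_mul mult_zero_left zero_neq_one)
  have A1: "A *v dd \<phi> p (E p) = axis 1 1" "A *v dd \<phi> p (F p) = axis 2 1" "A *v ww p = axis 3 1" "A *v \<phi> p = axis 4 1"
    using AQ[of "axis 1 1"] AQ[of "axis 2 1"] AQ[of "axis 3 1"] AQ[of "axis 4 1"] by (simp_all add: Q axis_def)
  define a where "a = A $ 4"
  have a: "(A *v y) $ 4 = a \<bullet> y" for y by (simp add: a_def matrix_vector_mult_def inner_vec_def)
  \<comment> \<open>The fourth row of \<open>A\<close> is \<open>ell p\<close>: both are zero on the
    two leaf directions and on \<open>ww p\<close>, and both are 1 on
    \<open>\<phi> p\<close>.\<close>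
  have "a - ell p = 0"
  proof (rule covector_eq_0[OF p])
    show "(a - ell p) \<bullet> \<phi> p = 0" using a[of "\<phi> p"] by (simp add: A1 inner_diff_left ell[OF p] axis_def)
    fix X
    obtain x y z where X: "X = x *\<^sub>R E p + y *\<^sub>R V p + z *\<^sub>R F p" using frame_expansion[OF p, of X] by blast
    have "m p = ww p + q p *\<^sub>R \<phi> p" by (simp add: ww_def)
    then have "a \<bullet> m p = q p" using a[of "ww p"] a[of "\<phi> p"] by (simp add: A1 inner_add_right axis_def)
    then show "(a - ell p) \<bullet> dd \<phi> p X = 0"
      using a[of "dd \<phi> p (E p)"] a[of "dd \<phi> p (F p)"]
      by (simp add: inner_diff_left ell[OF p]) (simp add: X dd_\<phi>_linear[OF p] \<theta>_simps \<theta>_frame[OF p] A1 inner_add_right axis_def flip: m_def)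
  qed
  then have a_ell: "a = ell p" by simp
  have "ww p \<noteq> 0" using frame_indep[OF p, of 0 0 1 0] by auto
  have "ell p \<noteq> 0" using ell(2)[OF p] by auto
  have c1: "isCont (\<lambda>u. ww p \<bullet> ww u) p" "isCont (\<lambda>u. ell p \<bullet> ell u) p"
    using has_derivative_continuous[OF has_derivative_ww[OF p]] has_derivative_continuous[OF has_derivative_ell[OF p]]
    by (auto intro!: continuous_intros)
  have "ww p \<bullet> ww p \<noteq> 0" "ell p \<bullet> ell p \<noteq> 0" using \<open>ww p \<noteq> 0\<close> \<open>ell p \<noteq> 0\<close> by auto
  \<comment> \<open>The functionals for \<open>constant_direction\<close> are the values at
    \<open>p\<close> themselves, which by continuity pair to something nonzero near
    \<open>p\<close>.\<close>
  from continuous_at_avoid[OF c1(1) this(1)] continuous_at_avoid[OF c1(2) this(2)]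
  obtain e1 e2 where e: "e1 > 0" "e2 > 0" and nz1: "\<And>u. dist p u < e1 \<Longrightarrow> ww p \<bullet> ww u \<noteq> 0"
     and nz2: "\<And>u. dist p u < e2 \<Longrightarrow> ell p \<bullet> ell u \<noteq> 0"
    by blast
  obtain e3 where e3: "e3 > 0" "ball p e3 \<subseteq> U" using U p open_contains_ball by blast
  define e where "e = min e1 (min e2 e3)"
  have e: "e > 0" "ball p e \<subseteq> U" using e e3 by (auto simp: e_def)
  have nz: "ww p \<bullet> ww u \<noteq> 0" "ell p \<bullet> ell u \<noteq> 0" if "u \<in> ball p e" for u
    using that nz1 nz2 by (auto simp: e_def)
  define \<rho> where "\<rho> u = (ww p \<bullet> ww u) / (ww p \<bullet> ww p)" for u
  define s where "s u = (ell p \<bullet> ell u) / (ell p \<bullet> ell p)" for u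
  have ww: "ww u = \<rho> u *\<^sub>R ww p" if u: "u \<in> ball p e" for u
    unfolding \<rho>_def
    by (rule constant_direction[OF convex_ball _ u, where c = "\<lambda>u z. - (q u + 2 * r u) * \<theta> u z"])
      (use e nz has_derivative_ww in auto)
  have el: "ell u = s u *\<^sub>R ell p" if u: "u \<in> ball p e" for u
    unfolding s_def
    by (rule constant_direction[OF convex_ball _ u, where c = "\<lambda>u z. - q u * \<theta> u z"])
      (use e nz has_derivative_ell in auto)
  have s: "s u \<noteq> 0" "\<rho> u \<noteq> 0" if "u \<in> ball p e" for u
    using nz[OF that] \<open>ell p \<noteq> 0\<close> \<open>ww p \<noteq> 0\<close> by (auto simp: s_def \<rho>_def)
  \<comment> \<open>\<open>ell u\<close> is 1 on \<open>\<phi> u\<close> and equals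
    \<open>s u\<close> times the fourth row of \<open>A\<close>.\<close>
  have 4: "(A *v \<phi> u) $ 4 = inverse (s u)" if u: "u \<in> ball p e" for u
    using ell(2)[of u] e u s[OF u] unfolding a a_ell el[OF u] by (auto simp: field_simps)
  show ?thesis
  proof (rule that[OF e detA])
    fix u assume u: "u \<in> ball p e"
    have "A *v ww u = \<rho> u *\<^sub>R axis 3 1"
      by (simp add: ww[OF u] A1 matrix_vector_mult_scaleR)
    then show "A *v (m u - q u *\<^sub>R \<phi> u) = axis 3 (\<rho> u)"
      by (simp add: ww_def vec_eq_iff axis_def)
    show "\<rho> u \<noteq> 0" "(A *v \<phi> u) $ 4 \<noteq> 0" using s[OF u] 4[OF u] by auto
    fix X
    have "u \<in> U" using e u by auto
    have "s u * (ell p \<bullet> dd \<phi> u X) = q u * \<theta> u X" using ell(1)[OF \<open>u \<in> U\<close>, of X] by (simp add: el[OF u])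
    then show "(A *v dd \<phi> u X) $ 4 = q u * \<theta> u X * (A *v \<phi> u) $ 4"
      using s[OF u] unfolding 4[OF u] unfolding a a_ell by (simp add: field_simps)
  qed
qed

end

section \<open>Functions that are quadratic along the leaves\<close>

lemma dd_linear: "(f has_derivative f') (at u) \<Longrightarrow> linear (dd f u)"
  using dd_eq has_derivative_linear by metis

lemma vec3_axis: "(z :: real^3) = z$1 *\<^sub>R axis 1 1 + z$2 *\<^sub>R axis 2 1 + z$3 *\<^sub>R axis 3 1"
  by (simp add: vec_eq_iff forall_3 axis_def)

lemma dd_axis3:
  fixes f :: "real^3 \<Rightarrow> 'b::real_normed_vector"
  assumes "(f has_derivative f') (at u)"
  shows "dd f u z = z$1 *\<^sub>R dd f u (axis 1 1) + z$2 *\<^sub>R dd f u (axis 2 1) + z$3 *\<^sub>R dd f u (axis 3 1)"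
  by (subst vec3_axis[of z]) (simp only: linear_add[OF dd_linear[OF assms]] linear_scale[OF dd_linear[OF assms]])

lemma constant_if_dd_axis_0:
  fixes f :: "real^3 \<Rightarrow> real"
  assumes "convex D" "open D" "smooth_on D f" "\<And>w i. w \<in> D \<Longrightarrow> dd f w (axis i 1) = 0" "v \<in> D" "w \<in> D"
  shows "f v = f w"
proof -
  have "(f has_derivative (\<lambda>z. 0)) (at w within D)" if "w \<in> D" for w
  proof -
    have "dd f w z = 0" for z
      using dd_axis3[OF smooth_on_has_derivative[OF assms(3,2) that], of z] assms(4)[OF that] by simp
    then have "dd f w = (\<lambda>z. 0)" by (simp add: fun_eq_iff)
    then show ?thesis
      using smooth_on_has_derivative[OF assms(3,2) that] has_derivative_at_withinI by metis
  qed
  from has_derivative_zero_constant[OF assms(1) this] show ?thesis using assms(5,6) by metis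
qed

lemma dd_quotient_fst:
  fixes f :: "real^3 \<Rightarrow> real"
  assumes "open D" "smooth_on D f" "w \<in> D" "w$1 \<noteq> 0"
  shows "dd (\<lambda>w. f w / w$1) w z = dd f w z / w$1 - f w * z$1 / (w$1 * w$1)"
proof -
  have "((\<lambda>w. w$1) has_derivative (\<lambda>z. z$1)) (at w)"
    by (rule bounded_linear_imp_has_derivative[OF bounded_linear_vec_nth])
  from has_derivative_divide'[OF smooth_on_has_derivative[OF assms(2,1,3)] this assms(4)]
  have "((\<lambda>w. f w / w$1) has_derivative (\<lambda>z. (dd f w z * w$1 - f w * z$1) / (w$1 * w$1))) (at w)" .
  from fun_cong[OF dd_eq[OF this]] show ?thesis using assms(4) by (simp add: field_simps)
qed

lemma smooth_on_nth: "open D \<Longrightarrow> smooth_on D (\<lambda>w::real^'n. w$i)"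
  by (rule smooth_on_linear[OF _ bounded_linear_vec_nth])

lemma smooth_on_quotient_fst:
  fixes f :: "real^3 \<Rightarrow> real"
  assumes "open D" "smooth_on D f" "\<And>w. w \<in> D \<Longrightarrow> w$1 \<noteq> 0"
  shows "smooth_on D (\<lambda>w. f w / w$1)"
  by (rule smooth_on_divide[OF assms(1,2) smooth_on_nth[OF assms(1)] assms(3)])

text \<open>By \<open>mixed\<close> the leaf gradient over \<open>w$1\<close> is independent of
  \<open>w$1\<close>; by \<open>third\<close> the leaf Hessian is constant on each leaf. So Hessian
  over \<open>w$1\<close> is one constant matrix, the gradient integrates with constants
  \<open>k\<close> and \<open>l\<close>, and the remainder of \<open>g\<close> depends on
  \<open>w$1\<close> alone.\<close>

lemma quadratic_in_leaf_coordinates: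
  fixes g :: "real^3 \<Rightarrow> real" and y :: "real^3"
  assumes "d > 0" and D: "D = {w. \<forall>i. \<bar>w$i - y$i\<bar> < d}"
    and "open D" "convex D" and g: "smooth_on D g" and nz: "\<And>w. w \<in> D \<Longrightarrow> w$1 \<noteq> 0"
    and mixed: "\<And>w a. w \<in> D \<Longrightarrow> a$1 = 0 \<Longrightarrow> dd (\<lambda>v. dd g v a) w (axis 1 1) = dd g w a / w$1"
    and third: "\<And>w a b c. w \<in> D \<Longrightarrow> a$1 = 0 \<Longrightarrow> b$1 = 0 \<Longrightarrow> c$1 = 0 \<Longrightarrow>
       dd (\<lambda>v. dd (\<lambda>v. dd g v a) v b) w c = 0"
  defines "c \<equiv> \<lambda>a b. dd (\<lambda>v. dd g v a) y b / y$1"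
  shows "\<exists>k l \<gamma>. smooth_on {y$1 - d<..<y$1 + d} \<gamma> \<and>
    (\<forall>w\<in>D. g w = w$1 * ((c (axis 2 1) (axis 2 1) * (w$2)\<^sup>2 + 2 * c (axis 2 1) (axis 3 1) * w$2 * w$3
       + c (axis 3 1) (axis 3 1) * (w$3)\<^sup>2) / 2 + k * w$2 + l * w$3) + \<gamma> (w$1))"
proof -
  have yD: "y \<in> D" using \<open>d > 0\<close> by (simp add: D)
  have smooth1: "smooth_on D (\<lambda>v. dd g v a)" for a
    by (rule smooth_on_dd[OF \<open>open D\<close> g smooth_on_const])
  have smooth2: "smooth_on D (\<lambda>v. dd (\<lambda>v. dd g v a) v b)" for a b
    by (rule smooth_on_dd[OF \<open>open D\<close> smooth1 smooth_on_const])
  have ax: "(axis 2 1 :: real^3) $ 1 = 0" "(axis 3 1 :: real^3) $ 1 = 0"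
    by (simp_all add: axis_def)
  have hess: "dd (\<lambda>v. dd g v a) w b = c a b * w$1" if w: "w \<in> D" and ab: "a$1 = 0" "b$1 = 0" for a b w
  proof -
    \<comment> \<open>Only the quotient by the first coordinate is constant: its derivative in that
      coordinate vanishes by commuting derivatives and \<open>mixed\<close>, the other two by
      \<open>third\<close>.\<close>
    have "dd (\<lambda>v. dd (\<lambda>v. dd g v a) v b / v$1) w (axis i 1) = 0" if w: "w \<in> D" for w i
    proof (cases "i = 1")
      case True
      have "dd (\<lambda>v. dd (\<lambda>v. dd g v a) v b) w (axis 1 1) = dd (\<lambda>v. dd (\<lambda>v. dd g v a) v (axis 1 1)) w b"
        by (rule dd_commute[OF \<open>open D\<close> smooth1 w])
      also have "\<dots> = dd (\<lambda>v. dd g v a / v$1) w b"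
        by (subst dd_cong[OF \<open>open D\<close> w, of _ "\<lambda>v. dd g v a / v$1"]) (simp_all add: mixed ab)
      also have "\<dots> = dd (\<lambda>v. dd g v a) w b / w$1"
        by (simp add: dd_quotient_fst[OF \<open>open D\<close> smooth1 w nz[OF w]] ab)
      finally show ?thesis
        using nz[OF w] by (simp add: True dd_quotient_fst[OF \<open>open D\<close> smooth2 w nz[OF w]] field_simps)
    next
      case False
      then have "axis i 1 $ 1 = (0::real)" by (simp add: axis_def)
      then show ?thesis
        by (simp add: dd_quotient_fst[OF \<open>open D\<close> smooth2 w nz[OF w]] third[OF w ab])
    qed
    from constant_if_dd_axis_0[OF \<open>convex D\<close> \<open>open D\<close> smooth_on_quotient_fst[OF \<open>open D\<close> smooth2 nz] this w yD]
    show ?thesis using nz[OF w] by (simp add: c_def field_simps)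
  qed
  have c_sym: "c (axis 3 1) (axis 2 1) = c (axis 2 1) (axis 3 1)"
    unfolding c_def by (subst dd_commute[OF \<open>open D\<close> g yD]) simp
  have first: "\<exists>k. \<forall>w\<in>D. dd g w a = w$1 * (c a (axis 2 1) * w$2 + c a (axis 3 1) * w$3 + k)" if a: "a$1 = 0" for a
  proof -
    \<comment> \<open>The normalised gradient minus its linear part; its constant value is the
      \<open>k\<close> or \<open>l\<close> of the quadratic polynomial.\<close>
    define P where "P w = dd g w a / w$1 - (c a (axis 2 1) * w$2 + c a (axis 3 1) * w$3)" for w
    have P: "smooth_on D P" unfolding P_def
      by (intro smooth_on_diff[OF \<open>open D\<close>] smooth_on_add[OF \<open>open D\<close>] smooth_on_mult[OF \<open>open D\<close>]
          smooth_on_const smooth_on_nth[OF \<open>open D\<close>] smooth_on_quotient_fst[OF \<open>open D\<close> smooth1 nz])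
    have dP: "dd P w (axis i 1) = 0" if w: "w \<in> D" for w i
    proof -
      have n: "((\<lambda>w. w$j) has_derivative (\<lambda>z. z$j)) (at w)" for j
        by (rule bounded_linear_imp_has_derivative[OF bounded_linear_vec_nth])
      have "(P has_derivative (\<lambda>z. dd (\<lambda>w. dd g w a / w$1) w z - (c a (axis 2 1) * z$2 + c a (axis 3 1) * z$3))) (at w)"
        unfolding P_def
        by (intro has_derivative_diff has_derivative_add has_derivative_mult_right n
            smooth_on_has_derivative[OF smooth_on_quotient_fst[OF \<open>open D\<close> smooth1 nz] \<open>open D\<close> w])
      from fun_cong[OF dd_eq[OF this]] have *: "dd P w z = dd (\<lambda>v. dd g v a) w z / w$1 - dd g w a * z$1 / (w$1 * w$1)
          - (c a (axis 2 1) * z$2 + c a (axis 3 1) * z$3)" for z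
        by (simp add: dd_quotient_fst[OF \<open>open D\<close> smooth1 w nz[OF w]])
      show ?thesis
        using exhaust_3[of i] nz[OF w] mixed[OF w a] hess[OF w a ax(1)] hess[OF w a ax(2)]
        by (auto simp: * axis_def)
    qed
    have const: "P w = P y" if "w \<in> D" for w
      by (rule constant_if_dd_axis_0[OF \<open>convex D\<close> \<open>open D\<close> P dP that yD])
    have "dd g w a = w$1 * (c a (axis 2 1) * w$2 + c a (axis 3 1) * w$3 + P y)" if w: "w \<in> D" for w
      using const[OF w] nz[OF w] by (simp add: P_def[of w] field_simps)
    then show ?thesis by blast
  qed
  obtain k where k: "\<And>w. w \<in> D \<Longrightarrow> dd g w (axis 2 1) = w$1 * (c (axis 2 1) (axis 2 1) * w$2 + c (axis 2 1) (axis 3 1) * w$3 + k)"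
    using first[OF ax(1)] by blast
  obtain l where l: "\<And>w. w \<in> D \<Longrightarrow> dd g w (axis 3 1) = w$1 * (c (axis 2 1) (axis 3 1) * w$2 + c (axis 3 1) (axis 3 1) * w$3 + l)"
    using first[OF ax(2)] unfolding c_sym by blast
  define f :: "real \<Rightarrow> real \<Rightarrow> real" where "f s t = (c (axis 2 1) (axis 2 1) * s\<^sup>2 + 2 * c (axis 2 1) (axis 3 1) * s * t
       + c (axis 3 1) (axis 3 1) * t\<^sup>2) / 2 + k * s + l * t" for s t
  define R where "R w = g w - w$1 * f (w$2) (w$3)" for w
  \<comment> \<open>The line through the centre of the cube across the leaves; restricting the
    remainder \<open>R\<close> to it supplies \<open>\<gamma>\<close>.\<close>
  define j :: "real \<Rightarrow> real^3" where "j s = vector [s, y$2, y$3]" for s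
  define I where "I = {y$1 - d<..<y$1 + d}"
  have jD: "j ` I \<subseteq> D" using \<open>d > 0\<close> by (auto simp: j_def I_def D forall_3)
  have j_smooth: "smooth_on I j"
  proof (rule smooth_on_vecI)
    fix i :: 3
    have "smooth_on I (\<lambda>s::real. s)"
      by (rule smooth_on_linear) (auto simp: I_def intro: bounded_linear_ident)
    then show "smooth_on I (\<lambda>s. j s $ i)"
      using exhaust_3[of i] smooth_on_const by (auto simp: j_def)
  qed (simp add: I_def)
  have "smooth_on D (\<lambda>w. w$1 * f (w$2) (w$3))"
    unfolding f_def power2_eq_square
    by (intro smooth_on_divide[OF \<open>open D\<close>] smooth_on_add[OF \<open>open D\<close>] smooth_on_mult[OF \<open>open D\<close>]
          smooth_on_const smooth_on_nth[OF \<open>open D\<close>]) simp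
  then have R: "smooth_on D R" unfolding R_def by (rule smooth_on_diff[OF \<open>open D\<close> g])
  have "smooth_on I (\<lambda>s. R (j s))"
    by (rule smooth_on_compose[OF _ \<open>open D\<close> jD R j_smooth]) (simp add: I_def)
  moreover have "R w = R (j (w$1))" if w: "w \<in> D" for w
  proof -
    \<comment> \<open>Leads from \<open>w\<close> to that line within its leaf. The segment stays in
      the convex set \<open>D\<close>, and \<open>R\<close> is constant along it.\<close>
    define z where "z = j (w$1) - w"
    have z1: "z$1 = 0" by (simp add: z_def j_def)
    have dR: "dd R v z = 0" if v: "v \<in> D" for v
    proof -
      have n: "((\<lambda>w. w$j) has_derivative (\<lambda>z. z$j)) (at v)" for j
        by (rule bounded_linear_imp_has_derivative[OF bounded_linear_vec_nth])
      \<comment> \<open>The forms \<open>of_nat 2\<close> and \<open>2-1\<close> are those produced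
        by \<open>has_derivative_power\<close>.\<close>
      have "(R has_derivative (\<lambda>z. dd g v z - (v$1 * (((c (axis 2 1) (axis 2 1) * (of_nat 2 * z$2 * (v$2)^(2-1))
         + (2 * c (axis 2 1) (axis 3 1) * v$2 * z$3 + 2 * c (axis 2 1) (axis 3 1) * z$2 * v$3)
         + c (axis 3 1) (axis 3 1) * (of_nat 2 * z$3 * (v$3)^(2-1))) / 2 + k * z$2 + l * z$3)) + z$1 * f (v$2) (v$3)))) (at v)"
        unfolding R_def f_def
        by (intro has_derivative_diff has_derivative_add has_derivative_mult has_derivative_mult_right has_derivative_power
            bounded_linear.has_derivative[OF bounded_linear_divide] n smooth_on_has_derivative[OF g \<open>open D\<close> v])
      note * = fun_cong[OF dd_eq[OF this], of z]
      have gz: "dd g v z = z$2 * dd g v (axis 2 1) + z$3 * dd g v (axis 3 1)"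
        using dd_axis3[OF smooth_on_has_derivative[OF g \<open>open D\<close> v], of z] z1 by simp
      show ?thesis
        unfolding * gz k[OF v] l[OF v] by (simp add: z1 field_simps)
    qed
    have seg: "w + s *\<^sub>R z \<in> D" if "0 \<le> s" "s \<le> 1" for s
    proof -
      have "\<bar>w$1 - y$1\<bar> < d" using w by (simp add: D)
      then have "w$1 \<in> I" by (simp add: I_def abs_less_iff)
      then have "j (w$1) \<in> D" using jD by blast
      then have "(1 - s) *\<^sub>R w + s *\<^sub>R j (w$1) \<in> D" using \<open>convex D\<close> w that by (simp add: convex_def)
      then show ?thesis by (simp add: z_def algebra_simps)
    qed
    have "((\<lambda>s. R (w + s *\<^sub>R z)) has_real_derivative dd R (w + s *\<^sub>R z) z) (at s)" if "0 \<le> s" "s \<le> 1" for s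
      by (rule has_real_derivative_along_line[OF smooth_on_has_derivative[OF R \<open>open D\<close> seg[OF that]]])
    from MVT2[OF zero_less_one this] obtain s where "0 < s" "s < 1"
      and "R (w + 1 *\<^sub>R z) - R (w + 0 *\<^sub>R z) = (1 - 0) * dd R (w + s *\<^sub>R z) z"
      by blast
    then show ?thesis using dR[OF seg[of s]] by (simp add: z_def)
  qed
  ultimately show ?thesis
    unfolding I_def R_def f_def by (intro exI[of _ k] exI[of _ l] exI[of _ "\<lambda>s. R (j s)"]) (force simp: R_def f_def)
qed

section \<open>The adapted chart\<close>

locale so11_normal = so11_sphere +
  fixes B :: "(real^3) set" and A :: "real^4^4" and \<rho> :: "real^3 \<Rightarrow> real"
  assumes B: "open B" "B \<subseteq> U" and det_A: "det A \<noteq> 0"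
    and A_ww: "\<And>u. u \<in> B \<Longrightarrow> A *v ww u = axis 3 (\<rho> u)" and \<rho>_nz: "\<And>u. u \<in> B \<Longrightarrow> \<rho> u \<noteq> 0"
    and A_\<phi>4: "\<And>u. u \<in> B \<Longrightarrow> (A *v \<phi> u) $ 4 \<noteq> 0"
    and A_d\<phi>4: "\<And>u X. u \<in> B \<Longrightarrow> (A *v dd \<phi> u X) $ 4 = q u * \<theta> u X * (A *v \<phi> u) $ 4"
begin

lemma BU: "u \<in> B \<Longrightarrow> u \<in> U"
  using B(2) by blast

definition \<Phi> where "\<Phi> u = A *v \<phi> u"

lemma has_derivative_\<Phi>: "u \<in> B \<Longrightarrow> (\<Phi> has_derivative (\<lambda>z. A *v dd \<phi> u z)) (at u)"
  unfolding \<Phi>_def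
  by (rule bounded_linear.has_derivative[OF matrix_vector_mul_bounded_linear has_derivative_frame(5)[OF BU]])

text \<open>The third axis is the direction of \<open>ww u\<close>, which is the image of V minus q
  \<phi>. Independence of tangent vectors and \<phi> lets the two parts be compared separately, and
  both carry the same factor.\<close>

lemma decompose:
  assumes u: "u \<in> B" and "A *v dd \<phi> u X - k *\<^sub>R \<Phi> u = axis 3 c"
  shows "X = (c / \<rho> u) *\<^sub>R V u" "k = c / \<rho> u * q u"
proof -
  define s where "s = c / \<rho> u"
  have "axis 3 c = s *\<^sub>R axis 3 (\<rho> u)"
    using \<rho>_nz[OF u] by (simp add: s_def vec_eq_iff axis_def)
  then have "A *v (dd \<phi> u X - k *\<^sub>R \<phi> u - s *\<^sub>R ww u) = 0"
    using assms(2) by (simp add: \<Phi>_def matrix_vector_mult_diff_distrib matrix_vector_mult_scaleR A_ww[OF u])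
  then have 0: "dd \<phi> u X - k *\<^sub>R \<phi> u - s *\<^sub>R ww u = 0"
    by (rule invertible_mult_eq_0[OF det_A])
  then have 1: "dd \<phi> u (X - s *\<^sub>R V u) = (k - s * q u) *\<^sub>R \<phi> u"
    by (simp add: dd_\<phi>_linear[OF BU[OF u]] ww_def m_def algebra_simps)
  then have 2: "X - s *\<^sub>R V u = 0" by (rule indep[OF BU[OF u]])
  then show "X = (c / \<rho> u) *\<^sub>R V u" by (simp add: s_def)
  show "k = c / \<rho> u * q u"
    using 1[unfolded 2 dd_\<phi>_linear(4)[OF BU[OF u]]] phi_nz[OF BU[OF u]] by (simp add: s_def)
qed

text \<open>\<open>\<rho>\<close> is the third coordinate of \<open>A *v ww u\<close> and inherits
  the growth rate of \<open>ww\<close>.\<close>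

lemma has_derivative_\<rho>:
  assumes u: "u \<in> B"
  shows "(\<rho> has_derivative (\<lambda>z. - (q u + 2 * r u) * \<theta> u z * \<rho> u)) (at u)"
proof -
  have *: "((\<lambda>u. (A *v ww u) $ 3) has_derivative (\<lambda>z. (A *v ((- (q u + 2 * r u) * \<theta> u z) *\<^sub>R ww u)) $ 3)) (at u)"
    by (rule bounded_linear.has_derivative[OF bounded_linear_vec_nth
          bounded_linear.has_derivative[OF matrix_vector_mul_bounded_linear has_derivative_ww[OF BU[OF u]]]])
  have "(\<rho> has_derivative (\<lambda>z. (A *v ((- (q u + 2 * r u) * \<theta> u z) *\<^sub>R ww u)) $ 3)) (at u)"
    by (rule has_derivative_transform_within_open[OF * B(1) u]) (simp add: A_ww axis_def)
  then show ?thesis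
    by (simp only: matrix_vector_mult_scaleR A_ww[OF u] vector_scaleR_component axis_def vec_lambda_beta) simp
qed

definition \<sigma> :: "real^3 \<Rightarrow> real^3" where
  "\<sigma> u = vector [\<Phi> u $ 4, \<Phi> u $ 1 / \<Phi> u $ 4, \<Phi> u $ 2 / \<Phi> u $ 4]"

lemma \<Phi>_smooth: "smooth_on B (\<lambda>u. \<Phi> u $ i)"
  unfolding \<Phi>_def
  by (intro smooth_on_vec_nth[OF B(1)] smooth_on_bounded_linear[OF matrix_vector_mul_bounded_linear B(1)]
      smooth_on_subset[OF smooth(1) U B])

lemma \<Phi>4_nz: "u \<in> B \<Longrightarrow> \<Phi> u $ 4 \<noteq> 0"
  using A_\<phi>4 by (simp add: \<Phi>_def)

lemma \<sigma>_smooth: "smooth_on B \<sigma>"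
proof (rule smooth_on_vecI[OF B(1)])
  fix i :: 3
  show "smooth_on B (\<lambda>u. \<sigma> u $ i)"
    using exhaust_3[of i] \<Phi>_smooth smooth_on_divide[OF B(1) \<Phi>_smooth \<Phi>_smooth \<Phi>4_nz]
    by (auto simp: \<sigma>_def)
qed

text \<open>A kernel vector alters none of the coordinates 1, 2, 4 of \<Phi>, so its image lies on
  the third axis. \<open>decompose\<close> with k = 0 makes it a multiple of V whose factor vanishes
  because q is not 0.\<close>

lemma \<sigma>_immersion:
  assumes u: "u \<in> B" and "dd \<sigma> u X = 0"
  shows "X = 0"
proof -
  define d where "d = A *v dd \<phi> u X"
  have d\<Phi>: "((\<lambda>u. \<Phi> u $ i) has_derivative (\<lambda>z. (A *v dd \<phi> u z) $ i)) (at u)" for i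
    by (rule bounded_linear.has_derivative[OF bounded_linear_vec_nth has_derivative_\<Phi>[OF u]])
  have comp: "dd (\<lambda>u. \<sigma> u $ i) u X = 0" for i
    using dd_linear_image[OF bounded_linear_vec_nth smooth_on_has_derivative[OF \<sigma>_smooth B(1) u], of i X] assms(2)
    by simp
  have d4: "d $ 4 = 0"
    using comp[of 1] fun_cong[OF dd_eq[OF d\<Phi>[of 4]], of X] by (simp add: \<sigma>_def d_def)
  have "dd (\<lambda>u. \<Phi> u $ i / \<Phi> u $ 4) u X = d $ i / \<Phi> u $ 4" for i
    using fun_cong[OF dd_eq[OF has_derivative_divide'[OF d\<Phi>[of i] d\<Phi>[of 4] \<Phi>4_nz[OF u]]], of X] d4 \<Phi>4_nz[OF u]
    by (simp add: d_def)
  then have "d $ 1 = 0" "d $ 2 = 0"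
    using comp[of 2] comp[of 3] \<Phi>4_nz[OF u] by (simp_all add: \<sigma>_def)
  then have "A *v dd \<phi> u X - 0 *\<^sub>R \<Phi> u = axis 3 (d $ 3)"
    using d4 by (simp add: d_def vec_eq_iff forall_4 axis_def)
  note * = decompose[OF u this]
  have "d $ 3 / \<rho> u = 0" using *(2) q_nz[OF BU[OF u]] by simp
  then show ?thesis using *(1) by simp
qed

end

locale so11_chart = so11_normal +
  fixes D :: "(real^3) set" and \<tau> :: "real^3 \<Rightarrow> real^3"
  assumes D: "open D" and \<tau>_smooth: "smooth_on D \<tau>" and \<tau>B: "\<And>y. y \<in> D \<Longrightarrow> \<tau> y \<in> B"
    and \<sigma>\<tau>: "\<And>y. y \<in> D \<Longrightarrow> \<sigma> (\<tau> y) = y"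
begin

lemma \<tau>U: "y \<in> D \<Longrightarrow> \<tau> y \<in> U"
  using \<tau>B BU by blast

lemma has_derivative_\<tau>: "y \<in> D \<Longrightarrow> (\<tau> has_derivative dd \<tau> y) (at y)"
  by (rule smooth_on_has_derivative[OF \<tau>_smooth D])

definition g where "g y = \<Phi> (\<tau> y) $ 3"

lemma \<Phi>\<tau>:
  assumes "y \<in> D"
  shows "y$1 \<noteq> 0" "\<Phi> (\<tau> y) $ 1 = y$1 * y$2" "\<Phi> (\<tau> y) $ 2 = y$1 * y$3" "\<Phi> (\<tau> y) $ 4 = y$1"
proof -
  have "\<sigma> (\<tau> y) $ i = y $ i" for i by (simp add: \<sigma>\<tau>[OF assms])
  from this[of 1] this[of 2] this[of 3]
  show "y$1 \<noteq> 0" "\<Phi> (\<tau> y) $ 1 = y$1 * y$2" "\<Phi> (\<tau> y) $ 2 = y$1 * y$3" "\<Phi> (\<tau> y) $ 4 = y$1"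
    using \<Phi>4_nz[OF \<tau>B[OF assms]] by (auto simp: \<sigma>_def field_simps)
qed

lemma g_smooth: "smooth_on D g"
  unfolding g_def using \<tau>B by (intro smooth_on_compose[OF D B(1) _ \<Phi>_smooth \<tau>_smooth]) auto

lemma has_derivative_nth: "((\<lambda>w. w$i) has_derivative (\<lambda>z. z$i)) (at (y :: real^3))"
  by (rule bounded_linear_imp_has_derivative[OF bounded_linear_vec_nth])

lemma first_derivative:
  assumes y: "y \<in> D"
  shows "A *v dd \<phi> (\<tau> y) (dd \<tau> y a) = vector [y$1 * a$2 + a$1 * y$2, y$1 * a$3 + a$1 * y$3, dd g y a, a$1]"
proof -
  have *: "((\<lambda>w. \<Phi> (\<tau> w) $ i) has_derivative (\<lambda>z. (A *v dd \<phi> (\<tau> y) (dd \<tau> y z)) $ i)) (at y)" for i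
    using diff_chain_at[OF has_derivative_\<tau>[OF y] has_derivative_\<Phi>[OF \<tau>B[OF y]]]
    by (intro bounded_linear.has_derivative[OF bounded_linear_vec_nth]) (simp add: o_def)
  have tr: "(A *v dd \<phi> (\<tau> y) (dd \<tau> y a)) $ i = f' a"
    if f: "(f has_derivative f') (at y)" and eq: "\<And>w. w \<in> D \<Longrightarrow> \<Phi> (\<tau> w) $ i = f w" for i f f'
    using fun_cong[OF has_derivative_unique[OF has_derivative_transform_within_open[OF *[of i] D y eq] f], of a] by simp
  show ?thesis
    unfolding vec_eq_iff forall_4 vector_4
  proof (intro conjI)
    show "(A *v dd \<phi> (\<tau> y) (dd \<tau> y a)) $ 1 = y$1 * a$2 + a$1 * y$2"
      by (rule tr[OF has_derivative_mult[OF has_derivative_nth has_derivative_nth]]) (simp add: \<Phi>\<tau>)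
    show "(A *v dd \<phi> (\<tau> y) (dd \<tau> y a)) $ 2 = y$1 * a$3 + a$1 * y$3"
      by (rule tr[OF has_derivative_mult[OF has_derivative_nth has_derivative_nth]]) (simp add: \<Phi>\<tau>)
    show "(A *v dd \<phi> (\<tau> y) (dd \<tau> y a)) $ 3 = dd g y a"
      by (rule tr[OF smooth_on_has_derivative[OF g_smooth D y]]) (simp add: g_def)
    show "(A *v dd \<phi> (\<tau> y) (dd \<tau> y a)) $ 4 = a$1"
      by (rule tr[OF has_derivative_nth]) (simp add: \<Phi>\<tau>)
  qed
qed

text \<open>The induced covariant derivative of the coordinate field \<open>dd \<tau> w a\<close> in
  the coordinate direction \<open>b\<close>.\<close>

definition Z where "Z y a b = G (\<tau> y) (dd \<tau> y b) (dd \<tau> y a) + dd (\<lambda>w. dd \<tau> w a) y b"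

lemma has_derivative_dd\<tau>: "y \<in> D \<Longrightarrow> ((\<lambda>w. dd \<tau> w a) has_derivative dd (\<lambda>w. dd \<tau> w a) y) (at y)"
  by (rule smooth_on_has_derivative[OF smooth_on_dd[OF D \<tau>_smooth smooth_on_const] D])

lemma has_derivative_ddg: "y \<in> D \<Longrightarrow> ((\<lambda>w. dd g w a) has_derivative dd (\<lambda>w. dd g w a) y) (at y)"
  by (rule smooth_on_has_derivative[OF smooth_on_dd[OF D g_smooth smooth_on_const] D])

text \<open>The same derivative is computed by the structure equation and from the entries of
  \<open>first_derivative\<close>, of which only the third involves the unknown
  \<open>g\<close>.\<close>

lemma second_derivative:
  assumes y: "y \<in> D"
  shows "A *v dd \<phi> (\<tau> y) (Z y a b) - (H * h (\<tau> y) (dd \<tau> y b) (dd \<tau> y a)) *\<^sub>R \<Phi> (\<tau> y)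
    = vector [b$1 * a$2 + a$1 * b$2, b$1 * a$3 + a$1 * b$3, dd (\<lambda>w. dd g w a) y b, 0]"
proof -
  let ?l = "\<lambda>z. A *v (dd \<phi> (\<tau> y) (Z y a z) - (H * h (\<tau> y) (dd \<tau> y z) (dd \<tau> y a)) *\<^sub>R \<phi> (\<tau> y))"
  have *: "((\<lambda>w. (A *v dd \<phi> (\<tau> w) (dd \<tau> w a)) $ i) has_derivative (\<lambda>z. ?l z $ i)) (at y)" for i
    unfolding Z_def
    by (rule bounded_linear.has_derivative[OF bounded_linear_vec_nth
          bounded_linear.has_derivative[OF matrix_vector_mul_bounded_linear
            has_derivative_\<phi>_field_along[OF D y \<tau>U has_derivative_\<tau>[OF y] has_derivative_dd\<tau>[OF y]]]])
  have tr: "?l b $ i = f' b"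
    if f: "(f has_derivative f') (at y)" and eq: "\<And>w. w \<in> D \<Longrightarrow> (A *v dd \<phi> (\<tau> w) (dd \<tau> w a)) $ i = f w" for i f f'
    using fun_cong[OF has_derivative_unique[OF has_derivative_transform_within_open[OF *[of i] D y eq] f], of b] by simp
  have "?l b = vector [b$1 * a$2 + a$1 * b$2, b$1 * a$3 + a$1 * b$3, dd (\<lambda>w. dd g w a) y b, 0]"
    unfolding vec_eq_iff forall_4 vector_4
  proof (intro conjI)
    show "?l b $ 1 = b$1 * a$2 + a$1 * b$2"
      by (rule tr[OF has_derivative_add[OF has_derivative_mult_left[OF has_derivative_nth] has_derivative_mult_right[OF has_derivative_nth]]])
        (simp add: first_derivative vector_4)
    show "?l b $ 2 = b$1 * a$3 + a$1 * b$3"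
      by (rule tr[OF has_derivative_add[OF has_derivative_mult_left[OF has_derivative_nth] has_derivative_mult_right[OF has_derivative_nth]]])
        (simp add: first_derivative vector_4)
    show "?l b $ 3 = dd (\<lambda>w. dd g w a) y b"
      by (rule tr[OF has_derivative_ddg[OF y]]) (simp add: first_derivative vector_4)
    show "?l b $ 4 = 0"
      by (rule tr[OF has_derivative_const[of "a$1"]]) (simp add: first_derivative vector_4)
  qed
  then show ?thesis by (simp add: \<Phi>_def matrix_vector_mult_diff_distrib matrix_vector_mult_scaleR)
qed

text \<open>A leaf direction keeps the fourth coordinate of \<Phi> fixed, and the differential of
  that coordinate is a nonzero multiple of \<theta>.\<close>

lemma \<theta>_leaf:
  assumes y: "y \<in> D" and a: "a$1 = 0"
  shows "\<theta> (\<tau> y) (dd \<tau> y a) = 0"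
proof -
  have "(A *v dd \<phi> (\<tau> y) (dd \<tau> y a)) $ 4 = 0" by (simp add: first_derivative[OF y] vector_4 a)
  then show ?thesis
    using A_d\<phi>4[OF \<tau>B[OF y], of "dd \<tau> y a"] A_\<phi>4[OF \<tau>B[OF y]] q_nz[OF \<tau>U[OF y]] by simp
qed

text \<open>The first coordinate field is a multiple of V and hence orthogonal to the leaf, so the
  \<phi>-term of the structure equation disappears. The images of \<open>Z y a (axis 1 1)\<close>
  and of \<open>dd \<tau> y a\<close> over \<open>y$1\<close> then differ at most on the third axis,
  and \<open>decompose\<close> with k = 0 excludes any difference.\<close>

lemma mixed:
  assumes y: "y \<in> D" and a: "a$1 = 0"
  shows "dd (\<lambda>w. dd g w a) y (axis 1 1) = dd g y a / y$1"
proof -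
  note [simp] = \<Phi>\<tau>[OF y]
  have lin: "linear (dd \<phi> (\<tau> y))" by (rule dd_linear[OF has_derivative_frame(5)[OF \<tau>U[OF y]]])
  define s where "s = (dd g y (axis 1 1) - g y / y$1) / \<rho> (\<tau> y)"
  have "A *v dd \<phi> (\<tau> y) (dd \<tau> y (axis 1 1)) - (1 / y$1) *\<^sub>R \<Phi> (\<tau> y) = axis 3 (dd g y (axis 1 1) - g y / y$1)"
    unfolding first_derivative[OF y] by (simp add: vec_eq_iff forall_4 vector_4 axis_def g_def)
  from decompose(1)[OF \<tau>B[OF y] this] have T1: "dd \<tau> y (axis 1 1) = s *\<^sub>R V (\<tau> y)" by (simp add: s_def)
  have h0: "h (\<tau> y) (dd \<tau> y (axis 1 1)) (dd \<tau> y a) = 0"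
    using \<theta>_leaf[OF y a] by (simp add: T1 h_linear \<theta>_def)
  have e1: "A *v dd \<phi> (\<tau> y) (Z y a (axis 1 1)) = vector [a$2, a$3, dd (\<lambda>w. dd g w a) y (axis 1 1), 0]"
    using second_derivative[OF y, of a "axis 1 1"] unfolding h0 by (simp add: a axis_def)
  have "A *v dd \<phi> (\<tau> y) (Z y a (axis 1 1) - (1 / y$1) *\<^sub>R dd \<tau> y a) - 0 *\<^sub>R \<Phi> (\<tau> y)
      = axis 3 (dd (\<lambda>w. dd g w a) y (axis 1 1) - dd g y a / y$1)"
    unfolding linear_diff[OF lin] linear_scale[OF lin] matrix_vector_mult_diff_distrib matrix_vector_mult_scaleR
      e1 first_derivative[OF y]
    by (simp add: vec_eq_iff forall_4 vector_4 axis_def a)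
  from decompose(2)[OF \<tau>B[OF y] this] show ?thesis
    using q_nz[OF \<tau>U[OF y]] \<rho>_nz[OF \<tau>B[OF y]] by simp
qed

text \<open>On a leaf the coordinates 1, 2 and 4 are affine in the parameters, so the second
  derivative lies on the third axis and \<open>decompose\<close> yields its tangential part and its
  \<phi>-part.\<close>

lemma leaf_hessian:
  assumes y: "y \<in> D" and ab: "a$1 = 0" "b$1 = 0"
  shows "Z y a b = (dd (\<lambda>w. dd g w a) y b / \<rho> (\<tau> y)) *\<^sub>R V (\<tau> y)"
    "q (\<tau> y) * dd (\<lambda>w. dd g w a) y b = \<rho> (\<tau> y) * (H * h (\<tau> y) (dd \<tau> y b) (dd \<tau> y a))"
proof -
  have "A *v dd \<phi> (\<tau> y) (Z y a b) - (H * h (\<tau> y) (dd \<tau> y b) (dd \<tau> y a)) *\<^sub>R \<Phi> (\<tau> y)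
      = axis 3 (dd (\<lambda>w. dd g w a) y b)"
    unfolding second_derivative[OF y] by (simp add: vec_eq_iff forall_4 vector_4 axis_def ab)
  note * = decompose[OF \<tau>B[OF y] this]
  show "Z y a b = (dd (\<lambda>w. dd g w a) y b / \<rho> (\<tau> y)) *\<^sub>R V (\<tau> y)" by (rule *(1))
  show "q (\<tau> y) * dd (\<lambda>w. dd g w a) y b = \<rho> (\<tau> y) * (H * h (\<tau> y) (dd \<tau> y b) (dd \<tau> y a))"
    unfolding *(2) using \<rho>_nz[OF \<tau>B[OF y]] by simp
qed

text \<open>Differentiate \<open>leaf_hessian(2)\<close> along the leaf. There q and \<rho> are
  constant, and the coordinate fields are parallel for the leaf metric because \<open>Z\<close> and
  \<open>K\<close> of leaf vectors are multiples of V.\<close>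

lemma third:
  assumes y: "y \<in> D" and abc: "a$1 = 0" "b$1 = 0" "c$1 = 0"
  shows "dd (\<lambda>w. dd (\<lambda>w. dd g w a) w b) y c = 0"
proof -
  define u where "u = \<tau> y"
  have uU: "u \<in> U" using y \<tau>U by (auto simp: u_def)
  let ?T = "dd \<tau> y"
  let ?g2 = "\<lambda>w. dd (\<lambda>w. dd g w a) w b"
  have \<theta>0: "\<theta> u (?T a) = 0" "\<theta> u (?T b) = 0" "\<theta> u (?T c) = 0"
    unfolding u_def by (simp_all add: \<theta>_leaf[OF y] abc)
  have hh: "((\<lambda>w. h (\<tau> w) X Y) has_derivative (\<lambda>z. h u (L u (?T z) X) Y + h u X (L u (?T z) Y))) (at y)" for X Y
    using diff_chain_at[OF has_derivative_\<tau>[OF y] has_derivative_h_const[OF \<tau>U[OF y]], of X Y]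
    by (simp add: o_def compat_L[OF uU] u_def[symmetric])
  have dh: "((\<lambda>w. h (\<tau> w) (dd \<tau> w b) (dd \<tau> w a)) has_derivative
      (\<lambda>z. h u (L u (?T z) (?T b)) (?T a) + h u (?T b) (L u (?T z) (?T a))
        + h u (dd (\<lambda>w. dd \<tau> w b) y z) (?T a) + h u (?T b) (dd (\<lambda>w. dd \<tau> w a) y z))) (at y)"
    using has_derivative_bilinear_field[OF h_bil hh has_derivative_dd\<tau>[OF y] has_derivative_dd\<tau>[OF y]]
    by (simp add: u_def)
  have LZ: "L u (?T c) (?T x) + dd (\<lambda>w. dd \<tau> w x) y c = Z y x c - K u (?T c) (?T x)" for x
    by (simp add: Z_def L_def u_def)
  have vert: "h u (Z y x c - K u (?T c) (?T x)) (?T x') = 0" if "x$1 = 0" "x'$1 = 0" for x x'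
  proof -
    have "\<theta> u (?T x) = 0" "\<theta> u (?T x') = 0" unfolding u_def using \<theta>_leaf[OF y] that by auto
    moreover have "h u (V u) X = \<theta> u X" for X by (simp add: \<theta>_def)
    ultimately show ?thesis
      by (simp add: leaf_hessian(1)[OF y that(1) abc(3)] h_linear h_K[OF uU] C_def \<theta>0 u_def[symmetric])
  qed
  have dh0: "h u (L u (?T c) (?T b)) (?T a) + h u (?T b) (L u (?T c) (?T a))
        + h u (dd (\<lambda>w. dd \<tau> w b) y c) (?T a) + h u (?T b) (dd (\<lambda>w. dd \<tau> w a) y c) = 0"
    using vert[of b a, folded LZ] vert[of a b, folded LZ] abc h_sym[OF uU, of "?T b"]
    by (simp add: h_linear)
  have dq\<tau>: "((\<lambda>w. q (\<tau> w)) has_derivative (\<lambda>z. dd q u (?T z))) (at y)"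
    using diff_chain_at[OF has_derivative_\<tau>[OF y] has_derivative_q[OF \<tau>U[OF y]]] by (simp add: o_def u_def)
  have d\<rho>\<tau>: "((\<lambda>w. \<rho> (\<tau> w)) has_derivative (\<lambda>z. - (q u + 2 * r u) * \<theta> u (?T z) * \<rho> u)) (at y)"
    using diff_chain_at[OF has_derivative_\<tau>[OF y] has_derivative_\<rho>[OF \<tau>B[OF y]]] by (simp add: o_def u_def)
  have dg2: "(?g2 has_derivative dd ?g2 y) (at y)"
    by (rule smooth_on_has_derivative[OF smooth_on_dd[OF D smooth_on_dd[OF D g_smooth smooth_on_const] smooth_on_const] D y])
  have 1: "((\<lambda>w. q (\<tau> w) * ?g2 w) has_derivative (\<lambda>z. q (\<tau> y) * dd ?g2 y z + dd q u (?T z) * ?g2 y)) (at y)"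
    by (rule has_derivative_mult[OF dq\<tau> dg2])
  have 2: "((\<lambda>w. q (\<tau> w) * ?g2 w) has_derivative
     (\<lambda>z. \<rho> (\<tau> y) * (H * (h u (L u (?T z) (?T b)) (?T a) + h u (?T b) (L u (?T z) (?T a))
        + h u (dd (\<lambda>w. dd \<tau> w b) y z) (?T a) + h u (?T b) (dd (\<lambda>w. dd \<tau> w a) y z)))
       + (- (q u + 2 * r u) * \<theta> u (?T z) * \<rho> u) * (H * h (\<tau> y) (?T b) (?T a)))) (at y)"
    by (rule has_derivative_transform_within_open[OF has_derivative_mult[OF d\<rho>\<tau> has_derivative_mult_right[OF dh]] D y])
      (simp add: leaf_hessian(2) abc)
  have "q u * dd ?g2 y c = 0"
    using fun_cong[OF has_derivative_unique[OF 1 2], of c] unfolding dh0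
    by (simp add: \<theta>0 dq[OF uU] u_def[symmetric])
  then show ?thesis using q_nz[OF uU] by simp
qed

lemma \<tau>_immersion:
  assumes y: "y \<in> D" and "dd \<tau> y a = 0"
  shows "a = 0"
proof -
  have "A *v dd \<phi> (\<tau> y) (dd \<tau> y a) = 0" by (simp add: assms(2) dd_\<phi>_linear[OF \<tau>U[OF y]])
  then have "a $ 1 = 0" "y$1 * a$2 + a$1 * y$2 = 0" "y$1 * a$3 + a$1 * y$3 = 0"
    unfolding first_derivative[OF y] vec_eq_iff forall_4 vector_4 by auto
  then show ?thesis using \<Phi>\<tau>(1)[OF y] by (simp add: vec_eq_iff forall_3)
qed

text \<open>The Hessian is a nonzero multiple of \<open>h\<close> on the leaf. In the null basis E,
  F the Gram determinant is minus the square of the change-of-basis determinant P S - Q R.\<close>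

lemma leaf_hessian_det:
  assumes y: "y \<in> D"
  defines "c \<equiv> \<lambda>a b. dd (\<lambda>v. dd g v a) y b / y$1"
  shows "c (axis 2 1) (axis 2 1) * c (axis 3 1) (axis 3 1) - (c (axis 2 1) (axis 3 1))\<^sup>2 < 0"
proof -
  define u where "u = \<tau> y"
  have uU: "u \<in> U" and uB: "u \<in> B" using y \<tau>U \<tau>B by (auto simp: u_def)
  have ax: "(axis 2 1 :: real^3) $ 1 = 0" "(axis 3 1 :: real^3) $ 1 = 0" by (simp_all add: axis_def)
  let ?T = "dd \<tau> y"
  define k where "k = \<rho> u * H / (q u * y$1)"
  have k: "k \<noteq> 0" using \<rho>_nz[OF uB] H_nz q_nz[OF uU] \<Phi>\<tau>(1)[OF y] by (simp add: k_def)
  have c: "c a b = k * h u (?T b) (?T a)" if "a$1 = 0" "b$1 = 0" for a b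
    using leaf_hessian(2)[OF y that] q_nz[OF uU] \<Phi>\<tau>(1)[OF y]
    by (simp add: c_def k_def u_def field_simps)
  have FE: "h u (F u) (E u) = 1" using frame(3)[OF uU] h_sym[OF uU] by metis
  define P Q R S where "P = h u (?T (axis 2 1)) (F u)" "Q = h u (?T (axis 2 1)) (E u)"
    "R = h u (?T (axis 3 1)) (F u)" "S = h u (?T (axis 3 1)) (E u)"
  have T2: "?T (axis 2 1) = P *\<^sub>R E u + Q *\<^sub>R F u" and T3: "?T (axis 3 1) = R *\<^sub>R E u + S *\<^sub>R F u"
    using frame_expansion[OF uU, of "?T (axis 2 1)"] frame_expansion[OF uU, of "?T (axis 3 1)"]
      \<theta>_leaf[OF y ax(1)] \<theta>_leaf[OF y ax(2)] by (simp_all add: P_Q_R_S_def u_def)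
  have lin: "linear ?T" by (rule dd_linear[OF has_derivative_\<tau>[OF y]])
  have inj: "s = 0 \<and> t = 0" if "s *\<^sub>R ?T (axis 2 1) + t *\<^sub>R ?T (axis 3 1) = 0" for s t
  proof -
    have "?T (s *\<^sub>R axis 2 1 + t *\<^sub>R axis 3 1) = 0"
      using that by (simp add: linear_add[OF lin] linear_scale[OF lin])
    then have "s *\<^sub>R axis 2 1 + t *\<^sub>R axis 3 1 = (0 :: real^3)" by (rule \<tau>_immersion[OF y])
    then show ?thesis by (simp add: vec_eq_iff forall_3 axis_def)
  qed
  have "P * S - Q * R \<noteq> 0"
  proof
    assume *: "P * S - Q * R = 0"
    have "S *\<^sub>R ?T (axis 2 1) + (- Q) *\<^sub>R ?T (axis 3 1) = (P * S - Q * R) *\<^sub>R E u"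
      unfolding T2 T3 by (simp add: algebra_simps)
    then have SQ: "S = 0" "Q = 0" using inj[of S "- Q"] * by auto
    have "R *\<^sub>R ?T (axis 2 1) + (- P) *\<^sub>R ?T (axis 3 1) = 0"
      unfolding T2 T3 SQ by simp
    then have "R = 0" "P = 0" using inj[of R "- P"] by auto
    then have "?T (axis 2 1) = 0" using T2 SQ by simp
    then show False using inj[of 1 0] by simp
  qed
  then have pos: "(P * S - Q * R)\<^sup>2 > 0" by simp
  have hs: "h u (?T (axis 2 1)) (?T (axis 2 1)) = 2 * P * Q" "h u (?T (axis 3 1)) (?T (axis 3 1)) = 2 * R * S"
    "h u (?T (axis 3 1)) (?T (axis 2 1)) = P * S + Q * R"
    unfolding T2 T3 by (simp_all add: h_linear frame[OF uU] FE)
  have "c (axis 2 1) (axis 2 1) * c (axis 3 1) (axis 3 1) - (c (axis 2 1) (axis 3 1))\<^sup>2 = - (k\<^sup>2 * (P * S - Q * R)\<^sup>2)"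
    unfolding c[OF ax(1,1)] c[OF ax(2,2)] c[OF ax(1,2)] hs by (simp add: power2_eq_square algebra_simps)
  then show ?thesis using pos k by (simp add: zero_less_mult_iff)
qed

end

section \<open>Assembling the local model\<close>

lemma (in so11_chart) model_form:
  assumes "d > 0" and D_eq: "D = {w. \<forall>i. \<bar>w$i - y$i\<bar> < d}" and "convex D"
  shows "\<exists>A' \<gamma> f. det (A' :: real^4^4) \<noteq> 0 \<and> smooth_on {y$1 - d<..<y$1 + d} \<gamma> \<and>
    (\<forall>N. hyp_paraboloid_normal001 f N) \<and> (\<forall>w\<in>D. A' *v \<phi> (\<tau> w) = model_map (\<lambda>v. v) \<gamma> f w)"
proof -
  have yD: "y \<in> D" using \<open>d > 0\<close> by (simp add: D_eq)
  define c where "c a b = dd (\<lambda>v. dd g v a) y b / y$1" for a b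
  let ?c22 = "c (axis 2 1) (axis 2 1)" and ?c23 = "c (axis 2 1) (axis 3 1)" and ?c33 = "c (axis 3 1) (axis 3 1)"
  obtain k l \<gamma> where \<gamma>: "smooth_on {y$1 - d<..<y$1 + d} \<gamma>"
    and g: "\<And>w. w \<in> D \<Longrightarrow> g w = w$1 * ((?c22 * (w$2)\<^sup>2 + 2 * ?c23 * w$2 * w$3 + ?c33 * (w$3)\<^sup>2) / 2
      + k * w$2 + l * w$3) + \<gamma> (w$1)"
    using quadratic_in_leaf_coordinates[OF \<open>d > 0\<close> D_eq D \<open>convex D\<close> g_smooth \<Phi>\<tau>(1) mixed third]
    unfolding c_def by blast
  \<comment> \<open>The Hessian of the graph function has determinant \<open>-(s * s)\<close>;
    dividing the third ambient coordinate by \<open>s\<close> normalises it to -1.\<close>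
  define s where "s = sqrt (?c23\<^sup>2 - ?c22 * ?c33)"
  have neg: "?c22 * ?c33 - ?c23\<^sup>2 < 0" unfolding c_def by (rule leaf_hessian_det[OF yD])
  then have s: "s > 0" "s * s = ?c23\<^sup>2 - ?c22 * ?c33" by (simp_all add: s_def)
  define f :: "real^2 \<Rightarrow> real" where "f z = (?c22 / s * (z$1)\<^sup>2 + 2 * (?c23 / s) * z$1 * z$2 + ?c33 / s * (z$2)\<^sup>2) / 2
    + k / s * z$1 + l / s * z$2 + 0" for z
  define A' where "A' = (\<chi> i. (if i = 3 then 1 / s else 1) *s A $ i)"
  have "det A' = prod (\<lambda>i::4. if i = 3 then 1 / s else 1) UNIV * det A"
    unfolding A'_def det_rows_mul by simp
  then have "det A' \<noteq> 0" using s det_A by simp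
  moreover have "smooth_on {y$1 - d<..<y$1 + d} (\<lambda>v. \<gamma> v / s)"
    using s by (intro smooth_on_divide[OF _ \<gamma> smooth_on_const]) auto
  moreover have "hyp_paraboloid_normal001 f N" for N
  proof -
    have "?c22 / s * (?c33 / s) - (?c23 / s)\<^sup>2 = (?c22 * ?c33 - ?c23\<^sup>2) / (s * s)"
      by (simp add: power2_eq_square diff_divide_distrib)
    also have "\<dots> = -1" using neg unfolding s(2) by (simp add: field_simps)
    finally show ?thesis unfolding hyp_paraboloid_normal001_def f_def by blast
  qed
  moreover have "A' *v \<phi> (\<tau> w) = model_map (\<lambda>v. v) (\<lambda>v. \<gamma> v / s) f w" if w: "w \<in> D" for w
  proof -
    have A': "(A' *v \<phi> (\<tau> w)) $ i = (if i = 3 then 1 / s else 1) * \<Phi> (\<tau> w) $ i" for i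
      by (simp add: A'_def matrix_vector_mult_def \<Phi>_def sum_distrib_left mult.assoc)
    have 3: "\<Phi> (\<tau> w) $ 3 = g w" by (simp add: g_def)
    show ?thesis
      unfolding vec_eq_iff forall_4 A' model_map_def vector_4 3 g[OF w]
      using s by (simp add: \<Phi>\<tau>[OF w] f_def field_simps)
  qed
  ultimately show ?thesis by blast
qed

context so11_sphere
begin

lemma local_model:
  assumes p: "p \<in> U"
  shows "\<exists>W I N \<gamma> f (A :: real^4^4) s. open W \<and> p \<in> W \<and> W \<subseteq> U \<and> (\<exists>a b. a < b \<and> I = {a<..<b}) \<and> open N \<and>
    hyp_paraboloid_normal001 f N \<and> smooth_on I \<gamma> \<and> det A \<noteq> 0 \<and>
    bij_betw s W (prod_dom I N) \<and> smooth_on W s \<and> smooth_on (prod_dom I N) (inv_into W s) \<and>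
    (\<forall>u\<in>W. A *v \<phi> u = model_map (\<lambda>v. v) \<gamma> f (s u))"
proof -
  obtain e A \<rho> where e: "e > 0" "ball p e \<subseteq> U" and nf: "det (A :: real^4^4) \<noteq> 0"
    "\<And>u. u \<in> ball p e \<Longrightarrow> A *v (m u - q u *\<^sub>R \<phi> u) = axis 3 (\<rho> u)"
    "\<And>u. u \<in> ball p e \<Longrightarrow> \<rho> u \<noteq> 0" "\<And>u. u \<in> ball p e \<Longrightarrow> (A *v \<phi> u) $ 4 \<noteq> 0"
    "\<And>u X. u \<in> ball p e \<Longrightarrow> (A *v dd \<phi> u X) $ 4 = q u * \<theta> u X * (A *v \<phi> u) $ 4"
    using normal_form[OF p] by blast
  interpret so11_normal U \<phi> h G E V F r q H \<theta> C "ball p e" A \<rho>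
    by unfold_locales (use e nf in \<open>auto simp: ww_def \<theta>_def\<close>)
  have p': "p \<in> ball p e" using e by simp
  obtain W0 V0 \<tau> where 0: "open W0" "p \<in> W0" "W0 \<subseteq> ball p e" "open V0" "\<sigma> p \<in> V0"
    "homeomorphism W0 V0 \<sigma> \<tau>" "smooth_on V0 \<tau>"
  proof (rule smooth_inverse_function[OF B(1) \<sigma>_smooth p'])
    fix u X assume "u \<in> ball p e" "dd \<sigma> u X = 0"
    then show "X = 0" by (rule \<sigma>_immersion)
  qed (rule that)
  obtain \<epsilon> where \<epsilon>: "\<epsilon> > 0" "ball (\<sigma> p) \<epsilon> \<subseteq> V0" using 0(4,5) open_contains_ball by blast
  \<comment> \<open>A third of the radius, since the norm is bounded by the sum of three
    coordinates.\<close>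
  define d where "d = \<epsilon> / 3"
  have d: "d > 0" using \<epsilon> by (simp add: d_def)
  define I where "I = {\<sigma> p $ 1 - d<..<\<sigma> p $ 1 + d}"
  define N :: "(real^2) set" where "N = box (\<chi> i. (if i = 1 then \<sigma> p $ 2 else \<sigma> p $ 3) - d) (\<chi> i. (if i = 1 then \<sigma> p $ 2 else \<sigma> p $ 3) + d)"
  \<comment> \<open>The ball around \<open>\<sigma> p\<close> is replaced by a cube: it is a product
    of an interval and an open set, and it is convex.\<close>
  define D where "D = prod_dom I N"
  have D_eq: "D = {w. \<forall>i. \<bar>w$i - \<sigma> p $ i\<bar> < d}"
    by (auto simp: D_def prod_dom_def I_def N_def mem_box_cart forall_2 forall_3 abs_less_iff)
  have D_box: "D = box (\<chi> i. \<sigma> p $ i - d) (\<chi> i. \<sigma> p $ i + d)"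
    by (auto simp: D_eq mem_box_cart abs_less_iff algebra_simps; meson less_diff_eq diff_less_eq)
  have openD: "open D" and convD: "convex D" unfolding D_box by (rule open_box, rule convex_box)
  have DV: "D \<subseteq> V0"
  proof
    fix w assume "w \<in> D"
    then have c: "\<bar>(w - \<sigma> p) $ i\<bar> < d" for i by (simp add: D_eq)
    have "norm (w - \<sigma> p) \<le> (\<Sum>i\<in>UNIV. \<bar>(w - \<sigma> p) $ i\<bar>)" by (rule norm_le_l1_cart)
    also have "\<dots> < \<epsilon>" using c[of 1] c[of 2] c[of 3] by (simp add: sum_3 d_def)
    finally show "w \<in> V0" using \<epsilon> by (auto simp: dist_norm norm_minus_commute)
  qed
  have hom: "\<And>u. u \<in> W0 \<Longrightarrow> \<tau> (\<sigma> u) = u" "\<And>y. y \<in> V0 \<Longrightarrow> \<sigma> (\<tau> y) = y" "\<And>y. y \<in> V0 \<Longrightarrow> \<tau> y \<in> W0"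
    "continuous_on W0 \<sigma>"
    using 0(6) by (auto simp: homeomorphism_def)
  interpret so11_chart U \<phi> h G E V F r q H \<theta> C "ball p e" A \<rho> D \<tau>
    using openD smooth_on_subset[OF 0(7,4) openD DV] hom 0(3) DV by unfold_locales blast+
  obtain A' \<gamma> f where m: "det (A' :: real^4^4) \<noteq> 0" "smooth_on I \<gamma>" "\<And>N. hyp_paraboloid_normal001 f N"
    "\<And>w. w \<in> D \<Longrightarrow> A' *v \<phi> (\<tau> w) = model_map (\<lambda>v. v) \<gamma> f w"
    using model_form[OF d D_eq convD] unfolding I_def by blast
  define W where "W = W0 \<inter> \<sigma> -` D"
  have W: "open W" unfolding W_def by (rule continuous_open_preimage[OF hom(4) 0(1) openD])
  have bij: "bij_betw \<sigma> W D"
    by (rule bij_betw_byWitness[where f' = \<tau>]) (use hom DV in \<open>auto simp: W_def\<close>)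
  have inv: "inv_into W \<sigma> y = \<tau> y" if "y \<in> D" for y
    using that hom DV by (intro inv_into_f_eq bij_betw_imp_inj_on[OF bij]) (auto simp: W_def)
  have WB: "W \<subseteq> ball p e" using 0(3) by (auto simp: W_def)
  show ?thesis
  proof (intro exI conjI)
    show "open W" by (rule W)
    show "p \<in> W" using 0(2) d by (simp add: W_def D_eq)
    show "W \<subseteq> U" using WB e by blast
    show "\<sigma> p $ 1 - d < \<sigma> p $ 1 + d" using d by simp
    show "I = {\<sigma> p $ 1 - d<..<\<sigma> p $ 1 + d}" by (rule I_def)
    show "open N" unfolding N_def by (rule open_box)
    show "hyp_paraboloid_normal001 f N" by (rule m(3))
    show "smooth_on I \<gamma>" by (rule m(2))
    show "det A' \<noteq> 0" by (rule m(1))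
    show "bij_betw \<sigma> W (prod_dom I N)" using bij by (simp add: D_def)
    show "smooth_on W \<sigma>" by (rule smooth_on_subset[OF \<sigma>_smooth B(1) W WB])
    have "smooth_on D (inv_into W \<sigma>)"
      by (rule smooth_on_cong[OF openD, THEN iffD2, OF _ \<tau>_smooth]) (rule inv)
    then show "smooth_on (prod_dom I N) (inv_into W \<sigma>)" by (simp add: D_def)
    show "\<forall>u\<in>W. A' *v \<phi> u = model_map (\<lambda>v. v) \<gamma> f (\<sigma> u)"
    proof
      fix u assume "u \<in> W"
      then have "\<sigma> u \<in> D" "\<tau> (\<sigma> u) = u" using hom(1) by (auto simp: W_def)
      then show "A' *v \<phi> u = model_map (\<lambda>v. v) \<gamma> f (\<sigma> u)" using m(4)[of "\<sigma> u"] by simp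
    qed
  qed
qed

end

section \<open>From the index notation to the frame formulation\<close>

text \<open>Common form of both connections, which makes \<open>diff_tensor\<close> a difference of
  bilinear maps.\<close>

definition contract3 :: "(3 \<Rightarrow> 3 \<Rightarrow> 3 \<Rightarrow> real) \<Rightarrow> real^3 \<Rightarrow> real^3 \<Rightarrow> real^3" where
  "contract3 c X Y = (\<chi> k. \<Sum>i\<in>UNIV. \<Sum>j\<in>UNIV. X$i * Y$j * c i j k)"

lemma bilinear_contract3: "bilinear (contract3 c)"
  unfolding bilinear_def
  by (auto intro!: linearI simp: contract3_def vec_eq_iff sum_3 algebra_simps)

lemma bilinear_hform: "bilinear (hform h u)"
  unfolding bilinear_def
  by (auto intro!: linearI simp: hform_def sum_3 algebra_simps)

lemma diff_tensor_contract3: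
  "diff_tensor Gam h u X Y = contract3 (Gam u) X Y - contract3 (lc_christoffel h u) X Y"
  by (simp add: diff_tensor_def contract3_def vec_eq_iff algebra_simps flip: sum_subtractf)

lemma contract3_sym: "(\<And>i j. c i j = c j i) \<Longrightarrow> contract3 c X Y = contract3 c Y X"
  by (simp add: contract3_def vec_eq_iff sum_3 algebra_simps)

locale so11_hypersurface =
  fixes U :: "(real^3) set" and \<phi> \<xi> :: "real^3 \<Rightarrow> real^4"
    and Gam :: "real^3 \<Rightarrow> 3 \<Rightarrow> 3 \<Rightarrow> 3 \<Rightarrow> real"
    and h S :: "real^3 \<Rightarrow> 3 \<Rightarrow> 3 \<Rightarrow> real" and H :: real
    and E V F :: "real^3 \<Rightarrow> real^3" and b4 :: "real^3 \<Rightarrow> real"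
  assumes blaschke: "blaschke_hypersurface U \<phi> \<xi> Gam h S"
    and umbilic: "\<forall>u\<in>U. \<forall>i k. S u i k = (if i = k then H else 0)"
    and H_nz: "H \<noteq> 0"
    and frame: "so11_frame U Gam h E V F b4"
    and H_eq: "\<forall>u\<in>U. H = (b4 u)^2 - (alpha12 h E V F u)^2"
begin

lemma U: "open U"
  and \<phi>_smooth: "smooth_on U \<phi>" and \<xi>_smooth: "smooth_on U \<xi>"
  and det_frame: "u \<in> U \<Longrightarrow> det (frame4 (pd \<phi> 1 u) (pd \<phi> 2 u) (pd \<phi> 3 u) (\<xi> u)) \<noteq> 0"
  and struct: "u \<in> U \<Longrightarrow> pd (pd \<phi> j) i u = (\<Sum>k\<in>UNIV. Gam u i j k *\<^sub>R pd \<phi> k u) + h u i j *\<^sub>R \<xi> u"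
  and weingarten: "u \<in> U \<Longrightarrow> pd \<xi> i u = - (\<Sum>k\<in>UNIV. S u i k *\<^sub>R pd \<phi> k u)"
  and det_h: "u \<in> U \<Longrightarrow> det (hmat h u) \<noteq> 0"
  using blaschke by (auto simp: blaschke_hypersurface_def)

lemma pd_\<phi>_smooth: "smooth_on U (pd \<phi> i)"
  unfolding pd_def[abs_def] by (rule smooth_on_dd[OF U \<phi>_smooth smooth_on_const])

definition M where "M u = transpose (frame4 (pd \<phi> 1 u) (pd \<phi> 2 u) (pd \<phi> 3 u) (\<xi> u))"

lemma M_mult: "M u *v x = x$1 *\<^sub>R pd \<phi> 1 u + x$2 *\<^sub>R pd \<phi> 2 u + x$3 *\<^sub>R pd \<phi> 3 u + x$4 *\<^sub>R \<xi> u"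
  unfolding M_def by (rule transpose_frame4_mult)

lemma det_M: "u \<in> U \<Longrightarrow> det (M u) \<noteq> 0"
  unfolding M_def det_transpose by (rule det_frame)

text \<open>The unknowns of the structure equation, gathered so that one linear system with matrix
  \<open>M u\<close> determines them.\<close>

definition coeffs :: "3 \<Rightarrow> 3 \<Rightarrow> real^3 \<Rightarrow> real^4" where
  "coeffs i j u = vector [Gam u i j 1, Gam u i j 2, Gam u i j 3, h u i j]"

lemma M_coeffs: "u \<in> U \<Longrightarrow> M u *v coeffs i j u = pd (pd \<phi> j) i u"
  by (simp add: M_mult coeffs_def vector_4 struct sum_3)

text \<open>Regularity of \<open>h\<close> and of the Christoffel symbols comes from Cramer's rule.\<close>

lemma coeffs_smooth: "smooth_on U (coeffs i j)"
proof (rule smooth_on_linear_system[OF U _ _ det_M M_coeffs])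
  show "smooth_on U (\<lambda>u. M u $ k $ l)" for k l
    using exhaust_4[of l] smooth_on_vec_nth[OF U pd_\<phi>_smooth] smooth_on_vec_nth[OF U \<xi>_smooth]
    by (auto simp: M_def transpose_def frame4_def vector_4)
  show "smooth_on U (\<lambda>u. pd (pd \<phi> j) i u $ k)" for k
    unfolding pd_def[of "pd \<phi> j"]
    by (rule smooth_on_vec_nth[OF U smooth_on_dd[OF U pd_\<phi>_smooth smooth_on_const]])
qed

lemma h_smooth: "smooth_on U (\<lambda>u. h u i j)"
  using smooth_on_vec_nth[OF U coeffs_smooth[of i j], of 4] by (simp add: coeffs_def vector_4)

lemma Gam_smooth: "smooth_on U (\<lambda>u. Gam u i j k)"
  using smooth_on_vec_nth[OF U coeffs_smooth[of i j], of 1] smooth_on_vec_nth[OF U coeffs_smooth[of i j], of 2]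
    smooth_on_vec_nth[OF U coeffs_smooth[of i j], of 3] exhaust_3[of k] by (auto simp: coeffs_def vector_4)

text \<open>Second partial derivatives of \<open>\<phi>\<close> commute and the linear system has a
  unique solution; this gives symmetry of \<open>h\<close> and absence of torsion at once.\<close>

lemma coeffs_sym:
  assumes u: "u \<in> U"
  shows "coeffs i j u = coeffs j i u"
proof -
  have "M u *v (coeffs i j u - coeffs j i u) = 0"
    unfolding matrix_vector_mult_diff_distrib M_coeffs[OF u]
    using dd_commute[OF U \<phi>_smooth u] by (simp add: pd_def[abs_def])
  then show ?thesis using invertible_mult_eq_0[OF det_M[OF u]] by force
qed

lemma h_sym: "u \<in> U \<Longrightarrow> h u i j = h u j i"
  using arg_cong[OF coeffs_sym, of u "\<lambda>v. v $ 4" i j] by (simp add: coeffs_def vector_4)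

lemma Gam_sym: "u \<in> U \<Longrightarrow> Gam u i j k = Gam u j i k"
  using arg_cong[OF coeffs_sym, of u "\<lambda>v. v $ 1" i j]
    arg_cong[OF coeffs_sym, of u "\<lambda>v. v $ 2" i j] arg_cong[OF coeffs_sym, of u "\<lambda>v. v $ 3" i j] exhaust_3[of k]
  by (auto simp: coeffs_def vector_4)

abbreviation hh where "hh \<equiv> hform h"
abbreviation G where "G u \<equiv> contract3 (Gam u)"
abbreviation L where "L u \<equiv> contract3 (lc_christoffel h u)"

lemma hh_sym: "u \<in> U \<Longrightarrow> hh u X Y = hh u Y X"
  by (simp add: hform_def sum_3 h_sym[of u 2 1] h_sym[of u 3 1] h_sym[of u 3 2] algebra_simps)

lemma G_sym: "u \<in> U \<Longrightarrow> G u X Y = G u Y X"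
  using Gam_sym by (intro contract3_sym) (simp add: fun_eq_iff)

lemma hh_smooth: "smooth_on U (\<lambda>u. hh u X Y)"
  unfolding hform_def by (intro smooth_on_sum[OF U] smooth_on_mult[OF U] smooth_on_const h_smooth)

lemma G_smooth: "smooth_on U (\<lambda>u. G u X Y)"
proof (rule smooth_on_vecI[OF U])
  show "smooth_on U (\<lambda>u. G u X Y $ k)" for k
    unfolding contract3_def vec_lambda_beta
    by (intro smooth_on_sum[OF U] smooth_on_mult[OF U] smooth_on_const Gam_smooth)
qed

lemma pd_h_sym: "u \<in> U \<Longrightarrow> pd (\<lambda>w. h w i j) l u = pd (\<lambda>w. h w j i) l u"
  unfolding pd_def by (subst dd_cong[OF U _ h_sym]) auto

lemma lc_sym: "u \<in> U \<Longrightarrow> lc_christoffel h u i j k = lc_christoffel h u j i k"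
  by (simp add: lc_christoffel_def pd_h_sym[of u i j] add.commute)

lemma L_sym: "u \<in> U \<Longrightarrow> L u X Y = L u Y X"
  using lc_sym by (intro contract3_sym) (simp add: fun_eq_iff)

text \<open>Contracting with \<open>h\<close> cancels the inverse matrix and leaves the Koszul
  expression.\<close>

lemma lc_lower:
  assumes u: "u \<in> U"
  shows "(\<Sum>k\<in>UNIV. lc_christoffel h u i j k * h u k m)
    = (pd (\<lambda>w. h w j m) i u + pd (\<lambda>w. h w i m) j u - pd (\<lambda>w. h w i j) m u) / 2"
proof -
  define g where "g l = pd (\<lambda>w. h w j l) i u + pd (\<lambda>w. h w i l) j u - pd (\<lambda>w. h w i j) l u" for l
  have inv: "invertible (hmat h u)" using det_h[OF u] by (simp add: invertible_det_nz)
  have "(hmat h u ** matrix_inv (hmat h u)) $ m $ l = (if m = l then 1 else 0)" for l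
    by (simp add: matrix_inv[OF inv] mat_def)
  then have *: "(\<Sum>k\<in>UNIV. h u m k * matrix_inv (hmat h u) $ k $ l) = (if m = l then 1 else 0)" for l
    by (simp add: matrix_matrix_mult_def hmat_def)
  have lc: "lc_christoffel h u i j k = (1/2) * (\<Sum>l\<in>UNIV. matrix_inv (hmat h u) $ k $ l * g l)" for k
    by (simp only: lc_christoffel_def g_def)
  have "(\<Sum>k\<in>UNIV. lc_christoffel h u i j k * h u k m)
      = (\<Sum>k\<in>UNIV. \<Sum>l\<in>UNIV. (h u m k * matrix_inv (hmat h u) $ k $ l) * g l) / 2"
    by (simp add: lc h_sym[OF u, of _ m] sum_3 algebra_simps)
  also have "\<dots> = (\<Sum>l\<in>UNIV. (\<Sum>k\<in>UNIV. h u m k * matrix_inv (hmat h u) $ k $ l) * g l) / 2"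
    by (subst sum.swap) (simp add: sum_distrib_right)
  also have "\<dots> = g m / 2" by (simp add: * if_distrib[of "\<lambda>x. x * _"] cong: if_cong)
  finally show ?thesis by (simp add: g_def)
qed

lemma hh_L:
  assumes u: "u \<in> U"
  shows "hh u (L u Z X) Y = (\<Sum>i\<in>UNIV. \<Sum>j\<in>UNIV. \<Sum>m\<in>UNIV. Z$i * X$j * Y$m *
    ((pd (\<lambda>w. h w j m) i u + pd (\<lambda>w. h w i m) j u - pd (\<lambda>w. h w i j) m u) / 2))"
proof -
  have "hh u (L u Z X) Y = (\<Sum>i\<in>UNIV. \<Sum>j\<in>UNIV. \<Sum>m\<in>UNIV. Z$i * X$j * Y$m *
      (\<Sum>k\<in>UNIV. lc_christoffel h u i j k * h u k m))"
    by (simp add: hform_def contract3_def sum_3 algebra_simps)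
  then show ?thesis by (simp only: lc_lower[OF u])
qed

lemma dd_hh:
  assumes u: "u \<in> U"
  shows "dd (\<lambda>w. hh w X Y) u Z = (\<Sum>i\<in>UNIV. \<Sum>j\<in>UNIV. \<Sum>m\<in>UNIV. Z$i * X$j * Y$m * pd (\<lambda>w. h w j m) i u)"
proof -
  have d: "((\<lambda>w. h w i j) has_derivative dd (\<lambda>w. h w i j) u) (at u)" for i j
    by (rule smooth_on_has_derivative[OF h_smooth U u])
  have "((\<lambda>w. hh w X Y) has_derivative (\<lambda>z. \<Sum>i\<in>UNIV. \<Sum>j\<in>UNIV. X$i * Y$j * dd (\<lambda>w. h w i j) u z)) (at u)"
    unfolding hform_def by (intro has_derivative_sum has_derivative_mult_right d)
  from fun_cong[OF dd_eq[OF this]]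
  have "dd (\<lambda>w. hh w X Y) u Z = (\<Sum>j\<in>UNIV. \<Sum>m\<in>UNIV. X$j * Y$m * dd (\<lambda>w. h w j m) u Z)" .
  moreover have "dd (\<lambda>w. h w i j) u Z = (\<Sum>k\<in>UNIV. Z$k * pd (\<lambda>w. h w i j) k u)" for i j
    using dd_axis3[OF d, of i j Z] by (simp add: sum_3 pd_def)
  ultimately show ?thesis by (simp add: sum_3 algebra_simps)
qed

text \<open>In the sum of the two Koszul expressions with \<open>X\<close> and \<open>Y\<close>
  exchanged, all derivatives cancel except those in the direction \<open>Z\<close>.\<close>

lemma levi_civita:
  assumes u: "u \<in> U"
  shows "dd (\<lambda>w. hh w X Y) u Z = hh u (L u Z X) Y + hh u X (L u Z Y)"
proof -
  have "hh u (L u Z X) Y + hh u (L u Z Y) X = (\<Sum>i\<in>UNIV. \<Sum>j\<in>UNIV. \<Sum>m\<in>UNIV. Z$i * X$j * Y$m *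
    ((pd (\<lambda>w. h w j m) i u + pd (\<lambda>w. h w i m) j u - pd (\<lambda>w. h w i j) m u) / 2
     + (pd (\<lambda>w. h w m j) i u + pd (\<lambda>w. h w i j) m u - pd (\<lambda>w. h w i m) j u) / 2))"
    unfolding hh_L[OF u] by (simp add: sum_3 algebra_simps)
  also have "\<dots> = (\<Sum>i\<in>UNIV. \<Sum>j\<in>UNIV. \<Sum>m\<in>UNIV. Z$i * X$j * Y$m * pd (\<lambda>w. h w j m) i u)"
  proof -
    have "(pd (\<lambda>w. h w j m) i u + pd (\<lambda>w. h w i m) j u - pd (\<lambda>w. h w i j) m u) / 2
     + (pd (\<lambda>w. h w m j) i u + pd (\<lambda>w. h w i j) m u - pd (\<lambda>w. h w i m) j u) / 2 = pd (\<lambda>w. h w j m) i u" for i j m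
      using pd_h_sym[OF u, of m j i] by (simp add: field_simps)
    then show ?thesis by simp
  qed
  finally show ?thesis by (simp add: dd_hh[OF u] hh_sym[OF u, of X])
qed

section \<open>The frame relations and the function \<open>q\<close>\<close>

lemma E_smooth: "smooth_on U E" and V_smooth: "smooth_on U V" and F_smooth: "smooth_on U F"
  and b4_pos: "u \<in> U \<Longrightarrow> b4 u > 0"
  and frame_metric: "u \<in> U \<Longrightarrow> hh u (E u) (E u) = 0" "u \<in> U \<Longrightarrow> hh u (F u) (F u) = 0"
    "u \<in> U \<Longrightarrow> hh u (E u) (F u) = 1" "u \<in> U \<Longrightarrow> hh u (E u) (V u) = 0"
    "u \<in> U \<Longrightarrow> hh u (F u) (V u) = 0" "u \<in> U \<Longrightarrow> hh u (V u) (V u) = 1"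
  and frame_K: "u \<in> U \<Longrightarrow> diff_tensor Gam h u (V u) (V u) = (-2 * b4 u) *\<^sub>R V u"
    "u \<in> U \<Longrightarrow> diff_tensor Gam h u (V u) (E u) = b4 u *\<^sub>R E u"
    "u \<in> U \<Longrightarrow> diff_tensor Gam h u (V u) (F u) = b4 u *\<^sub>R F u"
    "u \<in> U \<Longrightarrow> diff_tensor Gam h u (E u) (E u) = 0" "u \<in> U \<Longrightarrow> diff_tensor Gam h u (F u) (F u) = 0"
    "u \<in> U \<Longrightarrow> diff_tensor Gam h u (E u) (F u) = b4 u *\<^sub>R V u"
  using frame by (auto simp: so11_frame_def)

definition K where "K u X Y = G u X Y - L u X Y"

text \<open>Both sides are bilinear and symmetric, so the six prescribed values on the frame
  decide.\<close>

lemma K_formula: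
  assumes u: "u \<in> U"
  shows "K u X Y = b4 u *\<^sub>R (hh u (V u) X *\<^sub>R Y + hh u (V u) Y *\<^sub>R X + hh u X Y *\<^sub>R V u
    - (5 * hh u (V u) X * hh u (V u) Y) *\<^sub>R V u)"
proof -
  have bil: "bilinear (K u)"
    using bilinear_contract3 by (auto simp: bilinear_def K_def intro!: linear_compose_sub)
  have sym: "K u X Y = K u Y X" for X Y by (simp add: K_def G_sym[OF u] L_sym[OF u])
  have vals: "K u (V u) (V u) = (-2 * b4 u) *\<^sub>R V u" "K u (V u) (E u) = b4 u *\<^sub>R E u" "K u (V u) (F u) = b4 u *\<^sub>R F u"
    "K u (E u) (E u) = 0" "K u (F u) (F u) = 0" "K u (E u) (F u) = b4 u *\<^sub>R V u"
    using frame_K[OF u] by (simp_all only: diff_tensor_contract3 K_def)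
  then have vals': "K u (E u) (V u) = b4 u *\<^sub>R E u" "K u (F u) (V u) = b4 u *\<^sub>R F u" "K u (F u) (E u) = b4 u *\<^sub>R V u"
    using sym by metis+
  note hm = frame_metric[OF u]
  have hm': "hh u (V u) (E u) = 0" "hh u (V u) (F u) = 0" "hh u (F u) (E u) = 1"
    using hm hh_sym[OF u] by metis+
  note exp = null_frame_expansion[OF bilinear_hform hh_sym[OF u] hm(1,2,3) hm'(1,2) hm(6)]
  note lin = bilinear_ladd[OF bil] bilinear_radd[OF bil] bilinear_lmul[OF bil] bilinear_rmul[OF bil]
  note hlin = bilinear_ladd[OF bilinear_hform] bilinear_radd[OF bilinear_hform]
    bilinear_lmul[OF bilinear_hform] bilinear_rmul[OF bilinear_hform]
  obtain a b c where X: "X = a *\<^sub>R E u + b *\<^sub>R V u + c *\<^sub>R F u" using exp[of X] by blast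
  obtain a' b' c' where Y: "Y = a' *\<^sub>R E u + b' *\<^sub>R V u + c' *\<^sub>R F u" using exp[of Y] by blast
  have v: "hh u (V u) X = b" "hh u (V u) Y = b'" "hh u X Y = a * c' + c * a' + b * b'"
    unfolding X Y hlin by (simp_all add: hm hm')
  show ?thesis
    unfolding v unfolding X Y lin vals vals' by (simp add: vec_eq_iff algebra_simps)
qed

definition q where "q u = hh u (dd V u (E u) + G u (E u) (V u)) (F u)"

text \<open>The two derivatives of \<open>V\<close> along \<open>E\<close> differ by
  \<open>K(E,V) = b4 E\<close>, and h(E,F) = 1.\<close>

lemma alpha12_eq:
  assumes u: "u \<in> U"
  shows "alpha12 h E V F u = q u - b4 u"
proof -
  have der: "(V has_derivative dd V u) (at u)" by (rule smooth_on_has_derivative[OF V_smooth U u])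
  have "lc_cov h u (E u) V = dd V u (E u) + L u (E u) (V u)"
    unfolding lc_cov_def contract3_def dd_axis3[OF der, of "E u"] by (simp add: vec_eq_iff sum_3 pd_def)
  also have "\<dots> = dd V u (E u) + G u (E u) (V u) - K u (E u) (V u)"
    by (simp add: K_def)
  also have "K u (E u) (V u) = b4 u *\<^sub>R E u"
    using frame_K(2)[OF u] by (simp add: diff_tensor_contract3 K_def G_sym[OF u, of "E u"] L_sym[OF u, of "E u"])
  finally show ?thesis
    by (simp add: alpha12_def q_def bilinear_lsub[OF bilinear_hform] bilinear_lmul[OF bilinear_hform] frame_metric[OF u])
qed

lemma H_factor: "u \<in> U \<Longrightarrow> H = q u * (2 * b4 u - q u)"
  using H_eq by (simp add: alpha12_eq power2_eq_square algebra_simps)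

text \<open>\<open>b\<^sub>4\<close> is not assumed to be smooth; this follows from \<open>H = q (2 b\<^sub>4 - q)\<close> and \<open>q \<noteq> 0\<close>.\<close>

lemma b4_smooth: "smooth_on U b4"
proof -
  have q: "smooth_on U q"
    unfolding q_def
    by (rule smooth_on_bilinear_field[OF U bilinear_hform hh_smooth smooth_on_add[OF U smooth_on_dd[OF U V_smooth E_smooth]
        smooth_on_bilinear_field[OF U bilinear_contract3 G_smooth E_smooth V_smooth]] F_smooth])
  have q_nz: "q u \<noteq> 0" if "u \<in> U" for u using H_factor[OF that] H_nz by auto
  have "smooth_on U (\<lambda>u. (H / q u + q u) / 2)"
    by (intro smooth_on_divide[OF U] smooth_on_add[OF U] smooth_on_const q q_nz) simp_all
  from smooth_on_cong[OF U, THEN iffD2, OF _ this, of b4] have "smooth_on U b4" if "\<And>u. u \<in> U \<Longrightarrow> b4 u = (H / q u + q u) / 2"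
    using that by blast
  moreover have "b4 u = (H / q u + q u) / 2" if "u \<in> U" for u
    using H_factor[OF that] q_nz[OF that] by (simp add: field_simps)
  ultimately show ?thesis by blast
qed

lemma second_derivative:
  assumes u: "u \<in> U"
  shows "dd (\<lambda>w. dd \<phi> w Y) u X = dd \<phi> u (G u X Y) + hh u X Y *\<^sub>R \<xi> u"
proof -
  have d\<phi>: "(\<phi> has_derivative dd \<phi> u) (at u)" if "u \<in> U" for u by (rule smooth_on_has_derivative[OF \<phi>_smooth U that])
  have dp: "(pd \<phi> j has_derivative dd (pd \<phi> j) u) (at u)" for j by (rule smooth_on_has_derivative[OF pd_\<phi>_smooth U u])
  have "((\<lambda>w. \<Sum>j\<in>UNIV. Y$j *\<^sub>R pd \<phi> j w) has_derivative (\<lambda>z. \<Sum>j\<in>UNIV. Y$j *\<^sub>R dd (pd \<phi> j) u z)) (at u)"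
    by (intro has_derivative_sum has_derivative_scaleR_right dp)
  then have "((\<lambda>w. dd \<phi> w Y) has_derivative (\<lambda>z. \<Sum>j\<in>UNIV. Y$j *\<^sub>R dd (pd \<phi> j) u z)) (at u)"
    by (rule has_derivative_transform_within_open[OF _ U u]) (simp add: dd_axis3[OF d\<phi>, of _ Y] sum_3 pd_def)
  from fun_cong[OF dd_eq[OF this]]
  have "dd (\<lambda>w. dd \<phi> w Y) u X = (\<Sum>j\<in>UNIV. Y$j *\<^sub>R (\<Sum>i\<in>UNIV. X$i *\<^sub>R pd (pd \<phi> j) i u))"
    using dd_axis3[OF dp, of _ X] by (simp add: sum_3 pd_def[of "pd \<phi> _"])
  moreover have "dd \<phi> u (G u X Y) = (\<Sum>k\<in>UNIV. G u X Y $ k *\<^sub>R pd \<phi> k u)"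
    by (simp add: dd_axis3[OF d\<phi>[OF u], of "G u X Y"] sum_3 pd_def)
  ultimately show ?thesis
    by (simp add: struct[OF u] contract3_def hform_def sum_3 algebra_simps)
qed

lemma frame_independent:
  assumes u: "u \<in> U" and "dd \<phi> u X = c *\<^sub>R \<xi> u"
  shows "X = 0 \<and> c = 0"
proof -
  have "M u *v vector [X$1, X$2, X$3, - c] = 0"
    using assms(2) dd_axis3[OF smooth_on_has_derivative[OF \<phi>_smooth U u], of X]
    by (simp add: M_mult vector_4 pd_def)
  then have "vector [X$1, X$2, X$3, - c] = (0 :: real^4)" by (rule invertible_mult_eq_0[OF det_M[OF u]])
  then show ?thesis by (simp add: vec_eq_iff forall_4 vector_4 forall_3)
qed

lemma local_model:
  assumes p: "p \<in> U"
  shows "\<exists>W I N \<gamma> f (A :: real^4^4) c s. open W \<and> p \<in> W \<and> W \<subseteq> U \<and> (\<exists>a b. a < b \<and> I = {a<..<b}) \<and> open N \<and>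
    hyp_paraboloid_normal001 f N \<and> smooth_on I \<gamma> \<and> det A \<noteq> 0 \<and>
    bij_betw s W (prod_dom I N) \<and> smooth_on W s \<and> smooth_on (prod_dom I N) (inv_into W s) \<and>
    (\<forall>u\<in>W. A *v \<phi> u + c = model_map (\<lambda>v. v) \<gamma> f (s u))"
proof -
  obtain e where e: "e > 0" "ball p e \<subseteq> U" using U p open_contains_ball by blast
  let ?B = "ball p e"
  have BU: "u \<in> U" if "u \<in> ?B" for u using e that by blast
  have d\<phi>: "(\<phi> has_derivative dd \<phi> u) (at u)" and d\<xi>: "(\<xi> has_derivative dd \<xi> u) (at u)" if "u \<in> ?B" for u
    using smooth_on_has_derivative[OF _ U BU[OF that]] \<phi>_smooth \<xi>_smooth by blast+
  \<comment> \<open>The Weingarten equation with S = H Id cancels the derivative. The argument runs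
    on a ball because constancy needs a connected domain.\<close>
  have "((\<lambda>u. \<xi> u + H *\<^sub>R \<phi> u) has_derivative (\<lambda>z. 0)) (at u within ?B)" if u: "u \<in> ?B" for u
  proof -
    have w: "pd \<xi> i u = - (H *\<^sub>R pd \<phi> i u)" for i
    proof -
      have "(\<Sum>k\<in>UNIV. S u i k *\<^sub>R pd \<phi> k u) = (\<Sum>k\<in>UNIV. if i = k then H *\<^sub>R pd \<phi> k u else 0)"
        using umbilic BU[OF u] by (intro sum.cong) auto
      then show ?thesis using weingarten[OF BU[OF u], of i] by simp
    qed
    have "dd \<xi> u z + H *\<^sub>R dd \<phi> u z = 0" for z
      unfolding dd_axis3[OF d\<xi>[OF u], of z] dd_axis3[OF d\<phi>[OF u], of z]
      using w by (simp add: pd_def algebra_simps)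
    then show ?thesis
      using has_derivative_add[OF d\<xi>[OF u] has_derivative_scaleR_right[OF d\<phi>[OF u], of H]]
      by (auto intro: has_derivative_at_withinI)
  qed
  from has_derivative_zero_constant[OF convex_ball this]
  obtain k where k: "\<And>u. u \<in> ?B \<Longrightarrow> \<xi> u + H *\<^sub>R \<phi> u = k" by blast
  \<comment> \<open>The vector k / H is the common point of the affine normal lines, the centre of
    the sphere.\<close>
  define \<psi> where "\<psi> u = \<phi> u - (1 / H) *\<^sub>R k" for u
  have \<xi>: "\<xi> u = - (H *\<^sub>R \<psi> u)" if "u \<in> ?B" for u
    using H_nz by (simp add: \<psi>_def scaleR_diff_right flip: k[OF that])
  have d\<psi>: "dd \<psi> u = dd \<phi> u" if "u \<in> ?B" for u
    using dd_eq[OF has_derivative_diff[OF d\<phi>[OF that] has_derivative_const]] by (simp add: \<psi>_def[abs_def])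
  have dd\<psi>: "dd (\<lambda>w. dd \<psi> w Y) u X = dd (\<lambda>w. dd \<phi> w Y) u X" if "u \<in> ?B" for u X Y
    by (rule fun_cong[OF dd_cong[OF open_ball that]]) (simp only: d\<psi>)
  have sB: "smooth_on ?B f" if "smooth_on U f" for f :: "real^3 \<Rightarrow> 'b::real_normed_vector"
    by (rule smooth_on_subset[OF that U open_ball e(2)])
  \<comment> \<open>The last two arguments spell out \<open>\<theta>\<close> and \<open>C\<close>,
    which the locale fixes by definition.\<close>
  interpret X: so11_sphere ?B \<psi> hh G E V F b4 q H "\<lambda>u. hh u (V u)"
    "\<lambda>u X Y Z. b4 u * (hh u (V u) X * hh u Y Z + hh u (V u) Y * hh u X Z + hh u (V u) Z * hh u X Y
      - 5 * hh u (V u) X * hh u (V u) Y * hh u (V u) Z)"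
  proof unfold_locales
    show "smooth_on ?B \<psi>" unfolding \<psi>_def[abs_def]
      by (rule smooth_on_diff[OF open_ball sB[OF \<phi>_smooth] smooth_on_const])
    show "smooth_on ?B E" "smooth_on ?B V" "smooth_on ?B F" "smooth_on ?B b4"
      "smooth_on ?B (\<lambda>u. hh u X Y)" "smooth_on ?B (\<lambda>u. G u X Y)" for X Y
      by (intro sB E_smooth V_smooth F_smooth b4_smooth hh_smooth G_smooth)+
    fix u assume u: "u \<in> ?B"
    note uU = BU[OF u]
    show "hh u (E u) (E u) = 0" "hh u (F u) (F u) = 0" "hh u (E u) (F u) = 1" "hh u (V u) (V u) = 1"
      by (rule frame_metric[OF uU])+
    show "hh u (V u) (E u) = 0" "hh u (V u) (F u) = 0"
      using frame_metric[OF uU] hh_sym[OF uU] by metis+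
    show "hh u X Y = hh u Y X" "G u X Y = G u Y X" for X Y by (rule hh_sym[OF uU], rule G_sym[OF uU])
    show "b4 u > 0" by (rule b4_pos[OF uU])
    show "dd (\<lambda>w. dd \<psi> w Y) u X = dd \<psi> u (G u X Y) - (H * hh u X Y) *\<^sub>R \<psi> u" for X Y
      by (simp add: dd\<psi>[OF u] d\<psi>[OF u] second_derivative[OF uU] \<xi>[OF u] mult.commute)
    show "X = 0" if "dd \<psi> u X = c *\<^sub>R \<psi> u" for X c
    proof -
      have "dd \<phi> u X = (- c / H) *\<^sub>R \<xi> u" using that H_nz by (simp add: d\<psi>[OF u] \<xi>[OF u])
      then show ?thesis using frame_independent[OF uU] by blast
    qed
    show "\<psi> u \<noteq> 0"
    proof
      assume "\<psi> u = 0"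
      then have "dd \<phi> u 0 = 1 *\<^sub>R \<xi> u" using linear_0[OF dd_linear[OF d\<phi>[OF u]]] by (simp add: \<xi>[OF u])
      then show False using frame_independent[OF uU] by force
    qed
    show "q u = hh u (dd V u (E u) + G u (E u) (V u)) (F u)" by (rule q_def)
    show "H = q u * (2 * b4 u - q u)" by (rule H_factor[OF uU])
    show "dd (\<lambda>w. hh w X Y) u Z = hh u (G u Z X) Y + hh u X (G u Z Y)
        - 2 * (b4 u * (hh u (V u) X * hh u Y Z + hh u (V u) Y * hh u X Z + hh u (V u) Z * hh u X Y
      - 5 * hh u (V u) X * hh u (V u) Y * hh u (V u) Z))" for X Y Z
    proof -
      note lin = bilinear_ladd[OF bilinear_hform] bilinear_radd[OF bilinear_hform] bilinear_lsub[OF bilinear_hform]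
        bilinear_rsub[OF bilinear_hform] bilinear_lmul[OF bilinear_hform] bilinear_rmul[OF bilinear_hform]
      have L: "L u X Y = G u X Y - K u X Y" for X Y by (simp add: K_def)
      show ?thesis
        unfolding levi_civita[OF uU] L lin K_formula[OF uU]
        by (simp add: hh_sym[OF uU, of X "V u"] hh_sym[OF uU, of Z] algebra_simps)
    qed
  qed (use H_nz bilinear_hform bilinear_contract3 in auto)
  obtain W I N \<gamma> f A s where m: "open W" "p \<in> W" "W \<subseteq> ?B" "\<exists>a b. a < b \<and> I = {a<..<b}" "open N"
    "hyp_paraboloid_normal001 f N" "smooth_on I \<gamma>" "det (A :: real^4^4) \<noteq> 0"
    "bij_betw s W (prod_dom I N)" "smooth_on W s" "smooth_on (prod_dom I N) (inv_into W s)"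
    "\<forall>u\<in>W. A *v \<psi> u = model_map (\<lambda>v. v) \<gamma> f (s u)"
    using X.local_model[OF centre_in_ball[THEN iffD2, OF e(1)]] by blast
  have "W \<subseteq> U" using m(3) e(2) by blast
  moreover have "\<forall>u\<in>W. A *v \<phi> u + - (A *v ((1 / H) *\<^sub>R k)) = model_map (\<lambda>v. v) \<gamma> f (s u)"
    using m(12) by (simp add: \<psi>_def matrix_vector_mult_diff_distrib)
  ultimately show ?thesis using m(1,2,4-11) by blast
qed

end

theorem theorem8p18:
  fixes U :: "(real^3) set" and \<phi> \<xi> :: "real^3 \<Rightarrow> real^4"
    and Gam :: "real^3 \<Rightarrow> 3 \<Rightarrow> 3 \<Rightarrow> 3 \<Rightarrow> real"
    and h S :: "real^3 \<Rightarrow> 3 \<Rightarrow> 3 \<Rightarrow> real" and H :: real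
    and E V F :: "real^3 \<Rightarrow> real^3" and b4 :: "real^3 \<Rightarrow> real"
  assumes "blaschke_hypersurface U \<phi> \<xi> Gam h S"
    and "\<forall>u\<in>U. \<forall>i k. S u i k = (if i = k then H else 0)"
    and "H \<noteq> 0"
    and "indefinite_on U h"
    and "pointwise_SO11_symmetric U Gam h"
    and "so11_frame U Gam h E V F b4"
    and "\<forall>u\<in>U. H = (b4 u)^2 - (alpha12 h E V F u)^2"
  shows "\<forall>p\<in>U. \<exists>W I N g1 g2 f (A :: real^4^4) (c :: real^4) \<sigma>.
           open W \<and> p \<in> W \<and> W \<subseteq> U \<and>
           (\<exists>a b. a < b \<and> I = {a<..<b}) \<and> open N \<and>
           hyp_paraboloid_normal001 f N \<and>
           smooth_on I g1 \<and> smooth_on I g2 \<and>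
           det A \<noteq> 0 \<and>
           bij_betw \<sigma> W (prod_dom I N) \<and> smooth_on W \<sigma> \<and>
           smooth_on (prod_dom I N) (inv_into W \<sigma>) \<and>
           (\<forall>u\<in>W. A *v \<phi> u + c = model_map g1 g2 f (\<sigma> u))"
proof
  fix p assume p: "p \<in> U"
  interpret so11_hypersurface U \<phi> \<xi> Gam h S H E V F b4
    using assms by unfold_locales
  obtain W I N \<gamma> f A c s where m: "open W" "p \<in> W" "W \<subseteq> U" "\<exists>a b. a < b \<and> I = {a<..<b}" "open N"
    "hyp_paraboloid_normal001 f N" "smooth_on I \<gamma>" "det (A :: real^4^4) \<noteq> 0"
    "bij_betw s W (prod_dom I N)" "smooth_on W s" "smooth_on (prod_dom I N) (inv_into W s)"
    "\<forall>u\<in>W. A *v \<phi> u + c = model_map (\<lambda>v. v) \<gamma> f (s u)"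
    using local_model[OF p] by blast
  have "smooth_on I (\<lambda>v. v)"
    using m(4) smooth_on_linear[OF _ bounded_linear_ident, of I] by auto
  then show "\<exists>W I N g1 g2 f (A :: real^4^4) (c :: real^4) \<sigma>.
           open W \<and> p \<in> W \<and> W \<subseteq> U \<and>
           (\<exists>a b. a < b \<and> I = {a<..<b}) \<and> open N \<and>
           hyp_paraboloid_normal001 f N \<and>
           smooth_on I g1 \<and> smooth_on I g2 \<and>
           det A \<noteq> 0 \<and>
           bij_betw \<sigma> W (prod_dom I N) \<and> smooth_on W \<sigma> \<and>
           smooth_on (prod_dom I N) (inv_into W \<sigma>) \<and>
           (\<forall>u\<in>W. A *v \<phi> u + c = model_map g1 g2 f (\<sigma> u))"
    using m by blast
qed

end
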